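(* Let $l\ge 0$ be an integer and let $J\in L^1(\mathbf R)$ be non-negative, even, and not almost everywhere zero, and suppose that its moments $\mu_k=\int_{\mathbf R}x^kJ(x)\,dx$ exist for all integers $0\le k\le l+2$. Let $c>0$ and $D\colon L^2(\mathbf R)\to L^2(\mathbf R)$ be the constant and operator associated with $J$ as described in the context. Suppose that $u$ satisfies the integrodifferential equation \[ u_{tt}+\mu_0u=J\star u \] and that $u$ and $\partial_tu$ belong to the Schwartz class $\mathcal S(\mathbf R)$ when $t=0$. Then for every $v\in\mathbf R$ with $|v|>c$ and every $x_0\in\mathbf R$ there is a constant $C$ such that \[ |\partial_tu(t,x_0+vt)|^2+c^2|(Du)(t,x_0+vt)|^2\le C\,t^{-2l} \] for all $t>0$.
   Context: All integrals are Lebesgue integrals, so existence of $\mu_k$ means $\int_{\mathbf R}|x|^kJ(x)\,dx<\infty$. The convolution $J\star u$ is in the spatial variable only, for each $t$. The solution $u=u(t,x)$ is regarded as a twice continuously differentiable function of $t$ with values in $L^2(\mathbf R)$ (in the variable $x$), and $D$ acts in the spatial variable; $\partial_tu(t,\cdot)$ and $Du(t,\cdot)$ are identified with their continuous representatives. Definition of $c$ and $D$: they are the unique $c>0$ and unique bounded translation-invariant operator $D$ on $L^2(\mathbf R)$ such that (1) $J\star w-\mu_0w=c^2D^2w$ for all $w\in L^2(\mathbf R)$; (2) $HD$ is a positive operator, where $(Hw)(x)=\lim_{\epsilon\to0^+}\int_{|x-y|>\epsilon}\frac{w(y)}{x-y}\,dy$ is the Hilbert transform; (3) with $(S_\lambda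 w)(x)=w(\lambda^{-1}x)$, $\lim_{h\to0^+}h^{-1}S_hDS_{h^{-1}}w=w_x$ weakly in $L^2(\mathbf R)$ for every $w\in L^2(\mathbf R)$ with weak derivative $w_x\in L^2(\mathbf R)$. Explicitly, with $(Fw)(\xi)=\int_{\mathbf R}w(x)e^{-2\pi i\xi x}\,dx$, one has $c=\sqrt{\mu_2/2}$ and $(FDw)(\xi)=2\pi i\,\psi(\xi)(Fw)(\xi)$, where $\psi$ is the odd real function with $\psi(\xi)\ge 0$ for $\xi>0$ and $\psi(\xi)^2=\dfrac{\mu_0-(FJ)(\xi)}{2\pi^2\mu_2}$. *)

theory Defs
  imports "HOL-Analysis.Analysis"
begin

section \<open>The Hilbert space \<open>L\<^sup>2(\<real>)\<close> of complex-valued functions\<close>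

definition square_integrable :: "(real \<Rightarrow> complex) \<Rightarrow> bool" where
  "square_integrable f \<longleftrightarrow>
     f \<in> borel_measurable lborel \<and> integrable lborel (\<lambda>x. (cmod (f x))\<^sup>2)"

lemma square_integrable_zero: "square_integrable (\<lambda>x. 0)"
  by (simp add: square_integrable_def)

lemma square_integrable_mult_cnj:
  assumes "square_integrable f" "square_integrable g"
  shows "integrable lborel (\<lambda>x. f x * cnj (g x))"
proof (rule Bochner_Integration.integrable_bound)
  show "integrable lborel (\<lambda>x. (cmod (f x))\<^sup>2 + (cmod (g x))\<^sup>2)"
    using assms by (simp add: square_integrable_def)
  have [measurable]: "f \<in> borel_measurable lborel" "g \<in> borel_measurable lborel"
    using assms by (auto simp: square_integrable_def)
  have [measurable]: "cnj \<in> borel_measurable borel"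
    by (intro borel_measurable_continuous_onI continuous_intros)
  show "(\<lambda>x. f x * cnj (g x)) \<in> borel_measurable lborel"
    by measurable
  have "a * b \<le> a\<^sup>2 + b\<^sup>2" if "a \<ge> 0" "b \<ge> 0" for a b :: real
    using sum_squares_bound[of a b] mult_nonneg_nonneg[OF that] by linarith
  then show "AE x in lborel. norm (f x * cnj (g x)) \<le> norm ((cmod (f x))\<^sup>2 + (cmod (g x))\<^sup>2)"
    by (simp add: norm_mult)
qed

lemma square_integrable_add:
  assumes "square_integrable f" "square_integrable g"
  shows "square_integrable (\<lambda>x. f x + g x)"
  unfolding square_integrable_def
proof
  have [measurable]: "f \<in> borel_measurable lborel" "g \<in> borel_measurable lborel"
    using assms by (auto simp: square_integrable_def)
  show "(\<lambda>x. f x + g x) \<in> borel_measurable lborel"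
    by measurable
  show "integrable lborel (\<lambda>x. (cmod (f x + g x))\<^sup>2)"
  proof (rule Bochner_Integration.integrable_bound)
    show "integrable lborel (\<lambda>x. 2 * (cmod (f x))\<^sup>2 + 2 * (cmod (g x))\<^sup>2)"
      using assms by (simp add: square_integrable_def)
    have "(cmod (a + b))\<^sup>2 \<le> 2 * (cmod a)\<^sup>2 + 2 * (cmod b)\<^sup>2" for a b :: complex
    proof -
      have "(cmod (a + b))\<^sup>2 \<le> (cmod a + cmod b)\<^sup>2"
        by (intro power_mono norm_triangle_ineq) auto
      also have "\<dots> \<le> 2 * (cmod a)\<^sup>2 + 2 * (cmod b)\<^sup>2"
        using sum_squares_bound[of "cmod a" "cmod b"] by (simp add: power2_sum)
      finally show ?thesis .
    qed
    then show "AE x in lborel. norm ((cmod (f x + g x))\<^sup>2)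
                 \<le> norm (2 * (cmod (f x))\<^sup>2 + 2 * (cmod (g x))\<^sup>2)"
      by simp
  qed measurable
qed

lemma square_integrable_cmult:
  assumes "square_integrable f"
  shows "square_integrable (\<lambda>x. c * f x)"
  using assms by (auto simp: square_integrable_def norm_mult power_mult_distrib)

lemma AE_lborel_affine:
  fixes P :: "real \<Rightarrow> bool"
  assumes "AE x in lborel. P x" "c \<noteq> 0"
  shows "AE x in lborel. P (t + c * x)"
proof -
  obtain N where N: "N \<in> sets lborel" "emeasure lborel N = 0" "{x. \<not> P x} \<subseteq> N"
    using assms(1) by (auto elim!: AE_E)
  have "AE x in lborel. x \<notin> N"
    using N by (intro AE_not_in) (auto simp: null_sets_def)
  then have "AE x in density (distr lborel borel (\<lambda>x. t + c * x)) (\<lambda>_. \<bar>c\<bar>). x \<notin> N"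
    by (subst (asm) lborel_real_affine[OF assms(2), of t]) simp
  then have "AE x in distr lborel borel (\<lambda>x. t + c * x). x \<notin> N"
    using assms(2) by (subst (asm) AE_density) auto
  then have "AE x in lborel. t + c * x \<notin> N"
    using N(1) by (subst (asm) AE_distr_iff) auto
  then show ?thesis
    by (rule eventually_mono) (use N(3) in auto)
qed

lemma square_integrable_affine:
  assumes "square_integrable f" "c \<noteq> 0"
  shows "square_integrable (\<lambda>x. f (t + c * x))"
  using assms lborel_integrable_real_affine[of "\<lambda>x. (cmod (f x))\<^sup>2" c t]
  by (auto simp: square_integrable_def)

quotient_type l2 = "real \<Rightarrow> complex" / partial:
  "\<lambda>f g. square_integrable f \<and> square_integrable g \<and> (AE x in lborel. f x = g x)"
proof (rule part_equivpI)
  show "\<exists>f. square_integrable f \<and> square_integrable f \<and> (AE x in lborel. f x = f x)"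
    using square_integrable_zero by auto
  show "symp (\<lambda>f g. square_integrable f \<and> square_integrable g \<and> (AE x in lborel. f x = g x))"
    by (auto simp: symp_def eq_commute)
  show "transp (\<lambda>f g. square_integrable f \<and> square_integrable g \<and> (AE x in lborel. f x = g x))"
    by (auto simp: transp_def elim: AE_mp[OF _ AE_mp])
qed

text \<open>
  \<open>rep_l2 w\<close> is an arbitrary measurable representative of the class \<open>w\<close>.  Below it only occurs
  under an almost-everywhere quantifier or under an integral, so the choice does not matter.
\<close>

instantiation l2 :: real_inner
begin

lift_definition zero_l2 :: l2 is "\<lambda>x. 0"
  by (simp add: square_integrable_zero)

lift_definition plus_l2 :: "l2 \<Rightarrow> l2 \<Rightarrow> l2" is "\<lambda>f g x. f x + g x"
  by (auto intro!: square_integrable_add)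

lift_definition uminus_l2 :: "l2 \<Rightarrow> l2" is "\<lambda>f x. - f x"
  using square_integrable_cmult[of _ "-1"] by auto

definition minus_l2 :: "l2 \<Rightarrow> l2 \<Rightarrow> l2" where
  "minus_l2 v w = v + - w"

lift_definition scaleR_l2 :: "real \<Rightarrow> l2 \<Rightarrow> l2" is "\<lambda>r f x. complex_of_real r * f x"
  by (auto intro!: square_integrable_cmult)

lift_definition inner_l2 :: "l2 \<Rightarrow> l2 \<Rightarrow> real" is
  "\<lambda>f g. Re (LINT x|lborel. f x * cnj (g x))"
proof -
  fix f f' g g' :: "real \<Rightarrow> complex"
  assume A: "square_integrable f \<and> square_integrable f' \<and> (AE x in lborel. f x = f' x)"
    "square_integrable g \<and> square_integrable g' \<and> (AE x in lborel. g x = g' x)"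
  have "(LINT x|lborel. f x * cnj (g x)) = (LINT x|lborel. f' x * cnj (g' x))"
  proof (rule integral_cong_AE)
    show "AE x in lborel. f x * cnj (g x) = f' x * cnj (g' x)"
      using A by auto
  qed (rule borel_measurable_integrable, rule square_integrable_mult_cnj; use A in simp)+
  then show "Re (LINT x|lborel. f x * cnj (g x)) = Re (LINT x|lborel. f' x * cnj (g' x))"
    by simp
qed

definition norm_l2 :: "l2 \<Rightarrow> real" where
  "norm_l2 w = sqrt (inner w w)"

definition sgn_l2 :: "l2 \<Rightarrow> l2" where
  "sgn_l2 w = scaleR (inverse (norm w)) w"

definition dist_l2 :: "l2 \<Rightarrow> l2 \<Rightarrow> real" where
  "dist_l2 v w = norm (v - w)"

definition uniformity_l2 :: "(l2 \<times> l2) filter" where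
  "uniformity_l2 = (INF e\<in>{0<..}. principal {(v, w). dist v w < e})"

definition open_l2 :: "l2 set \<Rightarrow> bool" where
  "open_l2 U = (\<forall>w\<in>U. eventually (\<lambda>(w', v). w' = w \<longrightarrow> v \<in> U) uniformity)"

instance
proof
  fix a b c :: l2 and r s :: real
  show "a + b + c = a + (b + c)"
    by transfer (auto intro!: square_integrable_add simp: add.assoc)
  show "a + b = b + a"
    by transfer (auto intro!: square_integrable_add simp: add.commute)
  show "0 + a = a"
    by transfer auto
  show "- a + a = 0"
    by transfer (auto simp: square_integrable_zero)
  show "a - b = a + - b"
    by (rule minus_l2_def)
  show "r *\<^sub>R (a + b) = r *\<^sub>R a + r *\<^sub>R b"
    by transfer (auto intro!: square_integrable_add square_integrable_cmult simp: distrib_left)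
  show "(r + s) *\<^sub>R a = r *\<^sub>R a + s *\<^sub>R a"
    by transfer
      (auto intro!: square_integrable_add square_integrable_cmult
        simp: distrib_right)
  show "r *\<^sub>R s *\<^sub>R a = (r * s) *\<^sub>R a"
    by transfer (auto intro!: square_integrable_cmult simp: mult.assoc)
  show "1 *\<^sub>R a = a"
    by transfer auto
  show "dist a b = norm (a - b)"
    by (rule dist_l2_def)
  show "sgn a = scaleR (inverse (norm a)) a"
    by (rule sgn_l2_def)
  show "norm a = sqrt (inner a a)"
    by (rule norm_l2_def)
  show "(uniformity :: (l2 \<times> l2) filter) = (INF e\<in>{0<..}. principal {(v, w). dist v w < e})"
    by (rule uniformity_l2_def)
  show "open U = (\<forall>w\<in>U. eventually (\<lambda>(w', v). w' = w \<longrightarrow> v \<in> U) uniformity)" for U :: "l2 set"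
    by (rule open_l2_def)
  show "inner a b = inner b a"
  proof transfer
    fix f g :: "real \<Rightarrow> complex"
    have "(LINT x|lborel. f x * cnj (g x)) = (LINT x|lborel. cnj (g x * cnj (f x)))"
      by (simp add: mult.commute)
    also have "\<dots> = cnj (LINT x|lborel. g x * cnj (f x))"
      by (rule Bochner_Integration.integral_cnj)
    finally show "Re (LINT x|lborel. f x * cnj (g x)) = Re (LINT x|lborel. g x * cnj (f x))"
      by simp
  qed
  show "inner (a + b) c = inner a c + inner b c"
    by transfer (simp add: distrib_right square_integrable_mult_cnj)
  show "inner (r *\<^sub>R a) b = r * inner a b"
    by transfer (simp add: mult.assoc)
  have sq: "Re (LINT x|lborel. f x * cnj (f x)) = (LINT x|lborel. (cmod (f x))\<^sup>2)"
    for f :: "real \<Rightarrow> complex"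
    by (simp add: complex_norm_square[symmetric] flip: of_real_power)
  show "0 \<le> inner a a"
    by transfer (simp add: sq)
  show "inner a a = 0 \<longleftrightarrow> a = 0"
  proof transfer
    fix f :: "real \<Rightarrow> complex"
    assume "square_integrable f \<and> square_integrable f \<and> (AE x in lborel. f x = f x)"
    then have f: "square_integrable f" and "integrable lborel (\<lambda>x. (cmod (f x))\<^sup>2)"
      by (auto simp: square_integrable_def)
    then have "(LINT x|lborel. (cmod (f x))\<^sup>2) = 0 \<longleftrightarrow> (AE x in lborel. (cmod (f x))\<^sup>2 = 0)"
      by (intro integral_nonneg_eq_0_iff_AE) auto
    then show "(Re (LINT x|lborel. f x * cnj (f x)) = 0) =
        (square_integrable f \<and> square_integrable (\<lambda>x. 0) \<and> (AE x in lborel. f x = 0))"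
      using f by (simp add: sq square_integrable_zero)
  qed
qed

end

lift_definition scaleC :: "complex \<Rightarrow> l2 \<Rightarrow> l2" is "\<lambda>z f x. z * f x"
  by (auto intro!: square_integrable_cmult)

text \<open>The full complex inner product, linear in its first argument; \<open>inner\<close> is its real part.\<close>

definition cinner :: "l2 \<Rightarrow> l2 \<Rightarrow> complex" where
  "cinner v w = (LINT x|lborel. rep_l2 v x * cnj (rep_l2 w x))"

lift_definition translate :: "real \<Rightarrow> l2 \<Rightarrow> l2" is "\<lambda>a f x. f (x - a)"
  subgoal for a f g
    using AE_lborel_affine[where c = 1 and t = "- a" and P = "\<lambda>x. f x = g x"]
      square_integrable_affine[where c = 1 and t = "- a" and f = f]
      square_integrable_affine[where c = 1 and t = "- a" and f = g]
    by simp
  done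

text \<open>Only \<open>dilate r\<close> with \<open>r \<noteq> 0\<close> is meaningful; the value at \<open>r = 0\<close> is a dummy.\<close>

lift_definition dilate :: "real \<Rightarrow> l2 \<Rightarrow> l2" is
  "\<lambda>r f x. if r = 0 then 0 else f (inverse r * x)"
  subgoal for r f g
    using AE_lborel_affine[where c = "inverse r" and t = 0 and P = "\<lambda>x. f x = g x"]
      square_integrable_affine[where c = "inverse r" and t = 0 and f = f]
      square_integrable_affine[where c = "inverse r" and t = 0 and f = g]
    by (cases "r = 0") (auto simp: square_integrable_zero)
  done


section \<open>Smooth functions and weak derivatives\<close>

definition derivs_of :: "(real \<Rightarrow> complex) \<Rightarrow> (nat \<Rightarrow> real \<Rightarrow> complex) \<Rightarrow> bool" where
  "derivs_of f d \<longleftrightarrow> d 0 = f \<and> (\<forall>n x. (d n has_vector_derivative d (Suc n) x) (at x))"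

definition schwartz :: "(real \<Rightarrow> complex) \<Rightarrow> bool" where
  "schwartz f \<longleftrightarrow>
     (\<exists>d. derivs_of f d \<and> (\<forall>m n. bounded (range (\<lambda>x. x ^ m *\<^sub>R d n x))))"

definition in_schwartz :: "l2 \<Rightarrow> bool" where
  "in_schwartz w \<longleftrightarrow> (\<exists>f. schwartz f \<and> (AE x in lborel. rep_l2 w x = f x))"

definition test_function :: "(real \<Rightarrow> complex) \<Rightarrow> bool" where
  "test_function f \<longleftrightarrow> (\<exists>d. derivs_of f d) \<and> (\<exists>K. \<forall>x. \<bar>x\<bar> > K \<longrightarrow> f x = 0)"

definition has_weak_derivative :: "l2 \<Rightarrow> l2 \<Rightarrow> bool" where
  "has_weak_derivative w w' \<longleftrightarrow>
     (\<forall>f. test_function f \<longrightarrow>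
        (LINT x|lborel. rep_l2 w x * vector_derivative f (at x)) =
        - (LINT x|lborel. rep_l2 w' x * f x))"

definition continuous_representative :: "l2 \<Rightarrow> (real \<Rightarrow> complex) \<Rightarrow> bool" where
  "continuous_representative w g \<longleftrightarrow>
     continuous_on UNIV g \<and> (AE x in lborel. rep_l2 w x = g x)"


section \<open>Convolution, Hilbert transform, and the operator \<open>D\<close>\<close>

definition moment :: "(real \<Rightarrow> real) \<Rightarrow> nat \<Rightarrow> real" where
  "moment J k = (LINT x|lborel. x ^ k * J x)"

definition conv :: "(real \<Rightarrow> real) \<Rightarrow> l2 \<Rightarrow> real \<Rightarrow> complex" where
  "conv J w x = (LINT y|lborel. J (x - y) *\<^sub>R rep_l2 w y)"

definition is_hilbert_transform :: "l2 \<Rightarrow> l2 \<Rightarrow> bool" where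
  "is_hilbert_transform w z \<longleftrightarrow>
     (AE x in lborel.
        ((\<lambda>\<epsilon>. LINT y:{y. \<bar>x - y\<bar> > \<epsilon>}|lborel. rep_l2 w y / complex_of_real (x - y))
           \<longlongrightarrow> rep_l2 z x) (at_right 0))"

text \<open>
  The almost-everywhere limit determines \<open>z\<close>, and by the classical theory it exists in
  \<open>L\<^sup>2(\<real>)\<close> for every \<open>w\<close>.
\<close>

definition hilbert :: "l2 \<Rightarrow> l2" where
  "hilbert w = (THE z. is_hilbert_transform w z)"

definition bounded_operator :: "(l2 \<Rightarrow> l2) \<Rightarrow> bool" where
  "bounded_operator T \<longleftrightarrow> bounded_linear T \<and> (\<forall>z w. T (scaleC z w) = scaleC z (T w))"

definition translation_invariant :: "(l2 \<Rightarrow> l2) \<Rightarrow> bool" where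
  "translation_invariant T \<longleftrightarrow> (\<forall>a w. T (translate a w) = translate a (T w))"

text \<open>On a complex Hilbert space, positivity of the quadratic form includes self-adjointness.\<close>

definition positive_operator :: "(l2 \<Rightarrow> l2) \<Rightarrow> bool" where
  "positive_operator T \<longleftrightarrow> (\<forall>w. cinner (T w) w \<in> \<real>\<^sub>\<ge>\<^sub>0)"

definition weakly_tendsto :: "('a \<Rightarrow> l2) \<Rightarrow> l2 \<Rightarrow> 'a filter \<Rightarrow> bool" where
  "weakly_tendsto f w F \<longleftrightarrow> (\<forall>z. ((\<lambda>a. cinner (f a) z) \<longlongrightarrow> cinner w z) F)"

text \<open>
  If \<open>J\<close> is non-negative, even, not almost everywhere zero, and has a finite second moment, then
  exactly one pair \<open>c\<close>, \<open>D\<close> satisfies these conditions.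
\<close>

definition associated :: "(real \<Rightarrow> real) \<Rightarrow> real \<Rightarrow> (l2 \<Rightarrow> l2) \<Rightarrow> bool" where
  "associated J c D \<longleftrightarrow>
     c > 0 \<and> bounded_operator D \<and> translation_invariant D \<and>
     (\<forall>w. AE x in lborel.
        conv J w x - moment J 0 *\<^sub>R rep_l2 w x = c\<^sup>2 *\<^sub>R rep_l2 (D (D w)) x) \<and>
     positive_operator (\<lambda>w. hilbert (D w)) \<and>
     (\<forall>w w'. has_weak_derivative w w' \<longrightarrow>
        weakly_tendsto (\<lambda>h. inverse h *\<^sub>R dilate h (D (dilate (inverse h) w))) w' (at_right 0))"

text \<open>
  Solutions live on \<open>t \<ge> 0\<close>; the derivatives at \<open>t = 0\<close> are one-sided.  The functions \<open>u'\<close> and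
  \<open>u''\<close> are the first and second time derivatives of \<open>u\<close> in the norm of \<open>L\<^sup>2(\<real>)\<close>.
\<close>

definition is_solution ::
  "(real \<Rightarrow> real) \<Rightarrow> (real \<Rightarrow> l2) \<Rightarrow> (real \<Rightarrow> l2) \<Rightarrow> (real \<Rightarrow> l2) \<Rightarrow> bool" where
  "is_solution J u u' u'' \<longleftrightarrow>
     (\<forall>t\<ge>0. (u has_vector_derivative u' t) (at t within {0..})) \<and>
     (\<forall>t\<ge>0. (u' has_vector_derivative u'' t) (at t within {0..})) \<and>
     continuous_on {0..} u'' \<and>
     (\<forall>t\<ge>0. AE x in lborel.
        rep_l2 (u'' t) x + moment J 0 *\<^sub>R rep_l2 (u t) x = conv J (u t) x)"

end

theory Submission
  imports Defs "HOL-Probability.Probability"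
begin

text \<open>
  On the Fourier side \<open>(cD)\<^sup>2\<close> is multiplication by \<open>-\<omega>\<^sup>2\<close> with \<open>\<omega>\<^sup>2 = \<mu>\<^sub>0 - FJ\<close>.  Translation
  invariance makes \<open>cD\<close> commute with Fourier multipliers, and positivity of \<open>HD\<close> then selects the
  square root \<open>i \<theta>\<close> with \<open>\<theta> = sgn \<cdot> \<omega>\<close>; the scaling limit gives \<open>c = sqrt (\<mu>\<^sub>2 / 2)\<close>.  The functions
  \<open>u' \<plusminus> cDu\<close> solve \<open>f' = \<plusminus> cDf\<close>, so at \<open>x\<^sub>0 + v t\<close> they are oscillatory integrals with phase
  \<open>t (2 \<pi> v \<xi> \<plusminus> \<theta> \<xi>)\<close>.  Since \<open>\<bar>\<theta>'\<bar> \<le> 2 \<pi> c\<close>, the phase has no stationary point for \<open>\<bar>v\<bar> > c\<close>,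
  and \<open>l\<close> integrations by parts are possible because \<open>\<theta>\<close> has \<open>l + 1\<close> derivatives.
\<close>

section \<open>The Hilbert space \<open>L\<^sup>2\<close>\<close>

text \<open>The operator \<open>D\<close> is accessible only through its axioms, while explicit
  formulas exist only on the elements \<open>FT a\<close> with \<open>a\<close> integrable and
  square integrable; these are dense. The obstacle is that \<open>D (FT a)\<close> is just some
  element of L^2, on which the Hilbert transform has no formula. Applying \<open>D\<close> once more
  leads back to an explicit element, by axiom (1). Positivity of \<open>HD\<close> is therefore
  tested at the vector \<open>D (FT a)\<close>, and the surplus factors \<omega> are cancelled
  afterwards by moving a bounded multiplier across \<open>D\<close>.

  The two moments beyond \<open>l\<close> pay for the behaviour at frequency 0, where \<omega> has a
  corner: \<theta> is smooth there because \<omega>^2 can be divided by the square of the frequency,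
  and this quotient is an average of the second derivative of \<omega>^2. The same quotient must not
  decay too fast at infinity, which is the Riemann-Lebesgue lemma. The bound on the derivative of
  \<theta> is the Cauchy-Schwarz inequality with weight \<open>J\<close>. Its constant is the slope
  of \<theta> at 0, which is what the scaling axiom sees.\<close>

lemma square_integrable_rep: "square_integrable (rep_l2 w)"
  using Quotient3_rep_reflp[OF Quotient3_l2] by auto

lemma abs_rep_l2: "abs_l2 (rep_l2 w) = w"
  using Quotient3_abs_rep[OF Quotient3_l2] by auto

lemma rep_abs_l2: "square_integrable f \<Longrightarrow> AE x in lborel. rep_l2 (abs_l2 f) x = f x"
  using rep_abs_rsp_left[OF Quotient3_l2, of f f] by auto

lemma abs_l2_eqI:
  "square_integrable f \<Longrightarrow> square_integrable g \<Longrightarrow> AE x in lborel. f x = g x \<Longrightarrow> abs_l2 f = abs_l2 g"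
  using Quotient3_rel[OF Quotient3_l2, of f g] by auto

lemma l2_eqI: "AE x in lborel. rep_l2 v x = rep_l2 w x \<Longrightarrow> v = w"
  using abs_l2_eqI[OF square_integrable_rep square_integrable_rep] abs_rep_l2 by metis

lemma eq_abs_l2I:
  assumes "square_integrable f" "AE x in lborel. rep_l2 v x = f x"
  shows "v = abs_l2 f"
  using abs_l2_eqI[OF square_integrable_rep assms] abs_rep_l2 by metis

lemma abs_l2_add:
  "square_integrable f \<Longrightarrow> square_integrable g \<Longrightarrow> abs_l2 f + abs_l2 g = abs_l2 (\<lambda>x. f x + g x)"
  by (rule plus_l2.abs_eq) auto
lemma abs_l2_uminus:
  "square_integrable f \<Longrightarrow> - abs_l2 f = abs_l2 (\<lambda>x. - f x)"
  by (rule uminus_l2.abs_eq) auto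
lemma abs_l2_diff:
  "square_integrable f \<Longrightarrow> square_integrable g \<Longrightarrow> abs_l2 f - abs_l2 g = abs_l2 (\<lambda>x. f x - g x)"
  using square_integrable_cmult[of g "-1"]
  by (simp add: minus_l2_def abs_l2_uminus abs_l2_add)
lemma abs_l2_scaleR:
  "square_integrable f \<Longrightarrow> r *\<^sub>R abs_l2 f = abs_l2 (\<lambda>x. complex_of_real r * f x)"
  by (rule scaleR_l2.abs_eq) auto
lemma abs_l2_scaleC:
  "square_integrable f \<Longrightarrow> scaleC z (abs_l2 f) = abs_l2 (\<lambda>x. z * f x)"
  by (rule scaleC.abs_eq) auto
lemma abs_l2_translate:
  "square_integrable f \<Longrightarrow> translate a (abs_l2 f) = abs_l2 (\<lambda>x. f (x - a))"
  by (rule translate.abs_eq) auto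
lemma abs_l2_dilate:
  "square_integrable f \<Longrightarrow> r \<noteq> 0 \<Longrightarrow> dilate r (abs_l2 f) = abs_l2 (\<lambda>x. f (inverse r * x))"
  using dilate.abs_eq[of f r] by auto

lemma cinner_abs_l2:
  assumes "square_integrable f" "square_integrable g"
  shows "cinner (abs_l2 f) (abs_l2 g) = (LINT x|lborel. f x * cnj (g x))"
  unfolding cinner_def
proof (rule integral_cong_AE)
  show "AE x in lborel. rep_l2 (abs_l2 f) x * cnj (rep_l2 (abs_l2 g) x) = f x * cnj (g x)"
    using rep_abs_l2[OF assms(1)] rep_abs_l2[OF assms(2)] by eventually_elim auto
qed (rule borel_measurable_integrable, rule square_integrable_mult_cnj, (rule assms square_integrable_rep)+)+

lemma inner_abs_l2:
  assumes "square_integrable f" "square_integrable g"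
  shows "inner (abs_l2 f) (abs_l2 g) = Re (LINT x|lborel. f x * cnj (g x))"
  using assms by (intro inner_l2.abs_eq) auto

lemma Re_cinner: "Re (cinner v w) = inner v w"
  using inner_abs_l2[of "rep_l2 v" "rep_l2 w"] by (simp add: square_integrable_rep abs_rep_l2 cinner_def)

lemma norm_abs_l2:
  assumes "square_integrable f"
  shows "(norm (abs_l2 f))\<^sup>2 = (LINT x|lborel. (cmod (f x))\<^sup>2)"
  unfolding power2_norm_eq_inner[of "abs_l2 f"] inner_abs_l2[OF assms assms]
  by (simp add: complex_norm_square[symmetric] flip: of_real_power)

lemma l2_abs_cases: obtains f where "square_integrable f" "w = abs_l2 f"
  using square_integrable_rep abs_rep_l2 by metis

section \<open>The complex inner product\<close>

lemma cinner_add_left: "cinner (v + w) z = cinner v z + cinner w z"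
  by (rule l2_abs_cases[of v]; rule l2_abs_cases[of w]; rule l2_abs_cases[of z])
     (simp add: abs_l2_add cinner_abs_l2 square_integrable_add distrib_right square_integrable_mult_cnj)

lemma scaleC_add: "scaleC z (v + w) = scaleC z v + scaleC z w"
  by (rule l2_abs_cases[of v]; rule l2_abs_cases[of w])
     (simp add: abs_l2_add abs_l2_scaleC square_integrable_add square_integrable_cmult distrib_left)

lemma scaleC_scaleC: "scaleC y (scaleC z v) = scaleC (y * z) v"
  by (rule l2_abs_cases[of v])
     (simp add: abs_l2_scaleC square_integrable_cmult mult.assoc)

lemma scaleC_of_real: "scaleC (of_real r) v = r *\<^sub>R v"
  by (rule l2_abs_cases[of v]) (simp add: abs_l2_scaleC abs_l2_scaleR)

lemma scaleC_one [simp]: "scaleC 1 v = v"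
  using scaleC_of_real[of 1 v] by simp

lemma cinner_commute: "cinner w v = cnj (cinner v w)"
proof -
  have "cnj (cinner v w) = (LINT x|lborel. cnj (rep_l2 v x * cnj (rep_l2 w x)))"
    unfolding cinner_def by (rule Bochner_Integration.integral_cnj[symmetric])
  then show ?thesis by (simp add: cinner_def mult.commute)
qed

lemma cinner_scaleC_left: "cinner (scaleC y v) z = y * cinner v z"
  by (rule l2_abs_cases[of v]; rule l2_abs_cases[of z])
     (simp add: abs_l2_scaleC cinner_abs_l2 square_integrable_cmult mult.assoc)

lemma cinner_scaleC_right: "cinner z (scaleC y v) = cnj y * cinner z v"
  by (metis cinner_commute cinner_scaleC_left complex_cnj_mult)

lemma cinner_add_right: "cinner z (v + w) = cinner z v + cinner z w"
  by (metis cinner_commute cinner_add_left complex_cnj_add)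

lemma cinner_scaleR_right: "cinner z (r *\<^sub>R v) = r * cinner z v"
  using cinner_scaleC_right[of z "of_real r"] by (simp add: scaleC_of_real)

lemma cinner_diff_left: "cinner (v - w) z = cinner v z - cinner w z"
  using cinner_add_left[of "v - w" w z] by simp

text \<open>The imaginary part is the real part for a rotated second argument. Limits and isometry
  therefore only have to be established for \<open>inner\<close>.\<close>

lemma cinner_eq_inner: "cinner v w = Complex (inner v w) (inner v (scaleC \<i> w))"
  using cinner_scaleC_right[of v \<i> w] 
  by (simp add: complex_eq_iff Re_cinner[symmetric])

lemma cinner_self: "cinner w w = of_real ((norm w)\<^sup>2)"
proof -
  have "Im (cinner w w) = 0" using cinner_commute[of w w] by (simp add: complex_eq_iff)
  then show ?thesis by (simp add: complex_eq_iff Re_cinner power2_norm_eq_inner)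
qed

lemma norm_scaleC: "norm (scaleC z w) = cmod z * norm w"
proof -
  have "complex_of_real ((norm (scaleC z w))\<^sup>2) = (z * cnj z) * cinner w w"
    using cinner_self[of "scaleC z w"] by (simp add: cinner_scaleC_left cinner_scaleC_right mult_ac)
  also have "\<dots> = complex_of_real ((cmod z * norm w)\<^sup>2)"
    by (simp only: cinner_self complex_norm_square[symmetric] of_real_mult[symmetric] power_mult_distrib)
  finally have "(norm (scaleC z w))\<^sup>2 = (cmod z * norm w)\<^sup>2" by (simp only: of_real_eq_iff)
  then show ?thesis by (simp add: power2_eq_iff_nonneg)
qed

lemma cinner_Cauchy_Schwarz: "cmod (cinner v w) \<le> norm v * norm w"
proof -
  define z where "z = cinner v w"
  have "complex_of_real ((cmod z)\<^sup>2) = cnj z * cinner v w"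
    unfolding z_def complex_norm_square by (simp add: mult.commute)
  also have "\<dots> = cinner (scaleC (cnj z) v) w" by (simp add: cinner_scaleC_left)
  finally have "(cmod z)\<^sup>2 = inner (scaleC (cnj z) v) w"
    using Re_cinner by (metis Re_complex_of_real)
  also have "\<dots> \<le> norm (scaleC (cnj z) v) * norm w" by (rule norm_cauchy_schwarz)
  finally have "cmod z * cmod z \<le> cmod z * (norm v * norm w)"
    by (simp add: norm_scaleC power2_eq_square mult.assoc)
  then show ?thesis unfolding z_def[symmetric]
    by (cases "cmod z = 0") (auto simp: mult_le_cancel_left)
qed

lemma bounded_linear_scaleC: "bounded_linear (scaleC z)"
proof
  show "\<exists>K. \<forall>x. norm (scaleC z x) \<le> norm x * K" using norm_scaleC by (metis mult.commute order_refl)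
  show "scaleC z (r *\<^sub>R b) = r *\<^sub>R scaleC z b" for r b
    by (simp flip: scaleC_of_real add: scaleC_scaleC mult.commute)
qed (simp add: scaleC_add)

lemma tendsto_cinner:
  assumes "(f \<longlongrightarrow> v) F" "(g \<longlongrightarrow> w) F"
  shows "((\<lambda>x. cinner (f x) (g x)) \<longlongrightarrow> cinner v w) F"
  unfolding cinner_eq_inner
  by (intro tendsto_Complex tendsto_inner assms bounded_linear.tendsto[OF bounded_linear_scaleC])

section \<open>The Fourier transform and Plancherel's theorem\<close>

lemma borel_measurable_cis [measurable]: "cis \<in> borel_measurable borel"
  by (intro borel_measurable_continuous_onI continuous_intros)

lemma borel_measurable_cnj [measurable]: "cnj \<in> borel_measurable borel"
  by (intro borel_measurable_continuous_onI continuous_intros)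

lemma integrable_mult_bounded:
  fixes a b :: "real \<Rightarrow> complex"
  assumes "integrable lborel a" "b \<in> borel_measurable borel" "\<And>x. norm (b x) \<le> B"
  shows "integrable lborel (\<lambda>x. b x * a x)"
proof (rule Bochner_Integration.integrable_bound[where f = "\<lambda>x. B * norm (a x)"])
  have [measurable]: "a \<in> borel_measurable borel" using assms(1) by auto
  note [measurable] = assms(2)
  show "(\<lambda>x. b x * a x) \<in> borel_measurable lborel" by measurable
  have "B \<ge> 0" using assms(3)[of 0] norm_ge_zero order_trans by blast
  then show "AE x in lborel. norm (b x * a x) \<le> norm (B * norm (a x))"
    using assms(3) by (auto simp: norm_mult intro!: mult_right_mono)
qed (use assms in auto)

text \<open>A bound by a product of an integrable function of \<open>x\<close> and one of
  \<open>y\<close> gives integrability on the plane. The multiplication formula, the truncated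
  Hilbert transform and the convolution theorem all have this shape.\<close>

lemma Fubini_dominated:
  fixes f :: "real \<Rightarrow> real \<Rightarrow> complex" and g h :: "real \<Rightarrow> complex"
  assumes m[measurable]: "case_prod f \<in> borel_measurable (borel \<Otimes>\<^sub>M borel)"
    and g: "integrable lborel g" and h: "integrable lborel h"
    and le: "\<And>x y. norm (f x y) \<le> norm (g x) * norm (h y)"
  shows "(LINT x|lborel. LINT y|lborel. f x y) = (LINT y|lborel. LINT x|lborel. f x y)"
proof -
  have [measurable]: "g \<in> borel_measurable borel" "h \<in> borel_measurable borel" using g h by auto
  have i: "integrable lborel (\<lambda>y. f x y)" for x
    by (rule Bochner_Integration.integrable_bound[where f = "\<lambda>y. norm (g x) * norm (h y)"])
       (use h le in auto)
  have *: "integrable (lborel \<Otimes>\<^sub>M lborel) (case_prod f)"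
  proof (rule lborel_pair.Fubini_integrable)
    show "integrable lborel (\<lambda>x. LINT y|lborel. norm (case (x, y) of (x, y) \<Rightarrow> f x y))"
    proof (rule Bochner_Integration.integrable_bound[where f = "\<lambda>x. norm (g x) * (LINT y|lborel. norm (h y))"])
      have "(LINT y|lborel. norm (f x y)) \<le> norm (g x) * (LINT y|lborel. norm (h y))" for x
        using le h i by (subst integral_mult_right_zero[symmetric], intro integral_mono) auto
      then show "AE x in lborel. norm (LINT y|lborel. norm (case (x, y) of (x, y) \<Rightarrow> f x y))
         \<le> norm (norm (g x) * (LINT y|lborel. norm (h y)))"
        by (auto simp: abs_mult integral_nonneg_AE)
    qed (use g in auto)
  qed (use i in auto)
  show "(LINT x|lborel. LINT y|lborel. f x y) = (LINT y|lborel. LINT x|lborel. f x y)"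
    using lborel_pair.Fubini_integral[OF *] by simp
qed

lemma LINT_reflect:
  fixes f :: "real \<Rightarrow> 'a::{banach, second_countable_topology}"
  shows "(LINT s|lborel. f (y - s)) = (LINT s|lborel. f s)"
  using lborel_integral_real_affine[of "-1" f y] by simp

lemma integrable_reflect:
  fixes f :: "real \<Rightarrow> 'a::{banach, second_countable_topology}"
  shows "integrable lborel f \<Longrightarrow> integrable lborel (\<lambda>s. f (y - s))"
  using lborel_integrable_real_affine[of f "-1" y] by simp

lemma LINT_shift:
  fixes f :: "real \<Rightarrow> 'a::{banach, second_countable_topology}"
  shows "(LINT s|lborel. f (s - y)) = (LINT s|lborel. f s)"
  using lborel_integral_real_affine[of "1" f "-y"] by simp

lemma integrable_shift:
  fixes f :: "real \<Rightarrow> 'a::{banach, second_countable_topology}"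
  shows "integrable lborel f \<Longrightarrow> integrable lborel (\<lambda>s. f (s - y))"
  using lborel_integrable_real_affine[of f "1" "-y"] by simp

text \<open>The sign in the kernel is plus: this is the inverse of the transform \<open>F\<close>
  that defines the symbol of \<open>D\<close>. Throughout, the argument \<open>a\<close> lives on
  the frequency side and \<open>ft a\<close> in space, so that operators act on \<open>ft a\<close>
  by multiplying \<open>a\<close>.\<close>

definition ft :: "(real \<Rightarrow> complex) \<Rightarrow> real \<Rightarrow> complex" where
  "ft a x = (LINT y|lborel. a y * cis (2 * pi * x * y))"

lemma integrable_ft:
  assumes "integrable lborel a"
  shows "integrable lborel (\<lambda>y. a y * cis (2 * pi * x * y))"
  using integrable_mult_bounded[OF assms, of "\<lambda>y. cis (2 * pi * x * y)" 1] by (simp add: mult.commute)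

lemma norm_ft_le: "integrable lborel a \<Longrightarrow> cmod (ft a x) \<le> (LINT y|lborel. cmod (a y))"
  unfolding ft_def using integral_norm_bound[of lborel "\<lambda>y. a y * cis (2 * pi * x * y)"]
  by (simp add: norm_mult)

lemma continuous_ft:
  assumes a: "integrable lborel a"
  shows "continuous_on UNIV (ft a)"
proof (rule continuous_at_imp_continuous_on, intro ballI)
  fix x :: real
  have [measurable]: "a \<in> borel_measurable borel" using a by auto
  show "isCont (ft a) x"
    unfolding isCont_def ft_def tendsto_at_iff_sequentially comp_def
  proof safe
    fix X :: "nat \<Rightarrow> real" assume X: "X \<longlonglongrightarrow> x"
    show "(\<lambda>i. LINT y|lborel. a y * cis (2 * pi * X i * y)) \<longlonglongrightarrow> (LINT y|lborel. a y * cis (2 * pi * x * y))"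
    proof (rule integral_dominated_convergence[where w = "\<lambda>y. cmod (a y)"])
      have "(\<lambda>i. a y * cis (2 * pi * X i * y)) \<longlonglongrightarrow> a y * cis (2 * pi * x * y)" for y
      proof -
        have "isCont cis (2 * pi * x * y)"
          using continuous_on_cis[OF continuous_on_id, of UNIV] by (simp add: continuous_on_eq_continuous_at)
        then show ?thesis
          by (intro tendsto_intros isCont_tendsto_compose[of _ cis] X)
      qed
      then show "AE y in lborel. (\<lambda>i. a y * cis (2 * pi * X i * y)) \<longlonglongrightarrow> a y * cis (2 * pi * x * y)"
        by auto
    qed (use a in \<open>auto simp: norm_mult\<close>)
  qed
qed

lemma borel_measurable_ft [measurable]:
  "integrable lborel a \<Longrightarrow> ft a \<in> borel_measurable borel"
  by (intro borel_measurable_continuous_onI continuous_ft)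

lemma ft_mult_formula:
  assumes a: "integrable lborel a" and b: "integrable lborel b"
  shows "(LINT x|lborel. ft a x * b x) = (LINT y|lborel. a y * ft b y)"
proof -
  have [measurable]: "a \<in> borel_measurable borel" "b \<in> borel_measurable borel" using a b by auto
  have "(LINT x|lborel. ft a x * b x) = (LINT x|lborel. LINT y|lborel. b x * (a y * cis (2 * pi * x * y)))"
    unfolding ft_def by (simp only: integral_mult_right_zero mult.commute)
  also have "\<dots> = (LINT y|lborel. LINT x|lborel. b x * (a y * cis (2 * pi * x * y)))"
    by (rule Fubini_dominated[where g = b and h = a]) (auto simp: norm_mult a b)
  also have "\<dots> = (LINT y|lborel. LINT x|lborel. a y * (b x * cis (2 * pi * y * x)))"
    by (simp add: mult_ac)
  also have "\<dots> = (LINT y|lborel. a y * ft b y)"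
    unfolding ft_def by (simp only: integral_mult_right_zero)
  finally show ?thesis .
qed

text \<open>The convolution of \<open>a\<close> with its reflected conjugate. Its transform is the
  squared modulus of \<open>ft a\<close> and its value at 0 is the squared norm of \<open>a\<close>,
  so Plancherel's theorem becomes Fourier inversion of this one function at the point 0.\<close>

definition autocorr :: "(real \<Rightarrow> complex) \<Rightarrow> real \<Rightarrow> complex" where
  "autocorr a s = (LINT y|lborel. a y * cnj (a (y - s)))"

lemma
  assumes a: "integrable lborel a"
  shows integrable_autocorr: "integrable lborel (autocorr a)"
    and ft_autocorr: "ft (autocorr a) x = of_real ((cmod (ft a x))\<^sup>2)"
proof -
  have [measurable]: "a \<in> borel_measurable borel" using a by auto
  have i: "integrable lborel (\<lambda>s. cnj (a (y - s)))" for y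
    using integrable_reflect[OF a, of y] by simp
  have pi: "integrable (lborel \<Otimes>\<^sub>M lborel) (\<lambda>(y, s). a y * cnj (a (y - s)))"
  proof (rule lborel_pair.Fubini_integrable)
    have "(LINT s|lborel. cmod (a (y - s))) = (LINT s|lborel. cmod (a s))" for y
      by (rule LINT_reflect)
    then show "integrable lborel (\<lambda>y. LINT s|lborel. norm (case (y, s) of (y, s) \<Rightarrow> a y * cnj (a (y - s))))"
      using a by (simp add: norm_mult integral_mult_right_zero)
  qed (use i in \<open>auto intro!: integrable_mult_right\<close>)
  have pi': "integrable (lborel \<Otimes>\<^sub>M lborel) (\<lambda>(y, s). a y * cnj (a (y - s)) * cis (2 * pi * x * s))"
    by (rule Bochner_Integration.integrable_bound[OF pi]) (auto simp: norm_mult)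
  show "integrable lborel (autocorr a)"
    using lborel_pair.integrable_snd[OF pi] unfolding autocorr_def by simp
  have inner: "(LINT s|lborel. cnj (a (y - s)) * cis (2 * pi * x * s)) = cis (2 * pi * x * y) * cnj (ft a x)" for y
  proof -
    have "(LINT s|lborel. cnj (a (y - s)) * cis (2 * pi * x * s)) =
       (LINT s|lborel. cnj (a (y - s)) * cis (2 * pi * x * (y - (y - s))))" by simp
    also have "\<dots> = (LINT s|lborel. cnj (a s) * cis (2 * pi * x * (y - s)))"
      by (rule LINT_reflect)
    also have "\<dots> = (LINT s|lborel. cis (2 * pi * x * y) * cnj (a s * cis (2 * pi * x * s)))"
      by (intro Bochner_Integration.integral_cong) (auto simp: right_diff_distrib cis_mult cis_cnj mult_ac)
    also have "\<dots> = cis (2 * pi * x * y) * cnj (ft a x)"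
      unfolding ft_def by (simp only: integral_mult_right_zero Bochner_Integration.integral_cnj)
    finally show ?thesis .
  qed
  have "ft (autocorr a) x = (LINT s|lborel. LINT y|lborel. a y * cnj (a (y - s)) * cis (2 * pi * x * s))"
    unfolding ft_def autocorr_def by (simp only: integral_mult_left_zero)
  also have "\<dots> = (LINT y|lborel. LINT s|lborel. a y * cnj (a (y - s)) * cis (2 * pi * x * s))"
    using lborel_pair.Fubini_integral[OF pi'] by simp
  also have "\<dots> = (LINT y|lborel. a y * cis (2 * pi * x * y) * cnj (ft a x))"
    using inner by (simp add: mult.assoc integral_mult_right_zero)
  also have "\<dots> = ft a x * cnj (ft a x)"
    unfolding ft_def by (simp only: integral_mult_left_zero)
  finally show "ft (autocorr a) x = of_real ((cmod (ft a x))\<^sup>2)"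
    by (simp add: complex_norm_square del: of_real_power)
qed

text \<open>Cauchy-Schwarz for \<open>a\<close> and its translate, which have the same norm.\<close>

lemma autocorr_bound:
  assumes "square_integrable a"
  shows "cmod (autocorr a s) \<le> (LINT x|lborel. (cmod (a x))\<^sup>2)"
proof -
  have t: "square_integrable (\<lambda>x. a (x - s))"
    using square_integrable_affine[OF assms, of 1 "-s"] by simp
  have n: "norm (abs_l2 (\<lambda>x. a (x - s))) = norm (abs_l2 a)"
    using norm_abs_l2[OF t] norm_abs_l2[OF assms] LINT_shift[of "\<lambda>x. (cmod (a x))\<^sup>2" s]
    by - (rule power2_eq_imp_eq, auto)
  show ?thesis
    using cinner_Cauchy_Schwarz[of "abs_l2 a" "abs_l2 (\<lambda>x. a (x - s))"] norm_abs_l2[OF assms]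
    unfolding cinner_abs_l2[OF assms t] autocorr_def n by (simp add: power2_eq_square)
qed

section \<open>Plancherel's theorem by Gaussian summation\<close>

lemma ft_gauss:
  "LINT x|lborel. of_real (std_normal_density x) * cis (t * x) = of_real (exp (- t\<^sup>2 / 2))"
proof -
  have "(LINT x|std_normal_distribution. cis (t * x)) = of_real (exp (- t\<^sup>2 / 2))"
    using fun_cong[OF char_std_normal_distribution, of t]
    by (simp add: char_def cis_conv_exp)
  then show ?thesis
    by (subst (asm) integral_density) (auto simp: scaleR_conv_of_real)
qed

text \<open>The multiplication formula is applied to \<open>autocorr a\<close> and a Gaussian of
  width \<open>n\<close>, whose transform is a Gaussian of width \<open>1 / (2 * pi * n)\<close>.
  After rescaling, the damped Plancherel integral is an average of \<open>autocorr a\<close> over a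
  window that shrinks to 0 as \<open>n\<close> grows.\<close>

lemma weighted_ft:
  assumes a: "integrable lborel a" and n: "n > 0"
  shows "of_real (LINT x|lborel. (cmod (ft a x))\<^sup>2 * exp (- (x / n)\<^sup>2 / 2)) =
     (LINT r|lborel. autocorr a (r / (2 * pi * n)) * of_real (std_normal_density r))"
proof -
  let ?g = "\<lambda>x::real. complex_of_real (exp (- (x / n)\<^sup>2 / 2))"
  have nd: "exp (- r\<^sup>2 / 2) = sqrt (2 * pi) * std_normal_density r" for r :: real
    by (simp add: std_normal_density_def)
  have g': "?g = (\<lambda>x. complex_of_real (sqrt (2 * pi) * std_normal_density (0 + (1 / n) * x)))"
    by (auto simp: std_normal_density_def)
  have gi: "integrable lborel ?g"
    unfolding g' using n
    by (intro integrable_of_real integrable_mult_right lborel_integrable_real_affine) auto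
  have ftg: "ft ?g y = of_real (n * sqrt (2 * pi) * exp (- (2 * pi * n * y)\<^sup>2 / 2))" for y
  proof -
    have "ft ?g y = n *\<^sub>R (LINT x|lborel. ?g (0 + n * x) * cis (2 * pi * y * (0 + n * x)))"
      unfolding ft_def using lborel_integral_real_affine[of n "\<lambda>x. ?g x * cis (2 * pi * y * x)" 0] n by simp
    also have "(LINT x|lborel. ?g (0 + n * x) * cis (2 * pi * y * (0 + n * x))) =
      (LINT x|lborel. of_real (sqrt (2 * pi)) * (of_real (std_normal_density x) * cis (2 * pi * n * y * x)))"
      using n by (intro Bochner_Integration.integral_cong) (auto simp: std_normal_density_def mult_ac)
    also have "\<dots> = of_real (sqrt (2 * pi)) * of_real (exp (- (2 * pi * n * y)\<^sup>2 / 2))"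
      by (simp only: integral_mult_right_zero ft_gauss)
    finally show ?thesis by (simp add: scaleR_conv_of_real)
  qed
  have "complex_of_real (LINT x|lborel. (cmod (ft a x))\<^sup>2 * exp (- (x / n)\<^sup>2 / 2)) =
    (LINT x|lborel. ft (autocorr a) x * ?g x)"
    by (simp add: ft_autocorr[OF a] flip: integral_of_real of_real_mult of_real_power)
  also have "\<dots> = (LINT y|lborel. autocorr a y * ft ?g y)"
    by (rule ft_mult_formula[OF integrable_autocorr[OF a] gi])
  also have "\<dots> = \<bar>1 / (2 * pi * n)\<bar> *\<^sub>R (LINT r|lborel. autocorr a (0 + (1 / (2 * pi * n)) * r) * ft ?g (0 + (1 / (2 * pi * n)) * r))"
    using n by (intro lborel_integral_real_affine) auto
  also have "\<dots> = (LINT r|lborel. autocorr a (r / (2 * pi * n)) * of_real (std_normal_density r))"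
    unfolding ftg integral_scaleR_right[symmetric]
  proof (intro Bochner_Integration.integral_cong refl)
    fix r :: real
    have e: "2 * pi * n * (r / (2 * pi * n)) = r" "0 + 1 / (2 * pi * n) * r = r / (2 * pi * n)"
      using n by auto
    have "\<bar>1 / (2 * pi * n)\<bar> * (n * sqrt (2 * pi) * (sqrt (2 * pi) * std_normal_density r)) =
        \<bar>1 / (2 * pi * n)\<bar> * n * (sqrt (2 * pi) * sqrt (2 * pi)) * std_normal_density r"
      by (simp only: mult_ac)
    also have "\<dots> = std_normal_density r" using n by (subst real_sqrt_mult_self) auto
    finally have fin: "\<bar>1 / (2 * pi * n)\<bar> * (n * sqrt (2 * pi) * (sqrt (2 * pi) * std_normal_density r)) = std_normal_density r" .
    have *: "c *\<^sub>R (z * of_real d) = z * of_real p" if "c * d = p" for c d p :: real and z :: complex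
      using that by (auto simp: scaleR_conv_of_real)
    show "\<bar>1 / (2 * pi * n)\<bar> *\<^sub>R (autocorr a (0 + 1 / (2 * pi * n) * r) *
           of_real (n * sqrt (2 * pi) * exp (- (2 * pi * n * (0 + 1 / (2 * pi * n) * r))\<^sup>2 / 2))) =
         autocorr a (r / (2 * pi * n)) * of_real (std_normal_density r)"
      unfolding e nd by (rule *[OF fin])
  qed
  finally show ?thesis .
qed

text \<open>On this common domain \<open>ft\<close> is given by a convergent integral at every point
  and also defines an element of L^2.\<close>

definition L12 :: "(real \<Rightarrow> complex) \<Rightarrow> bool" where
  "L12 a \<longleftrightarrow> integrable lborel a \<and> square_integrable a"

lemma L12_measurable: "L12 a \<Longrightarrow> a \<in> borel_measurable borel"
  by (auto simp: L12_def)

lemma L12_add: "L12 a \<Longrightarrow> L12 b \<Longrightarrow> L12 (\<lambda>x. a x + b x)"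
  by (auto simp: L12_def square_integrable_add)

lemma square_integrable_mult_bounded:
  assumes "square_integrable a" "b \<in> borel_measurable borel" "\<And>x. cmod (b x) \<le> B"
  shows "square_integrable (\<lambda>x. b x * a x)"
  unfolding square_integrable_def
proof
  have [measurable]: "a \<in> borel_measurable borel" "b \<in> borel_measurable borel"
    using assms by (auto simp: square_integrable_def)
  show "(\<lambda>x. b x * a x) \<in> borel_measurable lborel" by measurable
  show "integrable lborel (\<lambda>x. (cmod (b x * a x))\<^sup>2)"
  proof (rule Bochner_Integration.integrable_bound[where f = "\<lambda>x. B\<^sup>2 * (cmod (a x))\<^sup>2"])
    show "AE x in lborel. norm ((cmod (b x * a x))\<^sup>2) \<le> norm (B\<^sup>2 * (cmod (a x))\<^sup>2)"
      using assms(3) by (auto simp: norm_mult power_mult_distrib intro!: mult_right_mono power_mono)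
  qed (use assms in \<open>auto simp: square_integrable_def\<close>)
qed

lemma L12_mult_bounded:
  assumes "L12 a" "b \<in> borel_measurable borel" "\<And>x. cmod (b x) \<le> B"
  shows "L12 (\<lambda>x. b x * a x)"
  using assms integrable_mult_bounded square_integrable_mult_bounded unfolding L12_def by blast

lemma L12_cmult: "L12 a \<Longrightarrow> L12 (\<lambda>x. c * a x)"
  by (rule L12_mult_bounded[where b = "\<lambda>_. c" and B = "cmod c"]) auto

lemma L12_diff: "L12 a \<Longrightarrow> L12 b \<Longrightarrow> L12 (\<lambda>x. a x - b x)"
  using L12_add[of a "\<lambda>x. (-1) * b x"] L12_cmult[of b "-1"] by simp

lemma square_integrable_diff:
  "square_integrable f \<Longrightarrow> square_integrable g \<Longrightarrow> square_integrable (\<lambda>x. f x - g x)"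
  using square_integrable_add[of f "\<lambda>x. (-1) * g x"] square_integrable_cmult[of g "-1"] by simp

lemma integrable_indicator_interval: "integrable lborel (\<lambda>x. indicator {-R..R::real} x * (c::real))"
proof -
  have "integrable lborel (\<lambda>x. indicator {-R..R::real} x *\<^sub>R (c::real))"
    by (intro integrable_scaleR_left integrable_real_indicator) (auto simp: emeasure_lborel_Icc_eq)
  then show ?thesis by simp
qed

lemma L12_bounded_support:
  assumes [measurable]: "a \<in> borel_measurable borel"
    and "\<And>x. \<bar>x\<bar> > R \<Longrightarrow> a x = 0" "\<And>x. \<bar>x\<bar> \<le> R \<Longrightarrow> cmod (a x) \<le> B"
  shows "L12 a"
  unfolding L12_def square_integrable_def
proof (intro conjI)
  show "integrable lborel a"
  proof (rule Bochner_Integration.integrable_bound[OF integrable_indicator_interval[of R B]])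
    show "AE x in lborel. norm (a x) \<le> norm (indicator {-R..R} x * B)"
    proof (intro AE_I2)
      fix x show "norm (a x) \<le> norm (indicator {-R..R} x * B)"
        using assms(2,3)[of x] norm_ge_zero[of "a x"] by (cases "\<bar>x\<bar> > R") (auto simp: indicator_def)
    qed
  qed auto
  show "integrable lborel (\<lambda>x. (cmod (a x))\<^sup>2)"
  proof (rule Bochner_Integration.integrable_bound[OF integrable_indicator_interval[of R "B\<^sup>2"]])
    show "AE x in lborel. norm ((cmod (a x))\<^sup>2) \<le> norm (indicator {-R..R} x * B\<^sup>2)"
    proof (intro AE_I2)
      fix x show "norm ((cmod (a x))\<^sup>2) \<le> norm (indicator {-R..R} x * B\<^sup>2)"
        using assms(2,3)[of x] power_mono[OF assms(3)[of x], of 2]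
        by (cases "\<bar>x\<bar> > R") (auto simp: indicator_def)
    qed
  qed auto
qed auto

lemma L12_continuous_support:
  assumes "continuous_on UNIV a" "\<And>x. \<bar>x\<bar> > R \<Longrightarrow> a x = 0"
  shows "L12 a"
proof -
  have "bounded (a ` {-R..R})"
    by (intro compact_imp_bounded compact_continuous_image continuous_on_subset[OF assms(1)]) auto
  then obtain B where "\<And>x. x \<in> {-R..R} \<Longrightarrow> cmod (a x) \<le> B"
    unfolding bounded_iff by blast
  then show ?thesis
    using assms by (intro L12_bounded_support[of a R B] borel_measurable_continuous_onI) (auto simp: abs_le_iff)
qed

lemma autocorr_0: "autocorr a 0 = of_real (LINT x|lborel. (cmod (a x))\<^sup>2)"
  by (simp only: autocorr_def diff_0_right complex_norm_square[symmetric] integral_complex_of_real)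

lemma borel_measurable_autocorr [measurable]:
  "integrable lborel a \<Longrightarrow> autocorr a \<in> borel_measurable borel"
  using integrable_autocorr[of a] by auto

text \<open>As the Gaussian widens, the damped integrals increase to the full one, while
  \<open>autocorr_bound\<close> keeps them below the squared norm of \<open>a\<close>; this gives
  the first two claims. Equality needs the averages to converge to \<open>autocorr a 0\<close>,
  hence the continuity premise of the third.\<close>

lemma
  assumes a: "L12 a"
  shows square_integrable_ft: "square_integrable (ft a)"
    and ft_norm_le: "(LINT x|lborel. (cmod (ft a x))\<^sup>2) \<le> (LINT x|lborel. (cmod (a x))\<^sup>2)"
    and ft_norm_eq: "(\<And>X. X \<longlonglongrightarrow> 0 \<Longrightarrow> (\<lambda>n. autocorr a (X n)) \<longlonglongrightarrow> autocorr a 0) \<Longrightarrow>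
       (LINT x|lborel. (cmod (ft a x))\<^sup>2) = (LINT x|lborel. (cmod (a x))\<^sup>2)"
proof -
  have i: "integrable lborel a" and sq: "square_integrable a" using a by (auto simp: L12_def)
  note [measurable] = borel_measurable_ft[OF i] borel_measurable_autocorr[OF i]
  define N where "N = (LINT x|lborel. (cmod (a x))\<^sup>2)"
  define f where "f k x = (cmod (ft a x))\<^sup>2 * exp (- (x / real (Suc k))\<^sup>2 / 2)" for k x
  define I where "I k = (LINT x|lborel. f k x)" for k
  have eq: "of_real (I k) = (LINT r|lborel. autocorr a (r / (2 * pi * real (Suc k))) * of_real (std_normal_density r))" for k
    unfolding I_def f_def by (rule weighted_ft[OF i]) simp
  have bnd: "cmod (autocorr a s * of_real (std_normal_density r)) \<le> N * std_normal_density r" for s r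
    using autocorr_bound[OF sq, of s] by (auto simp: norm_mult N_def intro!: mult_right_mono)
  have "\<bar>I k\<bar> \<le> N" for k
  proof -
    have "\<bar>I k\<bar> = cmod (LINT r|lborel. autocorr a (r / (2 * pi * real (Suc k))) * of_real (std_normal_density r))"
      unfolding eq[symmetric] by simp
    also have "\<dots> \<le> (LINT r|lborel. N * std_normal_density r)"
    proof (rule Bochner_Integration.integral_norm_bound_integral)
      show "integrable lborel (\<lambda>r. autocorr a (r / (2 * pi * real (Suc k))) * of_real (std_normal_density r))"
        by (rule Bochner_Integration.integrable_bound[where f = "\<lambda>r. N * std_normal_density r"])
          (use bnd in \<open>auto intro: order_trans[OF _ abs_ge_self]\<close>)
    qed (use bnd in auto)
    finally show ?thesis by simp
  qed
  then have IN: "I k \<le> N" for k by (simp add: abs_le_iff)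
  have fi: "integrable lborel (f k)" for k
  proof (rule Bochner_Integration.integrable_bound)
    let ?B = "(LINT y|lborel. cmod (a y))\<^sup>2 * sqrt (2 * pi)"
    show "integrable lborel (\<lambda>x. ?B * std_normal_density (0 + (1 / real (Suc k)) * x))"
      by (intro integrable_mult_right lborel_integrable_real_affine) auto
    show "f k \<in> borel_measurable lborel" unfolding f_def by measurable
    show "AE x in lborel. norm (f k x) \<le> norm (?B * std_normal_density (0 + (1 / real (Suc k)) * x))"
      using norm_ft_le[OF i]
      by (auto simp: f_def std_normal_density_def abs_mult intro!: mult_right_mono power_mono)
  qed
  have mono: "mono (\<lambda>k. f k x)" for x
    unfolding f_def mono_def
    by (auto intro!: mult_left_mono power_mono divide_left_mono simp: power_divide)
  have "mono I" unfolding I_def mono_def using fi mono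
    by (auto intro!: integral_mono simp: mono_def)
  then obtain L where L: "I \<longlonglongrightarrow> L" "L \<le> N"
  proof -
    assume *: "\<And>L. I \<longlonglongrightarrow> L \<Longrightarrow> L \<le> N \<Longrightarrow> thesis"
    obtain L where "I \<longlonglongrightarrow> L"
      using \<open>mono I\<close> IN by (metis incseq_convergent)
    then show thesis using * LIMSEQ_le_const2[of I L N] IN by auto
  qed
  have lim: "(\<lambda>k. f k x) \<longlonglongrightarrow> (cmod (ft a x))\<^sup>2" for x
  proof -
    have "(\<lambda>k. x / real (Suc k)) \<longlonglongrightarrow> 0"
      by (rule LIMSEQ_Suc[OF lim_const_over_n])
    then have "(\<lambda>k. (cmod (ft a x))\<^sup>2 * exp (- (x / real (Suc k))\<^sup>2 / 2)) \<longlonglongrightarrow> (cmod (ft a x))\<^sup>2 * exp (- 0\<^sup>2 / 2)"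
      by (intro tendsto_intros) auto
    then show ?thesis by (simp add: f_def)
  qed
  have mc: "integrable lborel (\<lambda>x. (cmod (ft a x))\<^sup>2)" "(LINT x|lborel. (cmod (ft a x))\<^sup>2) = L"
    using mono lim L(1) unfolding I_def
    by (auto intro!: integral_monotone_convergence_nonneg[of lborel f] fi) (auto simp: f_def)
  then show "square_integrable (ft a)" by (auto simp: square_integrable_def)
  show "(LINT x|lborel. (cmod (ft a x))\<^sup>2) \<le> (LINT x|lborel. (cmod (a x))\<^sup>2)"
    using mc L N_def by simp
  assume c: "\<And>X. X \<longlonglongrightarrow> 0 \<Longrightarrow> (\<lambda>n. autocorr a (X n)) \<longlonglongrightarrow> autocorr a 0"
  have "(\<lambda>k. complex_of_real (I k)) \<longlonglongrightarrow> (LINT r|lborel. autocorr a 0 * of_real (std_normal_density r))"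
    unfolding eq
  proof (rule integral_dominated_convergence[where w = "\<lambda>r. N * std_normal_density r"])
    show "AE r in lborel. (\<lambda>k. autocorr a (r / (2 * pi * real (Suc k))) * of_real (std_normal_density r)) \<longlonglongrightarrow> autocorr a 0 * of_real (std_normal_density r)"
    proof (intro AE_I2 tendsto_mult_right c)
      fix r :: real
      have "(\<lambda>k. (r / (2 * pi)) / real (Suc k)) \<longlonglongrightarrow> 0"
        by (rule LIMSEQ_Suc[OF lim_const_over_n])
      then show "(\<lambda>k. r / (2 * pi * real (Suc k))) \<longlonglongrightarrow> 0" by simp
    qed
  qed (use bnd in \<open>auto intro!: integrable_mult_right\<close>)
  also have "(LINT r|lborel. autocorr a 0 * of_real (std_normal_density r)) = of_real N"
    unfolding autocorr_0 N_def[symmetric] of_real_mult[symmetric] integral_of_real by simp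
  finally have "I \<longlonglongrightarrow> N" by (simp only: tendsto_of_real_iff)
  then have "L = N" using L(1) LIMSEQ_unique by blast
  then show "(LINT x|lborel. (cmod (ft a x))\<^sup>2) = (LINT x|lborel. (cmod (a x))\<^sup>2)"
    using mc N_def by simp
qed

lemma autocorr_continuous_support:
  assumes a: "continuous_on UNIV a" and R: "\<And>x. \<bar>x\<bar> > R \<Longrightarrow> a x = 0" and X: "X \<longlonglongrightarrow> 0"
  shows "(\<lambda>n. autocorr a (X n)) \<longlonglongrightarrow> autocorr a 0"
  unfolding autocorr_def
proof -
  have [measurable]: "a \<in> borel_measurable borel" using a by (rule borel_measurable_continuous_onI)
  have "bounded (a ` {-R..R})"
    by (intro compact_imp_bounded compact_continuous_image continuous_on_subset[OF a]) auto
  then obtain B0 where B0: "\<And>x. x \<in> {-R..R} \<Longrightarrow> cmod (a x) \<le> B0"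
    unfolding bounded_iff by blast
  define B where "B = max B0 0"
  have B: "cmod (a x) \<le> B" for x
  proof (cases "\<bar>x\<bar> > R")
    case False
    then have "x \<in> {-R..R}" by auto
    from B0[OF this] show ?thesis by (simp add: B_def)
  qed (use R[of x] in \<open>simp add: B_def\<close>)
  show "(\<lambda>n. LINT y|lborel. a y * cnj (a (y - X n))) \<longlonglongrightarrow> (LINT y|lborel. a y * cnj (a (y - 0)))"
  proof (rule integral_dominated_convergence[where w = "\<lambda>y. cmod (a y) * B"])
    show "AE y in lborel. (\<lambda>n. a y * cnj (a (y - X n))) \<longlonglongrightarrow> a y * cnj (a (y - 0))"
    proof (intro AE_I2 tendsto_mult_left tendsto_cnj)
      fix y
      have "isCont a (y - 0)" using a by (simp add: continuous_on_eq_continuous_at)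
      then show "(\<lambda>n. a (y - X n)) \<longlonglongrightarrow> a (y - 0)"
        by (rule isCont_tendsto_compose) (intro tendsto_intros X)
    qed
    show "integrable lborel (\<lambda>y. cmod (a y) * B)"
      using L12_continuous_support[OF a R] by (auto simp: L12_def)
  qed (use B in \<open>auto simp: norm_mult intro!: mult_left_mono\<close>)
qed

section \<open>Approximation by continuous functions of compact support\<close>

lemma power_add_le: "(x + y) ^ p \<le> 2 ^ p * (x ^ p + y ^ p)" if "x \<ge> 0" "y \<ge> 0" for x y :: real
proof -
  have "(x + y) ^ p \<le> (2 * max x y) ^ p" using that by (intro power_mono) auto
  also have "\<dots> \<le> 2 ^ p * (x ^ p + y ^ p)"
    using that by (auto simp: power_mult_distrib max_def)
  finally show ?thesis .
qed

text \<open>The exponent is kept general because the case 2 extends Plancherel's identity by density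
  and the case 1 serves the Riemann-Lebesgue lemma. \<open>f\<close> is first cut off in both domain
  and range; the result is an almost everywhere limit of continuous functions, which are then cut
  off as well so that dominated convergence applies.\<close>

lemma continuous_support_approx:
  fixes f :: "real \<Rightarrow> complex"
  assumes [measurable]: "f \<in> borel_measurable borel"
    and fi: "integrable lborel (\<lambda>x. cmod (f x) ^ p)" and p: "p > 0" and e: "e > 0"
  obtains h R where "continuous_on UNIV h" "\<And>x. \<bar>x\<bar> > R \<Longrightarrow> h x = 0"
    "integrable lborel (\<lambda>x. cmod (f x - h x) ^ p)" "(LINT x|lborel. cmod (f x - h x) ^ p) < e"
proof -
  define fk where "fk k x = (if \<bar>x\<bar> \<le> real k \<and> cmod (f x) \<le> real k then f x else 0)" for k x
  have [measurable]: "fk k \<in> borel_measurable borel" for k unfolding fk_def by measurable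
  \<comment> \<open>The factor \<open>2 ^ p\<close> is the constant of \<open>power_add_le\<close>;
    the other 2 splits the error between the two approximations.\<close>
  define e' where "e' = e / (2 * 2 ^ p)"
  have e': "e' > 0" using e by (simp add: e'_def)
  have "(\<lambda>k. LINT x|lborel. cmod (f x - fk k x) ^ p) \<longlonglongrightarrow> (LINT x::real|lborel. (0::real))"
  proof (rule integral_dominated_convergence[where w = "\<lambda>x. cmod (f x) ^ p"])
    show "AE x in lborel. (\<lambda>k. cmod (f x - fk k x) ^ p) \<longlonglongrightarrow> 0"
    proof (intro AE_I2)
      fix x
      obtain k0 where k0: "real k0 \<ge> max \<bar>x\<bar> (cmod (f x))" using real_arch_simple by blast
      have "\<forall>\<^sub>F k in sequentially. cmod (f x - fk k x) ^ p = 0"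
        using eventually_ge_at_top[of k0] by eventually_elim (use k0 p in \<open>auto simp: fk_def\<close>)
      then show "(\<lambda>k. cmod (f x - fk k x) ^ p) \<longlonglongrightarrow> 0" by (rule tendsto_eventually)
    qed
  qed (use fi p in \<open>auto simp: fk_def\<close>)
  then have "\<forall>\<^sub>F k in sequentially. (LINT x|lborel. cmod (f x - fk k x) ^ p) < e'"
    using e' by (intro order_tendstoD(2)) auto
  then have "\<forall>\<^sub>F k in sequentially. (LINT x|lborel. cmod (f x - fk k x) ^ p) < e' \<and> k > 0"
    using eventually_gt_at_top[of 0] by eventually_elim auto
  then obtain k where k: "(LINT x|lborel. cmod (f x - fk k x) ^ p) < e'" "k > 0"
    by (auto dest: eventually_happens)
  have fki: "integrable lborel (\<lambda>x. cmod (f x - fk k x) ^ p)"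
    by (rule Bochner_Integration.integrable_bound[OF fi]) (use p in \<open>auto simp: fk_def\<close>)
  have "fk k measurable_on UNIV"
    by (rule lebesgue_measurable_imp_measurable_on) (auto intro: borel_measurable_if_lebesgue_on measurable_completion)
  then obtain N g where N: "negligible N" and gc: "\<And>n. continuous_on UNIV (g n)"
    and g: "\<And>x. x \<notin> N \<Longrightarrow> (\<lambda>n. g n x) \<longlonglongrightarrow> fk k x"
    unfolding measurable_on_def by auto
  \<comment> \<open>\<open>P\<close> is the radial retraction onto the closed disc of radius
    \<open>k\<close>, and \<open>tent\<close> equals 1 for \<open>\<bar>x\<bar> \<le> k\<close> and
    0 from \<open>k + 1\<close> on. Neither changes \<open>fk k\<close>, so the limit is preserved
    while the approximants acquire a common bound and a common support.\<close>
  define P where "P z = complex_of_real (real k / max (real k) (cmod z)) * z" for z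
  define tent where "tent x = complex_of_real (max 0 (min 1 (real k + 1 - \<bar>x\<bar>)))" for x
  define h where "h n x = tent x * P (g n x)" for n x
  have Pc: "continuous_on UNIV P"
    unfolding P_def using k(2) by (intro continuous_intros) auto
  have Pb: "cmod (P z) \<le> k" for z
    using k(2) by (auto simp: P_def norm_mult norm_divide max_def field_simps)
  have tb: "cmod (tent x) \<le> 1" for x by (auto simp: tent_def)
  have hc: "continuous_on UNIV (h n)" for n
    unfolding h_def tent_def
    by (intro continuous_intros continuous_on_compose2[OF Pc gc]) auto
  have hz: "h n x = 0" if "\<bar>x\<bar> > real k + 1" for n and x :: real using that by (simp add: h_def tent_def)
  have hb: "cmod (h n x) \<le> k" for n x
    using mult_mono[OF tb[of x] Pb[of "g n x"]] by (simp add: h_def norm_mult)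
  have [measurable]: "h n \<in> borel_measurable borel" for n
    by (rule borel_measurable_continuous_onI[OF hc])
  have hl: "(\<lambda>n. h n x) \<longlonglongrightarrow> fk k x" if "x \<notin> N" for x
  proof -
    have "(\<lambda>n. P (g n x)) \<longlonglongrightarrow> P (fk k x)"
      using Pc by (intro isCont_tendsto_compose[of _ P] g that) (simp add: continuous_on_eq_continuous_at)
    then have "(\<lambda>n. h n x) \<longlonglongrightarrow> tent x * P (fk k x)" unfolding h_def by (intro tendsto_intros)
    also have "tent x * P (fk k x) = fk k x"
      using k(2) by (auto simp: tent_def P_def fk_def max_def)
    finally show ?thesis .
  qed
  let ?w = "\<lambda>x. indicator {-(real k + 1)..real k + 1} x * ((2 * real k) ^ p)"
  have hw: "cmod (fk k x - h n x) ^ p \<le> ?w x" for n x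
  proof (cases "\<bar>x\<bar> > real k + 1")
    case True then show ?thesis using hz p by (auto simp: fk_def indicator_def zero_power)
  next
    case False
    have "cmod (fk k x - h n x) \<le> cmod (fk k x) + cmod (h n x)" by (rule norm_triangle_ineq4)
    also have "\<dots> \<le> 2 * real k" using hb[of n x] by (auto simp: fk_def)
    finally show ?thesis using False power_mono[OF _ norm_ge_zero, of "fk k x - h n x" "2 * real k" p]
      by (auto simp: indicator_def)
  qed
  have "AE x in lborel. x \<notin> N"
    using N by (auto simp: negligible_iff_null_sets dest!: AE_not_in AE_completion_iff[THEN iffD1, rotated] intro: AE_completion)
  then have AEl: "AE x in lborel. (\<lambda>n. cmod (fk k x - h n x) ^ p) \<longlonglongrightarrow> 0"
  proof eventually_elim
    fix x assume "x \<notin> N"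
    then have "(\<lambda>n. cmod (fk k x - h n x) ^ p) \<longlonglongrightarrow> cmod (fk k x - fk k x) ^ p"
      by (intro tendsto_intros hl)
    then show "(\<lambda>n. cmod (fk k x - h n x) ^ p) \<longlonglongrightarrow> 0" using p by (simp add: zero_power)
  qed
  have hi: "integrable lborel (\<lambda>x. cmod (fk k x - h n x) ^ p)" for n
    by (rule Bochner_Integration.integrable_bound[OF integrable_indicator_interval[of "real k + 1" "(2 * real k) ^ p"]])
       (use order_trans[OF hw abs_ge_self] in auto)
  have "(\<lambda>n. LINT x|lborel. cmod (fk k x - h n x) ^ p) \<longlonglongrightarrow> (LINT x::real|lborel. (0::real))"
    by (rule integral_dominated_convergence[where w = ?w, OF _ _ integrable_indicator_interval AEl])
       (use hw in auto)
  then have "\<forall>\<^sub>F n in sequentially. (LINT x|lborel. cmod (fk k x - h n x) ^ p) < e'"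
    using e' by (intro order_tendstoD(2)) auto
  then obtain n where n: "(LINT x|lborel. cmod (fk k x - h n x) ^ p) < e'"
    by (auto dest: eventually_happens)
  have ab: "cmod (f x - h n x) ^ p \<le> 2 ^ p * (cmod (f x - fk k x) ^ p + cmod (fk k x - h n x) ^ p)" for x
  proof -
    have "cmod (f x - h n x) ^ p \<le> (cmod (f x - fk k x) + cmod (fk k x - h n x)) ^ p"
      using norm_triangle_ineq[of "f x - fk k x" "fk k x - h n x"] by (intro power_mono) auto
    also have "\<dots> \<le> 2 ^ p * (cmod (f x - fk k x) ^ p + cmod (fk k x - h n x) ^ p)"
      by (rule power_add_le) auto
    finally show ?thesis .
  qed
  have ri: "integrable lborel (\<lambda>x. 2 ^ p * (cmod (f x - fk k x) ^ p + cmod (fk k x - h n x) ^ p))"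
    using fki hi by auto
  have li: "integrable lborel (\<lambda>x. cmod (f x - h n x) ^ p)"
    by (rule Bochner_Integration.integrable_bound[OF ri]) (use ab in \<open>auto intro: order_trans[OF _ abs_ge_self]\<close>)
  have "(LINT x|lborel. cmod (f x - h n x) ^ p) \<le>
     (LINT x|lborel. 2 ^ p * (cmod (f x - fk k x) ^ p + cmod (fk k x - h n x) ^ p))"
    using li ri ab by (intro integral_mono) auto
  also have "\<dots> = 2 ^ p * ((LINT x|lborel. cmod (f x - fk k x) ^ p) + (LINT x|lborel. cmod (fk k x - h n x) ^ p))"
    using fki hi by simp
  also have "\<dots> < 2 ^ p * (e' + e')" using k n by (intro mult_strict_left_mono add_strict_mono) auto
  also have "\<dots> = e" by (simp add: e'_def)
  finally show thesis using that[of "h n" "real k + 1"] hc hz li by simp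
qed

section \<open>The transform as an isometry into L^2, and its inversion\<close>

definition FT :: "(real \<Rightarrow> complex) \<Rightarrow> l2" where
  "FT a = abs_l2 (ft a)"

lemma tendsto_norm_sq:
  assumes "((\<lambda>k. (norm (f k - l))\<^sup>2) \<longlongrightarrow> 0) F"
  shows "(f \<longlongrightarrow> (l::'a::real_normed_vector)) F"
proof -
  have "((\<lambda>k. norm (f k - l)) \<longlongrightarrow> 0) F" using tendsto_real_sqrt[OF assms] by simp
  then show ?thesis by (rule LIM_zero_cancel[OF tendsto_norm_zero_cancel])
qed

lemma L12_square_integrable: "L12 a \<Longrightarrow> square_integrable a"
  and L12_integrable: "L12 a \<Longrightarrow> integrable lborel a"
  by (auto simp: L12_def)

lemma ft_add: "integrable lborel a \<Longrightarrow> integrable lborel b \<Longrightarrow> ft (\<lambda>x. a x + b x) = (\<lambda>y. ft a y + ft b y)"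
  unfolding ft_def by (intro ext, subst Bochner_Integration.integral_add[symmetric])
    (auto intro: integrable_ft simp: distrib_right)

lemma ft_diff: "integrable lborel a \<Longrightarrow> integrable lborel b \<Longrightarrow> ft (\<lambda>x. a x - b x) = (\<lambda>y. ft a y - ft b y)"
  unfolding ft_def by (intro ext, subst Bochner_Integration.integral_diff[symmetric])
    (auto intro: integrable_ft simp: left_diff_distrib)

lemma ft_cmult: "ft (\<lambda>x. c * a x) = (\<lambda>y. c * ft a y)"
  unfolding ft_def by (simp only: integral_mult_right_zero mult.assoc)

lemma FT_add: "L12 a \<Longrightarrow> L12 b \<Longrightarrow> FT (\<lambda>x. a x + b x) = FT a + FT b"
  by (simp add: FT_def abs_l2_add square_integrable_ft ft_add L12_integrable)

lemma FT_diff: "L12 a \<Longrightarrow> L12 b \<Longrightarrow> FT (\<lambda>x. a x - b x) = FT a - FT b"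
  by (simp add: FT_def abs_l2_diff square_integrable_ft ft_diff L12_integrable)

lemma FT_cmult: "L12 a \<Longrightarrow> FT (\<lambda>x. c * a x) = scaleC c (FT a)"
  by (simp add: FT_def abs_l2_scaleC square_integrable_ft ft_cmult)

lemma abs_l2_cmult: "L12 a \<Longrightarrow> abs_l2 (\<lambda>x. c * a x) = scaleC c (abs_l2 a)"
  by (simp add: abs_l2_scaleC L12_square_integrable)

lemma FT_translate: "L12 a \<Longrightarrow> translate s (FT a) = FT (\<lambda>y. cis (- 2 * pi * s * y) * a y)"
  by (simp add: FT_def abs_l2_translate square_integrable_ft)
     (intro arg_cong[where f = abs_l2] ext, auto simp: ft_def cis_mult mult_ac algebra_simps
        intro!: Bochner_Integration.integral_cong)

lemma norm_abs_l2_less: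
  assumes "square_integrable f" "(LINT x|lborel. (cmod (f x))\<^sup>2) < e\<^sup>2" "e > 0"
  shows "norm (abs_l2 f) < e"
  using assms norm_abs_l2[OF assms(1)] by - (rule power2_less_imp_less, auto)

lemma norm_FT_le: "L12 a \<Longrightarrow> norm (FT a) \<le> norm (abs_l2 a)"
  using ft_norm_le[of a] norm_abs_l2[OF square_integrable_ft, of a] norm_abs_l2[OF L12_square_integrable, of a]
  by - (rule power2_le_imp_le, auto simp: FT_def)

lemma continuous_support_dense:
  assumes "square_integrable f" "e > 0"
  obtains h R where "continuous_on UNIV h" "\<And>x. \<bar>x\<bar> > R \<Longrightarrow> h x = 0" "L12 h" "norm (abs_l2 f - abs_l2 h) < e"
proof -
  obtain h R where h: "continuous_on UNIV h" "\<And>x. \<bar>x\<bar> > R \<Longrightarrow> h x = 0"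
    "(LINT x|lborel. cmod (f x - h x) ^ 2) < e\<^sup>2"
    by (rule continuous_support_approx[of f 2 "e\<^sup>2"]) (use assms in \<open>auto simp: square_integrable_def\<close>)
  have "L12 h" using L12_continuous_support h by blast
  then show thesis
    using norm_abs_l2_less[OF square_integrable_diff h(3) \<open>e > 0\<close>] assms
    by (intro that[OF h(1,2)]) (auto simp: abs_l2_diff L12_square_integrable)
qed

text \<open>Equality is known for continuous functions of compact support. The contraction estimate
  \<open>norm_FT_le\<close>, applied to the difference, makes both sides continuous in the L^2 norm,
  and density finishes.\<close>

lemma norm_FT: 
  assumes a: "L12 a"
  shows "norm (FT a) = norm (abs_l2 a)"
proof (rule antisym[OF norm_FT_le[OF a]], rule field_le_epsilon)
  fix e :: real assume e: "e > 0"
  obtain h R where h: "continuous_on UNIV h" "\<And>x. \<bar>x\<bar> > R \<Longrightarrow> h x = 0" "L12 h" "norm (abs_l2 a - abs_l2 h) < e / 2"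
    using continuous_support_dense[OF L12_square_integrable[OF a], of "e / 2"] e by auto
  have "(LINT x|lborel. (cmod (ft h x))\<^sup>2) = (LINT x|lborel. (cmod (h x))\<^sup>2)"
    by (rule ft_norm_eq[OF h(3)]) (rule autocorr_continuous_support[OF h(1,2)])
  then have eq: "norm (FT h) = norm (abs_l2 h)"
    using norm_abs_l2[OF square_integrable_ft[OF h(3)]] norm_abs_l2[OF L12_square_integrable[OF h(3)]]
    by - (rule power2_eq_imp_eq, auto simp: FT_def)
  have "norm (FT a - FT h) \<le> norm (abs_l2 a - abs_l2 h)"
    using norm_FT_le[OF L12_diff[OF a h(3)]] a h(3)
    by (simp add: FT_diff abs_l2_diff L12_square_integrable)
  then show "norm (abs_l2 a) \<le> norm (FT a) + e"
    using h(4) eq norm_triangle_ineq2[of "FT h" "FT a"] norm_triangle_ineq2[of "abs_l2 a" "abs_l2 h"]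
      norm_minus_commute[of "FT a" "FT h"]
    by linarith
qed

lemma inner_polarization: "inner x y = ((norm (x + y))\<^sup>2 - (norm (x - y))\<^sup>2) / 4" for x y :: "'a::real_inner"
  by (simp add: power2_norm_eq_inner inner_simps inner_commute)

lemma inner_FT: "L12 a \<Longrightarrow> L12 b \<Longrightarrow> inner (FT a) (FT b) = inner (abs_l2 a) (abs_l2 b)"
  using norm_FT[OF L12_add, of a b] norm_FT[OF L12_diff, of a b]
  by (simp add: inner_polarization FT_add FT_diff abs_l2_add abs_l2_diff L12_square_integrable)

lemma cinner_FT_abs: "L12 a \<Longrightarrow> L12 b \<Longrightarrow> cinner (FT a) (FT b) = cinner (abs_l2 a) (abs_l2 b)"
  using inner_FT[of a "\<lambda>x. \<i> * b x"] L12_cmult[of b \<i>]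
  by (simp add: cinner_eq_inner inner_FT FT_cmult abs_l2_cmult)

lemma cinner_FT: "L12 a \<Longrightarrow> L12 b \<Longrightarrow> cinner (FT a) (FT b) = (LINT x|lborel. a x * cnj (b x))"
  by (simp add: cinner_FT_abs cinner_abs_l2 L12_square_integrable)

text \<open>The transform with the opposite sign in the kernel, from space to frequency.\<close>

definition ift :: "(real \<Rightarrow> complex) \<Rightarrow> real \<Rightarrow> complex" where
  "ift w x = ft w (- x)"

text \<open>Inversion in L^2. \<open>ift w\<close> is square integrable but possibly not integrable,
  so it is truncated to bounded intervals before \<open>FT\<close> is applied; this also shows that
  the elements \<open>FT b\<close> are dense.\<close>

lemma
  fixes w :: "real \<Rightarrow> complex"
  assumes w: "L12 w"
  defines "b \<equiv> \<lambda>k x. if \<bar>x\<bar> \<le> real k then ift w x else 0"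
  shows L12_ift_cut: "L12 (b k)"
    and FT_ift_cut: "(\<lambda>k. FT (b k)) \<longlonglongrightarrow> abs_l2 w"
    and ift_cut: "(\<lambda>k. abs_l2 (b k)) \<longlonglongrightarrow> abs_l2 (ift w)"
proof -
  have wi: "integrable lborel w" using w by (simp add: L12_def)
  have [measurable]: "ft w \<in> borel_measurable borel" using wi by measurable
  have [measurable]: "ift w \<in> borel_measurable borel" unfolding ift_def by measurable
  have [measurable]: "b k \<in> borel_measurable borel" for k unfolding b_def by measurable
  have bL: "L12 (b k)" for k
    by (rule L12_bounded_support[of _ "real k" "LINT y|lborel. cmod (w y)"])
       (auto simp: b_def ift_def norm_ft_le[OF wi])
  then show "L12 (b k)" .
  have sq: "square_integrable (ift w)"
    unfolding ift_def using square_integrable_affine[OF square_integrable_ft[OF w], of "-1" 0] by simp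
  have nw: "(norm (abs_l2 (ift w)))\<^sup>2 = (norm (abs_l2 w))\<^sup>2"
    using norm_abs_l2[OF sq] norm_FT[OF w] norm_abs_l2[OF square_integrable_ft[OF w]]
      LINT_reflect[of "\<lambda>x. (cmod (ft w x))\<^sup>2" 0]
    by (simp add: FT_def ift_def)
  have lim1: "(\<lambda>k. LINT x|lborel. (cmod (b k x))\<^sup>2) \<longlonglongrightarrow> (LINT x|lborel. (cmod (ift w x))\<^sup>2)"
    and lim2: "(\<lambda>k. LINT x|lborel. (cmod (b k x - ift w x))\<^sup>2) \<longlonglongrightarrow> (LINT x::real|lborel. (0::real))"
  proof -
    have ev: "\<forall>\<^sub>F k in sequentially. b k x = ift w x" for x
    proof -
      obtain k0 where "real k0 \<ge> \<bar>x\<bar>" using real_arch_simple by blast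
      then show ?thesis by (intro eventually_mono[OF eventually_ge_at_top[of k0]]) (auto simp: b_def)
    qed
    have i: "integrable lborel (\<lambda>x. (cmod (ift w x))\<^sup>2)" using sq by (simp add: square_integrable_def)
    show "(\<lambda>k. LINT x|lborel. (cmod (b k x))\<^sup>2) \<longlonglongrightarrow> (LINT x|lborel. (cmod (ift w x))\<^sup>2)"
    proof (rule integral_dominated_convergence[where w = "\<lambda>x. (cmod (ift w x))\<^sup>2", OF _ _ i])
      show "AE x in lborel. (\<lambda>k. (cmod (b k x))\<^sup>2) \<longlonglongrightarrow> (cmod (ift w x))\<^sup>2"
      proof (rule AE_I2, rule tendsto_eventually)
        fix x show "\<forall>\<^sub>F k in sequentially. (cmod (b k x))\<^sup>2 = (cmod (ift w x))\<^sup>2"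
          using ev[of x] by eventually_elim simp
      qed
    qed (auto simp: b_def)
    show "(\<lambda>k. LINT x|lborel. (cmod (b k x - ift w x))\<^sup>2) \<longlonglongrightarrow> (LINT x::real|lborel. (0::real))"
    proof (rule integral_dominated_convergence[where w = "\<lambda>x. (cmod (ift w x))\<^sup>2", OF _ _ i])
      show "AE x in lborel. (\<lambda>k. (cmod (b k x - ift w x))\<^sup>2) \<longlonglongrightarrow> 0"
      proof (rule AE_I2, rule tendsto_eventually)
        fix x show "\<forall>\<^sub>F k in sequentially. (cmod (b k x - ift w x))\<^sup>2 = 0"
          using ev[of x] by eventually_elim simp
      qed
    qed (auto simp: b_def)
  qed
  have "(\<lambda>k. (norm (abs_l2 (b k) - abs_l2 (ift w)))\<^sup>2) \<longlonglongrightarrow> 0"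
    using lim2 by (simp add: abs_l2_diff L12_square_integrable[OF bL] sq norm_abs_l2 square_integrable_diff)
  then show "(\<lambda>k. abs_l2 (b k)) \<longlonglongrightarrow> abs_l2 (ift w)"
    by (rule tendsto_norm_sq)
  have ftc: "ft (\<lambda>x. cnj (w x)) x = cnj (ift w x)" for x
    unfolding ft_def ift_def Bochner_Integration.integral_cnj[symmetric]
    by (intro Bochner_Integration.integral_cong) (auto simp: cis_cnj)
  \<comment> \<open>By the multiplication formula the pairing of \<open>w\<close> with
    \<open>FT (b k)\<close> is the integral of the squared modulus of \<open>b k\<close>, because
    \<open>b k\<close> is a truncation of \<open>ift w\<close> itself. So \<open>FT (b k)\<close> is
    orthogonal to its own error, and the squared error is a difference of squared norms, which tends
    to 0 by Plancherel.\<close>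
  have ip: "inner (abs_l2 w) (FT (b k)) = (norm (FT (b k)))\<^sup>2" for k
  proof -
    have "(LINT x|lborel. w x * cnj (ft (b k) x)) = cnj (LINT x|lborel. ft (b k) x * cnj (w x))"
      by (simp only: Bochner_Integration.integral_cnj[symmetric]) (simp add: mult.commute)
    also have "\<dots> = cnj (LINT x|lborel. b k x * ft (\<lambda>x. cnj (w x)) x)"
      using bL[of k] wi by (subst ft_mult_formula) (auto simp: L12_def)
    also have "(\<lambda>x. b k x * ft (\<lambda>x. cnj (w x)) x) = (\<lambda>x. complex_of_real ((cmod (b k x))\<^sup>2))"
      unfolding ftc by (auto simp: b_def complex_norm_square simp del: of_real_power)
    finally have "(LINT x|lborel. w x * cnj (ft (b k) x)) = of_real (LINT x|lborel. (cmod (b k x))\<^sup>2)"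
      by (simp only: integral_complex_of_real complex_cnj_complex_of_real)
    then show ?thesis
      using norm_FT[OF bL, of k] norm_abs_l2[OF L12_square_integrable[OF bL], of k]
      unfolding FT_def
      by (subst inner_abs_l2) (auto simp: square_integrable_ft bL L12_square_integrable w)
  qed
  have nb: "(norm (FT (b k) - abs_l2 w))\<^sup>2 = (norm (abs_l2 (ift w)))\<^sup>2 - (LINT x|lborel. (cmod (b k x))\<^sup>2)" for k
  proof -
    have "(norm (FT (b k) - abs_l2 w))\<^sup>2 = (norm (abs_l2 w))\<^sup>2 - (norm (FT (b k)))\<^sup>2"
      using ip[of k] by (simp add: power2_norm_eq_inner inner_simps inner_commute)
    then show ?thesis
      using norm_FT[OF bL, of k] norm_abs_l2[OF L12_square_integrable[OF bL], of k] nw by simp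
  qed
  have "(\<lambda>k. (norm (FT (b k) - abs_l2 w))\<^sup>2) \<longlonglongrightarrow> (norm (abs_l2 (ift w)))\<^sup>2 - (LINT x|lborel. (cmod (ift w x))\<^sup>2)"
    unfolding nb by (intro tendsto_intros lim1)
  then have "(\<lambda>k. (norm (FT (b k) - abs_l2 w))\<^sup>2) \<longlonglongrightarrow> 0" by (simp add: norm_abs_l2[OF sq])
  then show "(\<lambda>k. FT (b k)) \<longlonglongrightarrow> abs_l2 w"
    by (rule tendsto_norm_sq)
qed

text \<open>If \<open>ift w\<close> is integrable, the truncations converge to it in L^2, and by
  isometry their transforms converge to \<open>FT (ift w)\<close> as well as to
  \<open>w\<close>.\<close>

lemma FT_ift:
  assumes w: "L12 w" and i: "L12 (ift w)"
  shows "FT (ift w) = abs_l2 w"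
proof -
  let ?b = "\<lambda>k x. if \<bar>x\<bar> \<le> real k then ift w x else 0"
  have "(\<lambda>k. norm (abs_l2 (?b k) - abs_l2 (ift w))) \<longlonglongrightarrow> 0"
    using ift_cut[OF w] by (simp add: LIM_zero tendsto_norm_zero)
  moreover have "norm (FT (?b k) - FT (ift w)) = norm (abs_l2 (?b k) - abs_l2 (ift w))" for k
    using norm_FT[OF L12_diff[OF L12_ift_cut[OF w, of k] i]] L12_ift_cut[OF w, of k] i
    by (simp add: FT_diff abs_l2_diff L12_square_integrable)
  ultimately have "(\<lambda>k. FT (?b k)) \<longlonglongrightarrow> FT (ift w)"
    by (simp add: LIM_zero_cancel[OF tendsto_norm_zero_cancel])
  then show ?thesis using FT_ift_cut[OF w] LIMSEQ_unique by blast
qed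

lemma FT_dense:
  assumes "e > 0" obtains b where "L12 b" "norm (w - FT b) < e"
proof -
  obtain f where f: "square_integrable f" "w = abs_l2 f" by (rule l2_abs_cases)
  obtain h where h: "L12 h" "norm (abs_l2 f - abs_l2 h) < e / 2"
    using continuous_support_dense[OF f(1), of "e / 2"] assms by auto
  let ?b = "\<lambda>k x. if \<bar>x\<bar> \<le> real k then ift h x else 0"
  obtain k where "norm (FT (?b k) - abs_l2 h) < e / 2"
    using LIMSEQ_D[OF FT_ift_cut[OF h(1)], of "e / 2"] assms by auto
  then have "norm (w - FT (?b k)) < e"
    using h(2) norm_triangle_ineq[of "abs_l2 f - abs_l2 h" "abs_l2 h - FT (?b k)"]
    by (simp add: f norm_minus_commute)
  then show thesis using that L12_ift_cut[OF h(1)] by blast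
qed

lemma FT_dense_seq:
  obtains b where "\<And>n. L12 (b n)" "(\<lambda>n. FT (b n)) \<longlonglongrightarrow> w"
proof -
  have "\<forall>n. \<exists>b. L12 b \<and> norm (w - FT b) < inverse (real (Suc n))"
  proof
    fix n
    have "inverse (real (Suc n)) > 0" by simp
    then obtain b where "L12 b" "norm (w - FT b) < inverse (real (Suc n))" by (rule FT_dense)
    then show "\<exists>b. L12 b \<and> norm (w - FT b) < inverse (real (Suc n))" by blast
  qed
  then obtain b where b: "\<And>n. L12 (b n)" "\<And>n. norm (w - FT (b n)) < inverse (real (Suc n))"
    unfolding choice_iff by blast
  have "(\<lambda>n. FT (b n) - w) \<longlonglongrightarrow> 0"
  proof (rule Lim_null_comparison[OF _ LIMSEQ_inverse_real_of_nat], rule always_eventually, rule allI)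
    show "norm (FT (b n) - w) \<le> inverse (real (Suc n))" for n
      using b(2)[of n] by (metis norm_minus_commute less_imp_le)
  qed
  then show thesis using that b(1) by (metis LIM_zero_cancel)
qed

text \<open>Dominated convergence takes place on the frequency side; the isometry turns it into norm
  convergence in space.\<close>

lemma FT_tendsto:
  assumes a: "\<And>n. L12 (a n)" "L12 b"
    and lim: "AE x in lborel. (\<lambda>n. a n x) \<longlonglongrightarrow> b x" and g: "square_integrable g"
    and le: "\<And>n x. cmod (a n x) \<le> cmod (g x)"
  shows "(\<lambda>n. FT (a n)) \<longlonglongrightarrow> FT b"
proof -
  have [measurable]: "a n \<in> borel_measurable borel" "b \<in> borel_measurable borel" for n
    using a L12_measurable by auto
  have "(\<lambda>n. LINT x|lborel. (cmod (a n x - b x))\<^sup>2) \<longlonglongrightarrow> (LINT x::real|lborel. (0::real))"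
  proof (rule integral_dominated_convergence[where w = "\<lambda>x. (2 * cmod (g x))\<^sup>2"])
    show "AE x in lborel. (\<lambda>n. (cmod (a n x - b x))\<^sup>2) \<longlonglongrightarrow> 0"
      using lim
    proof eventually_elim
      fix x assume "(\<lambda>n. a n x) \<longlonglongrightarrow> b x"
      then have "(\<lambda>n. (cmod (a n x - b x))\<^sup>2) \<longlonglongrightarrow> (cmod (b x - b x))\<^sup>2" by (intro tendsto_intros)
      then show "(\<lambda>n. (cmod (a n x - b x))\<^sup>2) \<longlonglongrightarrow> 0" by simp
    qed
    show "integrable lborel (\<lambda>x. (2 * cmod (g x))\<^sup>2)"
      using g by (simp add: square_integrable_def power_mult_distrib)
    show "AE x in lborel. norm ((cmod (a n x - b x))\<^sup>2) \<le> (2 * cmod (g x))\<^sup>2" for n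
      using lim
    proof eventually_elim
      fix x assume l: "(\<lambda>n. a n x) \<longlonglongrightarrow> b x"
      have "cmod (b x) \<le> cmod (g x)"
        by (rule LIMSEQ_le_const2[OF tendsto_norm[OF l]]) (use le in auto)
      then have "cmod (a n x - b x) \<le> 2 * cmod (g x)"
        using le[of n x] norm_triangle_ineq4[of "a n x" "b x"] by linarith
      then show "norm ((cmod (a n x - b x))\<^sup>2) \<le> (2 * cmod (g x))\<^sup>2"
        using power_mono[OF _ norm_ge_zero, of "a n x - b x" "2 * cmod (g x)" 2] by simp
    qed
  qed auto
  moreover have "(norm (FT (a n) - FT b))\<^sup>2 = (LINT x|lborel. (cmod (a n x - b x))\<^sup>2)" for n
    using norm_FT[OF L12_diff[OF a(1) a(2)], of n] a
    by (simp add: FT_diff norm_abs_l2 L12_square_integrable L12_diff)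
  ultimately have "(\<lambda>n. (norm (FT (a n) - FT b))\<^sup>2) \<longlonglongrightarrow> 0" by simp
  then show ?thesis
    by (rule tendsto_norm_sq)
qed

section \<open>The Hilbert transform of a Fourier transform\<close>

lemma Si_0: "Si 0 = 0"
  using Si_neg[of 0] by simp

lemma Si_tendsto_sgn:
  fixes \<xi> :: real
  assumes "\<xi> \<noteq> 0"
  shows "(\<lambda>n. Si (\<xi> * real n)) \<longlonglongrightarrow> pi / 2 * sgn \<xi>"
proof -
  have pos: "(\<lambda>n. Si (c * real n)) \<longlonglongrightarrow> pi / 2" if "c > 0" for c :: real
    by (rule filterlim_compose[OF Si_at_top])
       (use that in \<open>auto intro!: filterlim_tendsto_pos_mult_at_top[OF tendsto_const] filterlim_real_sequentially\<close>)
  show ?thesis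
  proof (cases "\<xi> > 0")
    case False
    then have "(\<lambda>n. - Si ((- \<xi>) * real n)) \<longlonglongrightarrow> - (pi / 2)"
      using assms by (intro tendsto_minus pos) auto
    moreover have "- Si ((- \<xi>) * real n) = Si (\<xi> * real n)" for n
      using Si_neg[of "(- \<xi>) * real n"] False by (simp add: mult_nonpos_nonneg)
    ultimately show ?thesis using False assms by simp
  qed (use pos in simp)
qed

text \<open>The kernel \<open>1 / s\<close> restricted to \<epsilon> \<le> |s| \<le> T. The negative
  half is written as a reflection of the positive one, so that in the transform the cosines cancel
  and a sine integral remains.\<close>

definition trunc_kernel :: "real \<Rightarrow> real \<Rightarrow> real \<Rightarrow> complex" where
  "trunc_kernel \<epsilon> T s = of_real (indicator {\<epsilon>..T} s / s - indicator {\<epsilon>..T} (- s) / (- s))"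

lemma trunc_kernel_measurable [measurable]: "trunc_kernel \<epsilon> T \<in> borel_measurable borel"
  unfolding trunc_kernel_def by measurable

lemma
  assumes "\<epsilon> > 0" "\<epsilon> \<le> T"
  shows integrable_trunc_kernel: "integrable lborel (trunc_kernel \<epsilon> T)"
    and ft_trunc_kernel: "ft (trunc_kernel \<epsilon> T) (- \<xi>) = - 2 * \<i> * of_real (Si (2 * pi * \<xi> * T) - Si (2 * pi * \<xi> * \<epsilon>))"
proof -
  define k where "k s = complex_of_real (indicator {\<epsilon>..T} s / s)" for s
  have [measurable]: "k \<in> borel_measurable borel" unfolding k_def by measurable
  have kL: "L12 k"
    by (rule L12_bounded_support[of _ T "1 / \<epsilon>"])
       (use assms in \<open>auto simp: k_def indicator_def norm_divide intro!: divide_left_mono\<close>)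
  have ki: "integrable lborel k" using kL by (simp add: L12_def)
  have k': "trunc_kernel \<epsilon> T = (\<lambda>s. k s - k (0 - s))"
    by (auto simp: trunc_kernel_def k_def fun_eq_iff)
  show ti: "integrable lborel (trunc_kernel \<epsilon> T)"
    unfolding k' by (intro Bochner_Integration.integrable_diff ki integrable_reflect)
  have i1: "integrable lborel (\<lambda>s. k s * cis (2 * pi * x * s))" for x by (rule integrable_ft[OF ki])
  have "ft (trunc_kernel \<epsilon> T) (- \<xi>) =
     (LINT s|lborel. k s * cis (2 * pi * (- \<xi>) * s)) - (LINT s|lborel. k (0 - s) * cis (2 * pi * (- \<xi>) * s))"
    unfolding ft_def k' left_diff_distrib
    using i1[of "- \<xi>"] integrable_reflect[OF i1[of \<xi>], of 0]
    by (subst Bochner_Integration.integral_diff) auto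
  also have "(LINT s|lborel. k (0 - s) * cis (2 * pi * (- \<xi>) * s)) = (LINT s|lborel. k s * cis (2 * pi * \<xi> * s))"
    using LINT_reflect[of "\<lambda>s. k s * cis (2 * pi * \<xi> * s)" 0] by simp
  also have "(LINT s|lborel. k s * cis (2 * pi * (- \<xi>) * s)) - (LINT s|lborel. k s * cis (2 * pi * \<xi> * s)) =
    (LINT s|lborel. k s * cis (2 * pi * (- \<xi>) * s) - k s * cis (2 * pi * \<xi> * s))"
    using i1[of "- \<xi>"] i1[of \<xi>] by (subst Bochner_Integration.integral_diff) auto
  also have "\<dots> = (LINT s|lborel. (- 2 * \<i>) * of_real (indicator {\<epsilon>..T} s *\<^sub>R (sin (2 * pi * \<xi> * s) / s)))"
    by (intro Bochner_Integration.integral_cong) (auto simp: k_def complex_eq_iff indicator_def)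
  also have "\<dots> = (- 2 * \<i>) * of_real (LINT s|lborel. indicator {\<epsilon>..T} s *\<^sub>R (sin (2 * pi * \<xi> * s) / s))"
    by (simp only: integral_mult_right_zero integral_complex_of_real)
  also have "(LINT s|lborel. indicator {\<epsilon>..T} s *\<^sub>R (sin (2 * pi * \<xi> * s) / s)) = Si (2 * pi * \<xi> * T) - Si (2 * pi * \<xi> * \<epsilon>)"
  proof (rule integral_FTC_Icc[OF \<open>\<epsilon> \<le> T\<close>])
    fix s assume s: "\<epsilon> \<le> s" "s \<le> T"
    have "((\<lambda>s. Si (2 * pi * \<xi> * s)) has_real_derivative sinc (2 * pi * \<xi> * s) * (2 * pi * \<xi>)) (at s)"
      by (rule DERIV_chain2[OF DERIV_Si]) (auto intro!: derivative_eq_intros)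
    moreover have "sinc (2 * pi * \<xi> * s) * (2 * pi * \<xi>) = sin (2 * pi * \<xi> * s) / s"
      using s assms by (cases "\<xi> = 0") auto
    ultimately show "((\<lambda>s. Si (2 * pi * \<xi> * s)) has_vector_derivative sin (2 * pi * \<xi> * s) / s) (at s within {\<epsilon>..T})"
      by (simp add: has_real_derivative_iff_has_vector_derivative has_vector_derivative_at_within)
  qed (use assms in \<open>auto intro!: continuous_intros\<close>)
  finally show "ft (trunc_kernel \<epsilon> T) (- \<xi>) = - 2 * \<i> * of_real (Si (2 * pi * \<xi> * T) - Si (2 * pi * \<xi> * \<epsilon>))" by simp
qed

text \<open>Away from 0 the function \<open>1 / s\<close> is square integrable, by comparison with
  \<open>1 / (1 + s^2)\<close>, so its product with \<open>f\<close> is integrable.\<close>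

lemma integrable_tail_over:
  assumes f: "square_integrable f" and e: "\<epsilon> > 0"
  shows "integrable lborel (\<lambda>s. f s * of_real (indicator {s. \<bar>s\<bar> > \<epsilon>} s / s))"
proof -
  let ?g = "\<lambda>s::real. complex_of_real (indicator {s. \<bar>s\<bar> > \<epsilon>} s / s)"
  have "square_integrable ?g"
    unfolding square_integrable_def
  proof
    show "integrable lborel (\<lambda>x. (cmod (?g x))\<^sup>2)"
    proof (rule Bochner_Integration.integrable_bound)
      show "integrable lborel (\<lambda>x::real. (1 + 1 / \<epsilon>\<^sup>2) * inverse (1 + x\<^sup>2))"
        using integrable_inverse_1_plus_square by (auto simp: set_integrable_def)
      have "(1 / x)\<^sup>2 \<le> (1 + 1 / \<epsilon>\<^sup>2) * inverse (1 + x\<^sup>2)" if "\<bar>x\<bar> > \<epsilon>" for x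
      proof -
        define X where "X = x\<^sup>2"
        define E where "E = \<epsilon>\<^sup>2"
        have E: "E > 0" using e by (simp add: E_def)
        have EX: "E \<le> X" using that e unfolding E_def X_def by (simp add: abs_le_square_iff[symmetric])
        then have X: "X > 0" using E by linarith
        have "1 \<le> X / E" using E EX by simp
        then have "1 + X \<le> X * (1 + 1 / E)" by (simp add: distrib_left)
        then have "(1 + X) / (X * (1 + X)) \<le> X * (1 + 1 / E) / (X * (1 + X))"
          using X by (intro divide_right_mono) auto
        moreover have "(1 + X) / (X * (1 + X)) = 1 / X" "X * (1 + 1 / E) / (X * (1 + X)) = (1 + 1 / E) * inverse (1 + X)"
          using X by (simp_all add: divide_inverse)
        ultimately have "1 / X \<le> (1 + 1 / E) * inverse (1 + X)" by simp
        then show ?thesis unfolding X_def E_def by (simp only: power_divide power_one)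
      qed
      then show "AE x in lborel. norm ((cmod (?g x))\<^sup>2) \<le> norm ((1 + 1 / \<epsilon>\<^sup>2) * inverse (1 + x\<^sup>2))"
        by (intro AE_I2) (simp add: indicator_def norm_divide power_divide)
    qed measurable
  qed measurable
  from square_integrable_mult_cnj[OF f this] show ?thesis by simp
qed

text \<open>The kernel on |s| > \<epsilon> is not integrable at infinity. Fubini is therefore
  applied to the kernel cut off at \<open>n\<close>, and \<open>n\<close> tends to infinity
  afterwards: in space under a product of two square integrable functions, on the frequency side
  because \<open>Si\<close> is bounded with limits \<open>pi / 2\<close> and
  \<open>- pi / 2\<close>.\<close>

lemma truncated_hilbert:
  assumes a: "L12 a" and e: "\<epsilon> > 0"
  shows "(LINT y:{y. \<bar>x - y\<bar> > \<epsilon>}|lborel. ft a y / of_real (x - y)) =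
     (LINT \<xi>|lborel. a \<xi> * cis (2 * pi * x * \<xi>) * (- 2 * \<i> * of_real (pi / 2 * sgn \<xi> - Si (2 * pi * \<xi> * \<epsilon>))))"
proof -
  have ai: "integrable lborel a" using a by (simp add: L12_def)
  have [measurable]: "a \<in> borel_measurable borel" "ft a \<in> borel_measurable borel"
    using ai by measurable
  let ?g = "\<lambda>s. of_real (indicator {s. \<bar>s\<bar> > \<epsilon>} s / s) :: complex"
  have sq: "square_integrable (\<lambda>s. ft a (x - s))"
    using square_integrable_affine[OF square_integrable_ft[OF a], of "-1" x] by simp
  obtain B where B: "\<And>T. \<bar>Si T\<bar> \<le> B" using bounded_Si by blast
  have "(LINT y:{y. \<bar>x - y\<bar> > \<epsilon>}|lborel. ft a y / of_real (x - y)) =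
      (LINT y|lborel. ft a (x - (x - y)) * ?g (x - y))"
    unfolding set_lebesgue_integral_def
    by (intro Bochner_Integration.integral_cong) (auto simp: indicator_def divide_inverse)
  also have "\<dots> = (LINT s|lborel. ft a (x - s) * ?g s)"
    by (rule LINT_reflect)
  finally have 1: "(LINT y:{y. \<bar>x - y\<bar> > \<epsilon>}|lborel. ft a y / of_real (x - y)) = (LINT s|lborel. ft a (x - s) * ?g s)" .
  define I where "I n = (LINT s|lborel. ft a (x - s) * trunc_kernel \<epsilon> (real n) s)" for n
  \<comment> \<open>The truncated kernel uses a closed interval and the tail a strict inequality;
    they disagree only at |s| = \<epsilon>.\<close>
  have AEe: "AE s in lborel. \<bar>s\<bar> \<noteq> \<epsilon>"
    using AE_lborel_singleton[of \<epsilon>] AE_lborel_singleton[of "- \<epsilon>"] by eventually_elim auto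
  have lim1: "I \<longlonglongrightarrow> (LINT s|lborel. ft a (x - s) * ?g s)"
    unfolding I_def
  proof (rule integral_dominated_convergence[where w = "\<lambda>s. cmod (ft a (x - s) * ?g s)"])
    show "AE s in lborel. (\<lambda>n. ft a (x - s) * trunc_kernel \<epsilon> (real n) s) \<longlonglongrightarrow> ft a (x - s) * ?g s"
      using AEe
    proof eventually_elim
      fix s :: real assume s: "\<bar>s\<bar> \<noteq> \<epsilon>"
      obtain n0 where n0: "real n0 \<ge> \<bar>s\<bar>" using real_arch_simple by blast
      have "trunc_kernel \<epsilon> (real n) s = ?g s" if "n \<ge> n0" for n
      proof -
        have "\<bar>s\<bar> \<le> real n" using n0 that by linarith
        then show ?thesis using s e by (auto simp: trunc_kernel_def indicator_def abs_if split: if_splits)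
      qed
      then have "\<forall>\<^sub>F n in sequentially. ft a (x - s) * trunc_kernel \<epsilon> (real n) s = ft a (x - s) * ?g s"
        by (intro eventually_mono[OF eventually_ge_at_top[of n0]]) auto
      then show "(\<lambda>n. ft a (x - s) * trunc_kernel \<epsilon> (real n) s) \<longlonglongrightarrow> ft a (x - s) * ?g s"
        by (rule tendsto_eventually)
    qed
    show "AE s in lborel. norm (ft a (x - s) * trunc_kernel \<epsilon> (real n) s) \<le> cmod (ft a (x - s) * ?g s)" for n
      using AEe
    proof eventually_elim
      fix s :: real assume s: "\<bar>s\<bar> \<noteq> \<epsilon>"
      then have "cmod (trunc_kernel \<epsilon> (real n) s) \<le> cmod (?g s)"
        using e by (auto simp: trunc_kernel_def indicator_def abs_if split: if_splits)
      then show "norm (ft a (x - s) * trunc_kernel \<epsilon> (real n) s) \<le> cmod (ft a (x - s) * ?g s)"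
        by (simp only: norm_mult mult_left_mono norm_ge_zero)
    qed
  qed (use integrable_tail_over[OF sq e] in auto)
  have I_eq: "I n = (LINT \<xi>|lborel. a \<xi> * cis (2 * pi * x * \<xi>) * (- 2 * \<i> * of_real (Si (2 * pi * \<xi> * real n) - Si (2 * pi * \<xi> * \<epsilon>))))"
    if n: "\<epsilon> \<le> real n" for n
  proof -
    have "I n = (LINT s|lborel. LINT \<xi>|lborel. a \<xi> * cis (2 * pi * (x - s) * \<xi>) * trunc_kernel \<epsilon> (real n) s)"
      unfolding I_def ft_def by (simp only: integral_mult_left_zero)
    also have "\<dots> = (LINT \<xi>|lborel. LINT s|lborel. a \<xi> * cis (2 * pi * (x - s) * \<xi>) * trunc_kernel \<epsilon> (real n) s)"
      by (rule Fubini_dominated[OF _ integrable_trunc_kernel[OF e n] ai]) (auto simp: norm_mult)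
    also have "\<dots> = (LINT \<xi>|lborel. LINT s|lborel. (a \<xi> * cis (2 * pi * x * \<xi>)) * (trunc_kernel \<epsilon> (real n) s * cis (2 * pi * (- \<xi>) * s)))"
      by (intro Bochner_Integration.integral_cong) (auto simp: cis_mult left_diff_distrib right_diff_distrib mult_ac)
    also have "\<dots> = (LINT \<xi>|lborel. (a \<xi> * cis (2 * pi * x * \<xi>)) * ft (trunc_kernel \<epsilon> (real n)) (- \<xi>))"
      unfolding ft_def by (simp only: integral_mult_right_zero)
    finally show ?thesis by (simp only: ft_trunc_kernel[OF e n])
  qed
  have lim2: "(\<lambda>n. LINT \<xi>|lborel. a \<xi> * cis (2 * pi * x * \<xi>) * (- 2 * \<i> * of_real (Si (2 * pi * \<xi> * real n) - Si (2 * pi * \<xi> * \<epsilon>))))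
    \<longlonglongrightarrow> (LINT \<xi>|lborel. a \<xi> * cis (2 * pi * x * \<xi>) * (- 2 * \<i> * of_real (pi / 2 * sgn \<xi> - Si (2 * pi * \<xi> * \<epsilon>))))"
  proof (rule integral_dominated_convergence[where w = "\<lambda>\<xi>. cmod (a \<xi>) * (4 * B)"])
    show "AE \<xi> in lborel. (\<lambda>n. a \<xi> * cis (2 * pi * x * \<xi>) * (- 2 * \<i> * of_real (Si (2 * pi * \<xi> * real n) - Si (2 * pi * \<xi> * \<epsilon>))))
       \<longlonglongrightarrow> a \<xi> * cis (2 * pi * x * \<xi>) * (- 2 * \<i> * of_real (pi / 2 * sgn \<xi> - Si (2 * pi * \<xi> * \<epsilon>)))"
      using AE_lborel_singleton[of 0]
    proof eventually_elim
      fix \<xi> :: real assume "\<xi> \<noteq> 0"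
      then have "(\<lambda>n. Si (2 * pi * \<xi> * real n)) \<longlonglongrightarrow> pi / 2 * sgn \<xi>"
        using Si_tendsto_sgn[of "2 * pi * \<xi>"] by (simp add: sgn_mult)
      then show "(\<lambda>n. a \<xi> * cis (2 * pi * x * \<xi>) * (- 2 * \<i> * of_real (Si (2 * pi * \<xi> * real n) - Si (2 * pi * \<xi> * \<epsilon>))))
       \<longlonglongrightarrow> a \<xi> * cis (2 * pi * x * \<xi>) * (- 2 * \<i> * of_real (pi / 2 * sgn \<xi> - Si (2 * pi * \<xi> * \<epsilon>)))"
        by (intro tendsto_intros)
    qed
    have "2 * \<bar>Si y - Si z\<bar> \<le> 4 * B" for y z 
    proof -
      have "\<bar>Si y - Si z\<bar> \<le> B + B"
        by (rule order_trans[OF abs_triangle_ineq4 add_mono[OF B B]])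
      then show ?thesis by simp
    qed
    then show "AE \<xi> in lborel. norm (a \<xi> * cis (2 * pi * x * \<xi>) * (- 2 * \<i> * of_real (Si (2 * pi * \<xi> * real n) - Si (2 * pi * \<xi> * \<epsilon>))))
        \<le> cmod (a \<xi>) * (4 * B)" for n
      by (intro AE_I2) (simp only: norm_mult norm_cis norm_minus_cancel norm_numeral norm_ii norm_of_real mult_1_right,
          simp only: mult.assoc mult_1 mult_left_mono norm_ge_zero)
  qed (use ai in auto)
  obtain n0 where "real n0 \<ge> \<epsilon>" using real_arch_simple by blast
  then have "\<forall>\<^sub>F n in sequentially. (LINT \<xi>|lborel. a \<xi> * cis (2 * pi * x * \<xi>) * (- 2 * \<i> * of_real (Si (2 * pi * \<xi> * real n) - Si (2 * pi * \<xi> * \<epsilon>)))) = I n"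
    by (intro eventually_mono[OF eventually_ge_at_top[of n0]] I_eq[symmetric]) (auto simp: order_trans)
  then have "I \<longlonglongrightarrow> (LINT \<xi>|lborel. a \<xi> * cis (2 * pi * x * \<xi>) * (- 2 * \<i> * of_real (pi / 2 * sgn \<xi> - Si (2 * pi * \<xi> * \<epsilon>))))"
    using lim2 by (rule Lim_transform_eventually[rotated])
  then show ?thesis unfolding 1 by (rule LIMSEQ_unique[OF lim1])
qed

lemma L12_sgn: "L12 a \<Longrightarrow> L12 (\<lambda>\<xi>. of_real (sgn \<xi>) * a \<xi>)"
  by (rule L12_mult_bounded[where B = 1]) (auto simp: sgn_if)

text \<open>With \<open>a\<close> integrable, boundedness of \<open>Si\<close> allows \<epsilon>
  \<rightarrow> 0 under the frequency integral, for every \<open>x\<close>. Since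
  \<open>Si 0 = 0\<close>, the surviving symbol is \<open>- pi * \<i> * sgn \<xi>\<close>.\<close>

lemma hilbert_pointwise:
  assumes a: "L12 a"
  shows "((\<lambda>\<epsilon>. LINT y:{y. \<bar>x - y\<bar> > \<epsilon>}|lborel. ft a y / of_real (x - y)) \<longlongrightarrow>
     ft (\<lambda>\<xi>. - pi * \<i> * (of_real (sgn \<xi>) * a \<xi>)) x) (at_right 0)"
proof (rule tendsto_at_right_sequentially[of 0 1])
  have ai: "integrable lborel a" using a by (simp add: L12_def)
  have [measurable]: "a \<in> borel_measurable borel" using ai by measurable
  obtain B where B: "\<And>T. \<bar>Si T\<bar> \<le> B" using bounded_Si by blast
  fix S :: "nat \<Rightarrow> real" assume S: "\<And>n. 0 < S n" "S \<longlonglongrightarrow> 0"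
  have "(\<lambda>n. LINT \<xi>|lborel. a \<xi> * cis (2 * pi * x * \<xi>) * (- 2 * \<i> * of_real (pi / 2 * sgn \<xi> - Si (2 * pi * \<xi> * S n))))
    \<longlonglongrightarrow> (LINT \<xi>|lborel. a \<xi> * cis (2 * pi * x * \<xi>) * (- 2 * \<i> * of_real (pi / 2 * sgn \<xi> - Si 0)))"
  proof (rule integral_dominated_convergence[where w = "\<lambda>\<xi>. cmod (a \<xi>) * (pi + 2 * B)"])
    have "(\<lambda>n. Si (2 * pi * \<xi> * S n)) \<longlonglongrightarrow> Si 0" for \<xi>
      by (rule isCont_tendsto_compose[OF isCont_Si]) (auto intro!: tendsto_eq_intros S)
    then show "AE \<xi> in lborel. (\<lambda>n. a \<xi> * cis (2 * pi * x * \<xi>) * (- 2 * \<i> * of_real (pi / 2 * sgn \<xi> - Si (2 * pi * \<xi> * S n))))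
       \<longlonglongrightarrow> a \<xi> * cis (2 * pi * x * \<xi>) * (- 2 * \<i> * of_real (pi / 2 * sgn \<xi> - Si 0))"
      by (intro AE_I2 tendsto_intros)
    have "2 * \<bar>pi / 2 * sgn \<xi> - Si z\<bar> \<le> pi + 2 * B" for \<xi> z
    proof -
      have "\<bar>pi / 2 * sgn \<xi>\<bar> \<le> pi / 2" by (auto simp: sgn_if)
      then have "\<bar>pi / 2 * sgn \<xi> - Si z\<bar> \<le> pi / 2 + B"
        by (rule order_trans[OF abs_triangle_ineq4 add_mono[OF _ B]])
      then show ?thesis by simp
    qed
    then show "AE \<xi> in lborel. norm (a \<xi> * cis (2 * pi * x * \<xi>) * (- 2 * \<i> * of_real (pi / 2 * sgn \<xi> - Si (2 * pi * \<xi> * S n))))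
        \<le> cmod (a \<xi>) * (pi + 2 * B)" for n
      by (intro AE_I2) (simp only: norm_mult norm_cis norm_minus_cancel norm_numeral norm_ii norm_of_real mult_1_right,
          simp only: mult.assoc mult_1 mult_left_mono norm_ge_zero)
  qed (use ai in auto)
  also have "(LINT \<xi>|lborel. a \<xi> * cis (2 * pi * x * \<xi>) * (- 2 * \<i> * of_real (pi / 2 * sgn \<xi> - Si 0))) =
    ft (\<lambda>\<xi>. - pi * \<i> * (of_real (sgn \<xi>) * a \<xi>)) x"
    unfolding ft_def by (intro Bochner_Integration.integral_cong) (auto simp: Si_0)
  finally show "(\<lambda>n. LINT y:{y. \<bar>x - y\<bar> > S n}|lborel. ft a y / of_real (x - y)) \<longlonglongrightarrow>
     ft (\<lambda>\<xi>. - pi * \<i> * (of_real (sgn \<xi>) * a \<xi>)) x"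
    by (simp only: truncated_hilbert[OF a S(1)])
qed simp

text \<open>The pointwise limit exhibits one Hilbert transform, and uniqueness of limits fixes the
  representative of any other almost everywhere; together they resolve the definite description in
  \<open>hilbert\<close>.\<close>

lemma hilbert_FT:
  assumes a: "L12 a"
  shows "hilbert (FT a) = scaleC (- pi * \<i>) (FT (\<lambda>\<xi>. of_real (sgn \<xi>) * a \<xi>))"
proof -
  let ?b = "\<lambda>\<xi>. - pi * \<i> * (of_real (sgn \<xi>) * a \<xi>)"
  have b: "L12 ?b" by (rule L12_cmult[OF L12_sgn[OF a]])
  have rep: "AE y in lborel. rep_l2 (FT a) y = ft a y"
    unfolding FT_def by (rule rep_abs_l2[OF square_integrable_ft[OF a]])
  have [measurable]: "ft a \<in> borel_measurable borel" "rep_l2 (FT a) \<in> borel_measurable borel"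
    using a square_integrable_rep[of "FT a"] by (auto simp: L12_def square_integrable_def)
  have eq: "(LINT y:{y. \<bar>x - y\<bar> > \<epsilon>}|lborel. rep_l2 (FT a) y / of_real (x - y)) =
     (LINT y:{y. \<bar>x - y\<bar> > \<epsilon>}|lborel. ft a y / of_real (x - y))" for x \<epsilon>
    unfolding set_lebesgue_integral_def
    by (rule integral_cong_AE) (use rep in \<open>auto elim: eventually_mono\<close>)
  have lim: "((\<lambda>\<epsilon>. LINT y:{y. \<bar>x - y\<bar> > \<epsilon>}|lborel. rep_l2 (FT a) y / of_real (x - y)) \<longlongrightarrow> ft ?b x) (at_right 0)" for x
    unfolding eq by (rule hilbert_pointwise[OF a])
  have repb: "AE x in lborel. rep_l2 (FT ?b) x = ft ?b x"
    unfolding FT_def by (rule rep_abs_l2[OF square_integrable_ft[OF b]])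
  have "is_hilbert_transform (FT a) (FT ?b)"
    unfolding is_hilbert_transform_def using repb by eventually_elim (use lim in auto)
  moreover have "z = FT ?b" if "is_hilbert_transform (FT a) z" for z
  proof (rule l2_eqI)
    show "AE x in lborel. rep_l2 z x = rep_l2 (FT ?b) x"
      using that[unfolded is_hilbert_transform_def] repb
    proof eventually_elim
      case (elim x)
      have "rep_l2 z x = ft ?b x"
        by (rule tendsto_unique[OF trivial_limit_at_right_real elim(1) lim])
      then show ?case using elim(2) by simp
    qed
  qed
  ultimately have "hilbert (FT a) = FT ?b"
    unfolding hilbert_def by (rule the_equality)
  then show ?thesis using FT_cmult[OF L12_sgn[OF a], of "- pi * \<i>"] by simp
qed

section \<open>Translation-invariant operators\<close>

lemma bounded_operatorD:
  assumes "bounded_operator T"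
  shows "T (v + w) = T v + T w" "T (v - w) = T v - T w" "T (scaleC z w) = scaleC z (T w)"
    "T 0 = 0" "T (- w) = - T w" "T (r *\<^sub>R w) = r *\<^sub>R T w"
  using assms unfolding bounded_operator_def
  by (auto simp: linear_simps)

lemma bounded_operator_tendsto:
  "bounded_operator T \<Longrightarrow> (f \<longlongrightarrow> w) F \<Longrightarrow> ((\<lambda>x. T (f x)) \<longlongrightarrow> T w) F"
  unfolding bounded_operator_def by (auto intro: bounded_linear.tendsto)

text \<open>
  The weak form only refers to inner products with transforms of functions in \<open>L\<^sup>1\<close>, so that
  nothing has to be known about \<open>T (FT a)\<close> beyond its membership in \<open>L\<^sup>2\<close>.
\<close>

definition commuting :: "(l2 \<Rightarrow> l2) \<Rightarrow> (real \<Rightarrow> complex) \<Rightarrow> bool" where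
  "commuting T f \<longleftrightarrow> f \<in> borel_measurable borel \<and> (\<exists>B. \<forall>x. cmod (f x) \<le> B) \<and>
     (\<forall>a b. L12 a \<longrightarrow> L12 b \<longrightarrow>
        cinner (T (FT (\<lambda>x. f x * a x))) (FT b) = cinner (T (FT a)) (FT (\<lambda>x. cnj (f x) * b x)))"

lemma commuting_L12:
  assumes "commuting T f" "L12 a"
  shows "L12 (\<lambda>x. f x * a x)" "L12 (\<lambda>x. cnj (f x) * a x)"
proof -
  obtain B where "\<And>x. cmod (f x) \<le> B" "f \<in> borel_measurable borel"
    using assms(1) by (auto simp: commuting_def)
  then show "L12 (\<lambda>x. f x * a x)" "L12 (\<lambda>x. cnj (f x) * a x)"
    using assms(2) by (auto intro!: L12_mult_bounded[where B = B])
qed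

lemma commutingD:
  "commuting T f \<Longrightarrow> L12 a \<Longrightarrow> L12 b \<Longrightarrow>
    cinner (T (FT (\<lambda>x. f x * a x))) (FT b) = cinner (T (FT a)) (FT (\<lambda>x. cnj (f x) * b x))"
  by (auto simp: commuting_def)

section \<open>Multipliers that commute with a translation-invariant operator\<close>

context
  fixes T :: "l2 \<Rightarrow> l2"
  assumes T: "bounded_operator T" and ti: "translation_invariant T"
begin

lemma commuting_const: "commuting T (\<lambda>x. z)"
  unfolding commuting_def
  by (auto simp: FT_cmult bounded_operatorD[OF T] cinner_scaleC_left cinner_scaleC_right)

lemma commuting_add:
  assumes f: "commuting T f" and g: "commuting T g"
  shows "commuting T (\<lambda>x. f x + g x)"
  unfolding commuting_def
proof (intro conjI allI impI)
  show "(\<lambda>x. f x + g x) \<in> borel_measurable borel" using f g by (auto simp: commuting_def)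
  obtain B C where "\<And>x. cmod (f x) \<le> B" "\<And>x. cmod (g x) \<le> C" using f g by (auto simp: commuting_def)
  then have "\<And>x. cmod (f x + g x) \<le> B + C" by (meson add_mono norm_triangle_ineq order_trans)
  then show "\<exists>B. \<forall>x. cmod (f x + g x) \<le> B" by blast
  fix a b assume a: "L12 a" and b: "L12 b"
  show "cinner (T (FT (\<lambda>x. (f x + g x) * a x))) (FT b) = cinner (T (FT a)) (FT (\<lambda>x. cnj (f x + g x) * b x))"
    using commutingD[OF f a b] commutingD[OF g a b]
    by (simp add: distrib_right FT_add commuting_L12[OF f] commuting_L12[OF g] a b
        bounded_operatorD[OF T] cinner_add_left cinner_add_right)
qed

lemma commuting_mult:
  assumes f: "commuting T f" and g: "commuting T g"
  shows "commuting T (\<lambda>x. f x * g x)"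
  unfolding commuting_def
proof (intro conjI allI impI)
  show "(\<lambda>x. f x * g x) \<in> borel_measurable borel" using f g by (auto simp: commuting_def)
  obtain B C where BC: "\<And>x. cmod (f x) \<le> B" "\<And>x. cmod (g x) \<le> C" using f g by (auto simp: commuting_def)
  have "cmod (f x * g x) \<le> B * C" for x
    unfolding norm_mult using BC[of x] by (intro mult_mono) (auto intro: order_trans[OF norm_ge_zero])
  then show "\<exists>B. \<forall>x. cmod (f x * g x) \<le> B" by blast
  fix a b assume a: "L12 a" and b: "L12 b"
  show "cinner (T (FT (\<lambda>x. f x * g x * a x))) (FT b) = cinner (T (FT a)) (FT (\<lambda>x. cnj (f x * g x) * b x))"
    using commutingD[OF f commuting_L12(1)[OF g a] b] commutingD[OF g a commuting_L12(2)[OF f b]]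
    by (simp add: mult_ac)
qed

lemma commuting_cmult: "commuting T f \<Longrightarrow> commuting T (\<lambda>x. z * f x)"
  by (rule commuting_mult[OF commuting_const])

lemma commuting_diff: "commuting T f \<Longrightarrow> commuting T g \<Longrightarrow> commuting T (\<lambda>x. f x - g x)"
  using commuting_add[OF _ commuting_cmult[of g "-1"], of f] by simp

lemma commuting_sum:
  "(\<And>i. i \<in> I \<Longrightarrow> commuting T (f i)) \<Longrightarrow> commuting T (\<lambda>x. \<Sum>i\<in>I. f i x)"
  by (induction I rule: infinite_finite_induct) (auto intro: commuting_const commuting_add)

text \<open>Bounded pointwise convergence of the multipliers gives norm convergence in either slot
  of the inner product, and \<open>T\<close> is continuous. This closure property is what carries
  the class from characters to all bounded measurable functions.\<close>

lemma commuting_lim: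
  assumes f: "\<And>n. commuting T (f n)" and B: "\<And>n x. cmod (f n x) \<le> B"
    and lim: "\<And>x. (\<lambda>n. f n x) \<longlonglongrightarrow> g x"
  shows "commuting T g"
  unfolding commuting_def
proof (intro conjI allI impI)
  have [measurable]: "f n \<in> borel_measurable borel" for n using f by (auto simp: commuting_def)
  show gm [measurable]: "g \<in> borel_measurable borel"
    by (rule borel_measurable_LIMSEQ_metric[of f]) (auto simp: lim)
  have gB: "cmod (g x) \<le> B" for x
    by (rule LIMSEQ_le_const2[OF tendsto_norm[OF lim]]) (use B in auto)
  then show "\<exists>B. \<forall>x. cmod (g x) \<le> B" by blast
  fix a b assume a: "L12 a" and b: "L12 b"
  have conv: "(\<lambda>n. FT (\<lambda>x. h n x * d x)) \<longlonglongrightarrow> FT (\<lambda>x. k x * d x)"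
    if "\<And>n x. cmod (h n x) \<le> B" "\<And>x. (\<lambda>n. h n x) \<longlonglongrightarrow> k x" "\<And>n. h n \<in> borel_measurable borel"
      "k \<in> borel_measurable borel" "\<And>x. cmod (k x) \<le> B" "L12 d" for h k d
  proof (rule FT_tendsto)
    show "square_integrable (\<lambda>x. of_real B * d x)"
      using that(6) by (intro square_integrable_cmult) (simp add: L12_def)
    have "B \<ge> 0" using B[of 0 0] norm_ge_zero order_trans by blast
    then show "cmod (h n x * d x) \<le> cmod (of_real B * d x)" for n x
      using that(1) by (simp add: norm_mult mult_right_mono)
    show "AE x in lborel. (\<lambda>n. h n x * d x) \<longlonglongrightarrow> k x * d x"
      by (intro AE_I2 tendsto_intros that)
  qed (rule L12_mult_bounded[OF that(6)], (rule that)+)+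
  have "(\<lambda>n. cinner (T (FT (\<lambda>x. f n x * a x))) (FT b)) \<longlonglongrightarrow> cinner (T (FT (\<lambda>x. g x * a x))) (FT b)"
    by (intro tendsto_cinner bounded_operator_tendsto[OF T] conv tendsto_const) (auto simp: B lim gB a)
  moreover have "(\<lambda>n. cinner (T (FT a)) (FT (\<lambda>x. cnj (f n x) * b x))) \<longlonglongrightarrow> cinner (T (FT a)) (FT (\<lambda>x. cnj (g x) * b x))"
    by (intro tendsto_cinner conv tendsto_const) (auto simp: B lim gB b intro!: tendsto_cnj)
  ultimately show "cinner (T (FT (\<lambda>x. g x * a x))) (FT b) = cinner (T (FT a)) (FT (\<lambda>x. cnj (g x) * b x))"
    using commutingD[OF f a b] by (simp add: LIMSEQ_unique)
qed

lemma cinner_translate: "cinner (translate s v) (translate s w) = cinner v w"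
proof (rule l2_abs_cases[of v], rule l2_abs_cases[of w])
  fix f g assume f: "square_integrable f" "v = abs_l2 f" and g: "square_integrable g" "w = abs_l2 g"
  have "square_integrable (\<lambda>x. f (x - s))" "square_integrable (\<lambda>x. g (x - s))"
    using square_integrable_affine[of f 1 "-s"] square_integrable_affine[of g 1 "-s"] f g by simp_all
  then show ?thesis
    using LINT_shift[of "\<lambda>x. f x * cnj (g x)" s]
    by (simp add: f g abs_l2_translate cinner_abs_l2)
qed

text \<open>Multiplication by a character on the frequency side is a translation in space, and
  translations are unitary. This is where the invariance of \<open>T\<close> enters.\<close>

lemma commuting_cis: "commuting T (\<lambda>x. cis (s * x))"
  unfolding commuting_def
proof (intro conjI allI impI)
  show "(\<lambda>x. cis (s * x)) \<in> borel_measurable borel" by measurable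
  show "\<exists>B. \<forall>x. cmod (cis (s * x)) \<le> B" by (auto intro: exI[of _ 1])
  fix a b assume a: "L12 a" and b: "L12 b"
  define r where "r = - s / (2 * pi)"
  have r: "- 2 * pi * r = s" by (simp add: r_def)
  have b': "L12 (\<lambda>x. cnj (cis (s * x)) * b x)"
    by (rule L12_mult_bounded[OF b, where B = 1]) auto
  have "translate r (FT (\<lambda>x. cnj (cis (s * x)) * b x)) = FT (\<lambda>x. cis (s * x) * (cnj (cis (s * x)) * b x))"
    using FT_translate[OF b', of r] unfolding r .
  also have "(\<lambda>x. cis (s * x) * (cnj (cis (s * x)) * b x)) = b"
    by (auto simp: cis_cnj cis_mult mult.assoc[symmetric])
  finally have 1: "FT b = translate r (FT (\<lambda>x. cnj (cis (s * x)) * b x))" by simp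
  have "T (FT (\<lambda>x. cis (s * x) * a x)) = translate r (T (FT a))"
    using ti FT_translate[OF a, of r] unfolding r translation_invariant_def by metis
  then show "cinner (T (FT (\<lambda>x. cis (s * x) * a x))) (FT b) = cinner (T (FT a)) (FT (\<lambda>x. cnj (cis (s * x)) * b x))"
    unfolding 1 by (simp only: cinner_translate)
qed

lemma commuting_sin: "commuting T (\<lambda>x. of_real (sin (s * (x - y))))"
proof -
  have "(\<lambda>x. complex_of_real (sin (s * (x - y)))) =
     (\<lambda>x. (- \<i> / 2) * (cis (- (s * y)) * cis (s * x) - cis (s * y) * cis (- s * x)))"
    by (auto simp: fun_eq_iff cis_mult complex_eq_iff algebra_simps sin_diff cos_diff sin_add cos_add diff_divide_distrib)
  then show ?thesis
    by (simp only:) (intro commuting_cmult commuting_diff commuting_cis)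
qed

lemma commuting_polynomial:
  assumes "real_polynomial_function p" "commuting T (\<lambda>x. of_real (f x))"
  shows "commuting T (\<lambda>x. of_real (p (f x)))"
  using assms(1)
proof (induction rule: real_polynomial_function.induct)
  case (linear p)
  then have "p y = y * p 1" for y
    using linear_cmul[OF bounded_linear.linear, of p y 1] by simp
  then have "(\<lambda>x. complex_of_real (p (f x))) = (\<lambda>x. of_real (p 1) * of_real (f x))"
    by (metis of_real_mult mult.commute)
  then show ?case by (simp only:) (intro commuting_cmult assms)
qed (auto intro: commuting_const commuting_add commuting_mult)

text \<open>Polynomials in a commuting function commute, and by Weierstrass they approximate
  \<open>g\<close> uniformly on the range of \<open>f\<close>.\<close>

lemma commuting_continuous:
  assumes g: "continuous_on {-1..1::real} g" and f: "commuting T (\<lambda>x. of_real (f x))"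
    and le: "\<And>x. \<bar>f x\<bar> \<le> 1"
  shows "commuting T (\<lambda>x. of_real (g (f x)))"
proof -
  have "\<exists>p. real_polynomial_function p \<and> (\<forall>y\<in>{-1..1}. \<bar>g y - p y\<bar> < inverse (real (Suc n)))" for n
    by (rule Stone_Weierstrass_real_polynomial_function[OF compact_Icc g, of "inverse (real (Suc n))"]) auto
  then obtain p where p: "\<And>n. real_polynomial_function (p n)"
    "\<And>n y. y \<in> {-1..1} \<Longrightarrow> \<bar>g y - p n y\<bar> < inverse (real (Suc n))" by metis
  have fi: "f x \<in> {-1..1}" for x using le[of x] by (auto simp: abs_le_iff)
  have "bounded (g ` {-1..1})" by (intro compact_imp_bounded compact_continuous_image g) auto
  then obtain B where B: "\<And>y. y \<in> {-1..1} \<Longrightarrow> \<bar>g y\<bar> \<le> B" unfolding bounded_iff by (metis imageI real_norm_def)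
  show ?thesis
  proof (rule commuting_lim[where B = "B + 1" and f = "\<lambda>n x. of_real (p n (f x))"])
    show "commuting T (\<lambda>x. of_real (p n (f x)))" for n by (rule commuting_polynomial[OF p(1) f])
    show "cmod (of_real (p n (f x))) \<le> B + 1" for n x
    proof -
      have "inverse (real (Suc n)) \<le> 1" by (simp add: field_simps)
      then show ?thesis using p(2)[OF fi[of x], of n] B[OF fi[of x]] by (simp add: abs_le_iff) linarith
    qed
    show "(\<lambda>n. complex_of_real (p n (f x))) \<longlonglongrightarrow> of_real (g (f x))" for x
    proof (intro tendsto_of_real LIM_zero_cancel[OF Lim_null_comparison[OF _ LIMSEQ_inverse_real_of_nat]])
      show "\<forall>\<^sub>F n in sequentially. norm (p n (f x) - g (f x)) \<le> inverse (real (Suc n))"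
        using p(2)[OF fi[of x]] by (intro always_eventually allI) (simp only: real_norm_def abs_minus_commute less_imp_le)
    qed
  qed
qed

text \<open>The ramps \<open>min 1 (max 0 (k * z))\<close> converge to the indicator of
  \<open>z > 0\<close>; composed with a sine they are continuous functions of a commuting
  function.\<close>

lemma commuting_sin_pos: "commuting T (\<lambda>x. of_real (indicator {x. sin (s * (x - y)) > 0} x))"
proof (rule commuting_lim[where B = 1])
  let ?g = "\<lambda>k z. min 1 (max 0 (real k * z))"
  show "commuting T (\<lambda>x. of_real (?g k (sin (s * (x - y)))))" for k
    by (rule commuting_continuous[of "?g k"]) (auto intro!: continuous_intros commuting_sin)
  show "cmod (of_real (?g k (sin (s * (x - y))))) \<le> 1" for k x by simp
  show "(\<lambda>k. complex_of_real (?g k (sin (s * (x - y))))) \<longlonglongrightarrow> of_real (indicator {x. sin (s * (x - y)) > 0} x)" for x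
  proof (cases "sin (s * (x - y)) > 0")
    case True
    then obtain k0 where k0: "real k0 * sin (s * (x - y)) \<ge> 1"
      using ex_less_of_nat_mult[of "sin (s * (x - y))" 1] by (auto intro: less_imp_le)
    have "?g k (sin (s * (x - y))) = 1" if "k \<ge> k0" for k
    proof -
      have "real k0 * sin (s * (x - y)) \<le> real k * sin (s * (x - y))"
        using True that by (intro mult_right_mono) auto
      then show ?thesis using k0 by simp
    qed
    then have "\<forall>\<^sub>F k in sequentially. complex_of_real (?g k (sin (s * (x - y)))) = of_real (indicator {x. sin (s * (x - y)) > 0} x)"
      using True by (intro eventually_mono[OF eventually_ge_at_top[of k0]]) auto
    then show ?thesis by (rule tendsto_eventually)
  next
    case False
    then have "real k * sin (s * (x - y)) \<le> 0" for k
      by (simp add: mult_nonneg_nonpos)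
    then have "?g k (sin (s * (x - y))) = 0" for k
      by (simp add: max_absorb1)
    then show ?thesis using False by simp
  qed
qed

text \<open>The period is stretched to infinity. For fixed \<open>x\<close> the argument of the sine
  eventually lies between \<open>- pi\<close> and \<open>pi\<close>, where the sine has the sign of
  \<open>x - y\<close>.\<close>

lemma commuting_greaterThan: "commuting T (\<lambda>x. of_real (indicator {y<..} x))"
proof (rule commuting_lim[where B = 1, OF commuting_sin_pos])
  let ?s = "\<lambda>n. inverse (real (Suc n))"
  show "cmod (of_real (indicator {x. sin (?s n * (x - y)) > 0} x)) \<le> 1" for n x
    by (auto simp: indicator_def)
  show "(\<lambda>n. complex_of_real (indicator {x. sin (?s n * (x - y)) > 0} x)) \<longlonglongrightarrow> of_real (indicator {y<..} x)" for x
  proof -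
    have "(\<lambda>n. ?s n * \<bar>x - y\<bar>) \<longlonglongrightarrow> 0 * \<bar>x - y\<bar>"
      by (intro tendsto_intros LIMSEQ_inverse_real_of_nat)
    then have "\<forall>\<^sub>F n in sequentially. ?s n * \<bar>x - y\<bar> < pi"
      by (intro order_tendstoD(2)[of _ "0 * \<bar>x - y\<bar>"]) auto
    then have "\<forall>\<^sub>F n in sequentially. complex_of_real (indicator {x. sin (?s n * (x - y)) > 0} x) = of_real (indicator {y<..} x)"
    proof eventually_elim
      fix n assume n: "?s n * \<bar>x - y\<bar> < pi"
      have s: "?s n > 0" by simp
      show "complex_of_real (indicator {x. sin (?s n * (x - y)) > 0} x) = of_real (indicator {y<..} x)"
      proof (cases "x > y")
        case True
        then have "sin (?s n * (x - y)) > 0" using n s by (intro sin_gt_zero) (auto simp del: of_nat_Suc)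
        then show ?thesis using True by (simp del: of_nat_Suc)
      next
        case False
        have "sin (?s n * (y - x)) \<ge> 0" using n s False by (intro sin_ge_zero) (auto simp del: of_nat_Suc)
        moreover have "sin (?s n * (x - y)) = - sin (?s n * (y - x))"
          by (simp only: sin_minus[symmetric] mult_minus_right[symmetric] minus_diff_eq)
        ultimately show ?thesis using False by (simp del: of_nat_Suc)
      qed
    qed
    then show ?thesis by (rule tendsto_eventually)
  qed
qed

text \<open>The half-lines are stable under intersection and generate the Borel sets, while the sets
  with commuting indicator are closed under complements and countable disjoint unions.\<close>

lemma commuting_indicator:
  assumes "A \<in> sets borel"
  shows "commuting T (\<lambda>x. of_real (indicator A x))"
proof -
  have A: "A \<in> sigma_sets UNIV (range greaterThan)"
    using assms by (simp add: borel_Ioi)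
  show ?thesis
  proof (induction rule: sigma_sets_induct_disjoint[OF _ _ A])
    show "Int_stable (range (greaterThan :: real \<Rightarrow> real set))"
      unfolding Int_stable_def
    proof safe
      fix a b :: real
      show "{a<..} \<inter> {b<..} \<in> range greaterThan"
        by (rule image_eqI[of _ _ "max a b"]) auto
    qed
  next
    case (3 A)
    show ?case using commuting_greaterThan 3 by auto
  next
    case 4
    show ?case using commuting_const[of 0] by simp
  next
    case (5 A)
    have "(\<lambda>x. complex_of_real (indicator (UNIV - A) x)) = (\<lambda>x. 1 - of_real (indicator A x))"
      by (auto simp: indicator_def fun_eq_iff)
    then show ?case using commuting_diff[OF commuting_const[of 1] 5(2)] by simp
  next
    case (6 A)
    show ?case
    proof (rule commuting_lim[where B = 1])
      show "commuting T (\<lambda>x. \<Sum>i<n. of_real (indicator (A i) x))" for n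
        by (intro commuting_sum 6)
      have eq: "(\<Sum>i<n. complex_of_real (indicator (A i) x)) = of_real (indicator (\<Union>i<n. A i) x)" for n x
        using 6(1) by (subst indicator_UN_disjoint) (auto simp: disjoint_family_on_def)
      show "cmod (\<Sum>i<n. of_real (indicator (A i) x)) \<le> 1" for n x
        unfolding eq by (auto simp: indicator_def)
      show "(\<lambda>n. \<Sum>i<n. complex_of_real (indicator (A i) x)) \<longlonglongrightarrow> of_real (indicator (\<Union>i. A i) x)" for x
        unfolding eq by (intro tendsto_of_real LIMSEQ_indicator_UN)
    qed
  qed auto
qed

text \<open>Rounding \<open>f\<close> down to multiples of \<open>1 / (n + 1)\<close> gives uniform
  approximation. As \<open>f\<close> is bounded, only finitely many values occur, so each
  approximant is a finite combination of indicators.\<close>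

lemma commuting_real:
  assumes f [measurable]: "f \<in> borel_measurable borel" and B: "\<And>x. \<bar>f x\<bar> \<le> B"
  shows "commuting T (\<lambda>x. of_real (f x :: real))"
proof (rule commuting_lim[where B = "B + 1"])
  let ?s = "\<lambda>n x. real_of_int \<lfloor>real (Suc n) * f x\<rfloor> / real (Suc n)"
  have err: "\<bar>?s n x - f x\<bar> \<le> inverse (real (Suc n))" for n x
  proof -
    have "\<bar>real_of_int \<lfloor>real (Suc n) * f x\<rfloor> - real (Suc n) * f x\<bar> \<le> 1" by linarith
    then have "\<bar>(real_of_int \<lfloor>real (Suc n) * f x\<rfloor> - real (Suc n) * f x) / real (Suc n)\<bar> \<le> 1 / real (Suc n)"
      by (simp only: abs_divide abs_of_nat divide_right_mono of_nat_0_le_iff)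
    then show ?thesis by (simp add: diff_divide_distrib inverse_eq_divide del: of_nat_Suc)
  qed
  show "commuting T (\<lambda>x. of_real (?s n x))" for n
  proof -
    define K where "K = \<lfloor>real (Suc n) * B\<rfloor> + 1"
    have fin: "\<lfloor>real (Suc n) * f x\<rfloor> \<in> {-K..K}" for x
    proof -
      have "\<bar>real (Suc n) * f x\<bar> \<le> real (Suc n) * B"
        unfolding abs_mult using B[of x] by (auto intro!: mult_left_mono)
      then have "real (Suc n) * f x \<le> real (Suc n) * B" "- (real (Suc n) * B) \<le> real (Suc n) * f x"
        by (simp_all only: abs_le_iff minus_le_iff)
      then have "\<lfloor>real (Suc n) * f x\<rfloor> \<le> \<lfloor>real (Suc n) * B\<rfloor>" "- \<lfloor>real (Suc n) * B\<rfloor> - 1 \<le> \<lfloor>real (Suc n) * f x\<rfloor>"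
        by linarith+
      then show ?thesis unfolding K_def by simp
    qed
    have "(\<lambda>x. complex_of_real (?s n x)) = (\<lambda>x. \<Sum>j\<in>{-K..K}.
        of_real (real_of_int j / real (Suc n)) * of_real (indicator {x. \<lfloor>real (Suc n) * f x\<rfloor> = j} x))"
    proof
      fix x
      have "(\<Sum>j\<in>{-K..K}. complex_of_real (real_of_int j / real (Suc n)) * of_real (indicator {x. \<lfloor>real (Suc n) * f x\<rfloor> = j} x)) =
         (\<Sum>j\<in>{-K..K}. if \<lfloor>real (Suc n) * f x\<rfloor> = j then of_real (real_of_int j / real (Suc n)) else 0)"
        by (intro sum.cong) (auto simp: indicator_def)
      also have "\<dots> = of_real (?s n x)" using fin[of x] by (subst sum.delta') auto
      finally show "complex_of_real (?s n x) = (\<Sum>j\<in>{-K..K}.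
        of_real (real_of_int j / real (Suc n)) * of_real (indicator {x. \<lfloor>real (Suc n) * f x\<rfloor> = j} x))" by simp
    qed
    moreover have "{x. \<lfloor>real (Suc n) * f x\<rfloor> = j} \<in> sets borel" for j by measurable
    ultimately show ?thesis
      by (simp only:) (intro commuting_sum commuting_cmult commuting_indicator)
  qed
  show "cmod (of_real (?s n x)) \<le> B + 1" for n x
  proof -
    have "inverse (real (Suc n)) \<le> 1" by (simp add: field_simps)
    then have "\<bar>?s n x - f x\<bar> \<le> 1" using err[of n x] by linarith
    then have "\<bar>?s n x\<bar> \<le> B + 1" using B[of x] abs_triangle_ineq2[of "?s n x" "f x"] by linarith
    then show ?thesis by (simp only: norm_of_real)
  qed
  show "(\<lambda>n. complex_of_real (?s n x)) \<longlonglongrightarrow> of_real (f x)" for x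
    by (intro tendsto_of_real LIM_zero_cancel[OF Lim_null_comparison[OF _ LIMSEQ_inverse_real_of_nat]]
        always_eventually allI) (use err[of _ x] in \<open>simp only: real_norm_def\<close>)
qed

end

section \<open>Square roots determined by positivity\<close>

lemma FT_zero: "FT (\<lambda>x. 0) = 0"
proof -
  have "L12 (\<lambda>x. 0)" by (rule L12_bounded_support[of _ 0 0]) auto
  from FT_diff[OF this this] show ?thesis by simp
qed

lemma cinner_zero_left: "cinner 0 w = 0"
  using cinner_diff_left[of w w w] by simp

text \<open>
  On the frequencies in a set \<open>S\<close> where \<open>\<omega> \<ge> \<delta>\<close> the operator \<open>N\<close> is a non-negative square root
  of the multiplier \<open>\<omega>\<^sup>2\<close>.  With \<open>g = N a - \<omega> a\<close> one has \<open>(N + \<omega>) g = 0\<close>, so \<open>g\<close> vanishes because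
  \<open>N + \<omega> \<ge> \<delta>\<close>.  As \<open>g\<close> is not known to be a transform of a function in \<open>L\<^sup>1\<close>, this is carried out
  along approximants \<open>b\<^sub>n\<close>.
\<close>

lemma positive_square_root_unique:
  assumes N: "bounded_operator N" and comm: "\<And>f B. f \<in> borel_measurable borel \<Longrightarrow> (\<And>x. \<bar>f x\<bar> \<le> B) \<Longrightarrow> commuting N (\<lambda>x. of_real (f x))"
    and \<omega> [measurable]: "\<omega> \<in> borel_measurable borel" and \<omega>B: "\<And>x. \<bar>\<omega> x\<bar> \<le> B"
    and S [measurable]: "S \<in> sets borel" and \<delta>: "\<delta> > 0" "\<And>x. x \<in> S \<Longrightarrow> \<omega> x \<ge> \<delta>"
    and pos: "\<And>b. L12 b \<Longrightarrow> (\<And>x. x \<notin> S \<Longrightarrow> b x = 0) \<Longrightarrow> 0 \<le> Re (cinner (N (FT b)) (FT b))"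
    and sq: "\<And>a. L12 a \<Longrightarrow> N (N (FT a)) = FT (\<lambda>x. of_real (\<omega> x) * (of_real (\<omega> x) * a x))"
    and a: "L12 a" "\<And>x. x \<notin> S \<Longrightarrow> a x = 0"
  shows "N (FT a) = FT (\<lambda>x. of_real (\<omega> x) * a x)"
proof -
  have cw: "commuting N (\<lambda>x. of_real (\<omega> x))" by (rule comm[OF \<omega> \<omega>B])
  define W where "W a = (\<lambda>x. of_real (\<omega> x) * a x)" for a :: "real \<Rightarrow> complex"
  have LW: "L12 (W a)" if "L12 a" for a
    using commuting_L12(1)[OF cw that] by (simp add: W_def)
  have swap: "cinner (N (FT (W a))) (FT b) = cinner (N (FT a)) (FT (W b))" if "L12 a" "L12 b" for a b
    using commutingD[OF cw that] by (simp add: W_def)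
  have swap': "cinner (FT (W a)) (FT b) = cinner (FT a) (FT (W b))" if "L12 a" "L12 b" for a b
    using that LW by (simp add: cinner_FT W_def mult_ac)
  define g where "g = N (FT a) - FT (W a)"
  \<comment> \<open>\<open>y\<close> plays the part of the multiplier \<omega> applied to
    \<open>g\<close>. It is written through \<open>a\<close>, because \<omega> acts as a
    multiplication only on transforms.\<close>
  define y where "y = N (FT (W a)) - FT (W (W a))"
  have gy: "N g + y = 0"
    using sq[OF a(1)] by (simp add: g_def y_def bounded_operatorD[OF N] W_def)
  obtain b' where b': "\<And>n. L12 (b' n)" "(\<lambda>n. FT (b' n)) \<longlonglongrightarrow> g" by (rule FT_dense_seq[of g]) blast
  define I where "I x = (indicator S x :: real)" for x
  have cI: "commuting N (\<lambda>x. of_real (1 - I x))"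
    by (rule comm[where B = 1]) (auto simp: I_def indicator_def)
  define r where "r n x = of_real (1 - I x) * b' n x" for n x
  define b where "b n x = of_real (I x) * b' n x" for n x
  have Lb: "L12 (b n)" for n
    unfolding b_def by (rule L12_mult_bounded[OF b'(1), where B = 1]) (auto simp: I_def indicator_def)
  have Lr: "L12 (r n)" for n unfolding r_def by (rule commuting_L12(1)[OF cI b'(1)])
  have bz: "b n x = 0" if "x \<notin> S" for n x using that by (simp add: b_def I_def)
  have az: "(\<lambda>x. of_real (1 - I x) * a x) = (\<lambda>x. 0)"
    using a(2) by (auto simp: I_def indicator_def fun_eq_iff)
  \<comment> \<open>\<open>g\<close> has no frequencies outside \<open>S\<close>:
    \<open>N (FT a)\<close> is orthogonal to \<open>FT (r n)\<close> because \<open>N\<close>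
    commutes with the indicator of the complement, and \<open>FT (W a)\<close> because the supports
    are disjoint. So cutting \<open>b' n\<close> down to \<open>S\<close> changes its transform by
    no more than the error of the approximation to \<open>g\<close>.\<close>
  have rn: "norm (FT (r n)) \<le> norm (FT (b' n) - g)" for n
  proof -
    have "cinner (N (FT a)) (FT (r n)) = 0"
      using commutingD[OF cI a(1) b'(1), of n] unfolding az r_def
      by (simp add: FT_zero bounded_operatorD[OF N] cinner_zero_left)
    moreover have "cinner (FT (W a)) (FT (r n)) = 0"
    proof -
      have "(\<lambda>x. W a x * cnj (r n x)) = (\<lambda>x. 0)"
      proof
        fix x show "W a x * cnj (r n x) = 0"
          using a(2)[of x] by (cases "x \<in> S") (simp_all add: W_def r_def I_def)
      qed
      then show ?thesis by (simp add: cinner_FT[OF LW[OF a(1)] Lr])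
    qed
    ultimately have gr: "cinner g (FT (r n)) = 0" by (simp add: g_def cinner_diff_left)
    have "cinner (FT (r n)) (FT (r n)) = cinner (FT (b' n)) (FT (r n))"
      by (simp add: cinner_FT Lr b'(1)) (intro Bochner_Integration.integral_cong, auto simp: r_def I_def indicator_def)
    also have "\<dots> = cinner (FT (b' n) - g) (FT (r n))" by (simp add: cinner_diff_left gr)
    finally have "(norm (FT (r n)))\<^sup>2 = cmod (cinner (FT (b' n) - g) (FT (r n)))"
      unfolding cinner_self by (metis norm_of_real abs_power2)
    also have "\<dots> \<le> norm (FT (b' n) - g) * norm (FT (r n))" by (rule cinner_Cauchy_Schwarz)
    finally show ?thesis
      by (cases "norm (FT (r n)) = 0") (auto simp: power2_eq_square)
  qed
  have "(\<lambda>n. FT (r n)) \<longlonglongrightarrow> 0"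
    by (rule Lim_null_comparison[OF always_eventually[OF allI[OF rn]]])
       (rule tendsto_norm_zero[OF LIM_zero[OF b'(2)]])
  then have "(\<lambda>n. FT (b' n) - FT (r n)) \<longlonglongrightarrow> g - 0" by (intro tendsto_diff b')
  moreover have "FT (b' n) - FT (r n) = FT (b n)" for n
    unfolding FT_diff[OF b'(1) Lr, symmetric]
    by (intro arg_cong[where f = FT]) (auto simp: b_def r_def fun_eq_iff algebra_simps)
  ultimately have bg: "(\<lambda>n. FT (b n)) \<longlonglongrightarrow> g" by simp
  have wb: "norm (FT (W (b n))) \<le> B * norm (FT (b n))" for n
  proof -
    have B: "B \<ge> 0" using \<omega>B[of 0] abs_ge_zero order_trans by blast
    have "(norm (FT (W (b n))))\<^sup>2 = (LINT x|lborel. (cmod (W (b n) x))\<^sup>2)"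
      using norm_FT[OF LW[OF Lb]] norm_abs_l2[OF L12_square_integrable[OF LW[OF Lb]]] by simp
    also have "\<dots> \<le> (LINT x|lborel. B\<^sup>2 * (cmod (b n x))\<^sup>2)"
    proof (rule integral_mono)
      have "\<bar>\<omega> x\<bar>\<^sup>2 \<le> B\<^sup>2" for x using \<omega>B[of x] by (intro power_mono) auto
      then show "(cmod (W (b n) x))\<^sup>2 \<le> B\<^sup>2 * (cmod (b n x))\<^sup>2" for x
        by (simp add: W_def norm_mult power_mult_distrib mult_right_mono)
    qed (use LW[OF Lb] Lb in \<open>auto simp: L12_def square_integrable_def\<close>)
    also have "\<dots> = (B * norm (FT (b n)))\<^sup>2"
      using norm_FT[OF Lb, of n] norm_abs_l2[OF L12_square_integrable[OF Lb], of n] by (simp add: power_mult_distrib)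
    finally show ?thesis by (rule power2_le_imp_le) (use B in auto)
  qed
  have lim1: "(\<lambda>n. cinner (N (FT (b n))) (FT (b n))) \<longlonglongrightarrow> cinner (N g) g"
    by (intro tendsto_cinner bounded_operator_tendsto[OF N] bg)
  \<comment> \<open>The pairing of \<open>g\<close> with \<open>FT (W (b n))\<close> equals that of
    \<open>y\<close> with \<open>FT (b n)\<close>, by moving \<omega> across both terms of
    \<open>g\<close>. The remaining summand contains \<open>FT (b n) - g\<close> and tends to 0,
    since \<open>W\<close> is bounded.\<close>
  have eq2: "cinner (FT (W (b n))) (FT (b n)) = cinner y (FT (b n)) + cinner (FT (b n) - g) (FT (W (b n)))" for n
    using swap[OF a(1) Lb] swap'[OF LW[OF a(1)] Lb] swap'[OF Lb Lb]
    by (simp add: g_def y_def cinner_diff_left)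
  have "(\<lambda>n. norm (FT (b n) - g) * (B * norm (FT (b n)))) \<longlonglongrightarrow> 0 * (B * norm g)"
    by (intro tendsto_intros tendsto_norm_zero LIM_zero bg)
  then have z: "(\<lambda>n. norm (FT (b n) - g) * (B * norm (FT (b n)))) \<longlonglongrightarrow> 0" by simp
  have "norm (cinner (FT (b n) - g) (FT (W (b n)))) \<le> norm (FT (b n) - g) * (B * norm (FT (b n)))" for n
    by (rule order_trans[OF cinner_Cauchy_Schwarz]) (intro mult_left_mono wb norm_ge_zero)
  then have "(\<lambda>n. cinner (FT (b n) - g) (FT (W (b n)))) \<longlonglongrightarrow> 0"
    by (intro Lim_null_comparison[OF _ z] always_eventually allI)
  then have lim2: "(\<lambda>n. cinner (FT (W (b n))) (FT (b n))) \<longlonglongrightarrow> cinner y g + 0"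
    unfolding eq2 by (intro tendsto_add tendsto_cinner bg tendsto_const)
  \<comment> \<open>Coercivity of \<open>N + \<omega>\<close>: since \<open>b n\<close> vanishes off
    \<open>S\<close>, the multiplier contributes at least \<delta> times the squared norm and
    \<open>N\<close> a non-negative amount. In the limit the right-hand side becomes the pairing of
    \<open>N g + y = 0\<close> with \<open>g\<close>.\<close>
  have "\<delta> * (norm (FT (b n)))\<^sup>2 \<le> Re (cinner (N (FT (b n))) (FT (b n)) + cinner (FT (W (b n))) (FT (b n)))" for n
  proof -
    have e: "W (b n) x * cnj (b n x) = of_real (\<omega> x * (cmod (b n x))\<^sup>2)" for x
      by (simp add: W_def complex_norm_square mult.assoc del: of_real_power)
    have i: "integrable lborel (\<lambda>x. W (b n) x * cnj (b n x))"
      by (intro square_integrable_mult_cnj L12_square_integrable LW Lb)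
    have "\<delta> * (norm (FT (b n)))\<^sup>2 = (LINT x|lborel. \<delta> * (cmod (b n x))\<^sup>2)"
      using norm_FT[OF Lb, of n] norm_abs_l2[OF L12_square_integrable[OF Lb], of n] by simp
    also have "\<dots> \<le> (LINT x|lborel. \<omega> x * (cmod (b n x))\<^sup>2)"
    proof (rule integral_mono)
      show "integrable lborel (\<lambda>x. \<omega> x * (cmod (b n x))\<^sup>2)"
        using integrable_Re[OF i] unfolding e by simp
      show "\<delta> * (cmod (b n x))\<^sup>2 \<le> \<omega> x * (cmod (b n x))\<^sup>2" for x
        using \<delta>(2)[of x] bz[of x n] by (cases "x \<in> S") (auto intro: mult_right_mono)
    qed (use Lb in \<open>auto simp: L12_def square_integrable_def\<close>)
    also have "\<dots> = Re (cinner (FT (W (b n))) (FT (b n)))"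
      by (simp only: cinner_FT[OF LW[OF Lb] Lb] e integral_complex_of_real Re_complex_of_real)
    finally show ?thesis using pos[OF Lb bz, of n] by simp
  qed
  moreover have "(\<lambda>n. Re (cinner (N (FT (b n))) (FT (b n)) + cinner (FT (W (b n))) (FT (b n)))) \<longlonglongrightarrow> Re (cinner (N g) g + (cinner y g + 0))"
    by (intro tendsto_Re tendsto_add lim1 lim2)
  moreover have "(\<lambda>n. \<delta> * (norm (FT (b n)))\<^sup>2) \<longlonglongrightarrow> \<delta> * (norm g)\<^sup>2"
    by (intro tendsto_intros bg)
  ultimately have "\<delta> * (norm g)\<^sup>2 \<le> Re (cinner (N g) g + (cinner y g + 0))"
    using LIMSEQ_le by blast
  also have "\<dots> = Re (cinner (N g + y) g)" by (simp add: cinner_add_left)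
  also have "\<dots> = 0" unfolding gy Re_cinner by simp
  finally have "g = 0" using \<delta>(1) by (simp add: mult_le_0_iff)
  then show ?thesis by (simp add: g_def W_def)
qed

text \<open>On frequencies of one sign \<open>s\<close> with \<omega> \<ge> \<delta>, the function
  \<open>sgn\<close> is constant and \<open>1 / \<omega>\<close> is bounded, so the operator
  \<open>- \<i> * s * M\<close> can be recognised as the positive root of \<open>\<omega>^2\<close>.
  The general \<open>a\<close> is reached by letting \<delta> tend to 0. The factor
  \<open>\<omega>^2\<close> in \<open>pos\<close> reflects that positivity of \<open>HD\<close> is
  available at vectors in the range of \<open>M\<close>.\<close>

lemma symbol_identification:
  assumes M: "bounded_operator M" and ti: "translation_invariant M"
    and \<omega> [measurable]: "\<omega> \<in> borel_measurable borel" and \<omega>B: "\<And>x. \<bar>\<omega> x\<bar> \<le> B"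
    and \<omega>pos: "\<And>x. x \<noteq> 0 \<Longrightarrow> \<omega> x > 0"
    and sq: "\<And>a. L12 a \<Longrightarrow> M (M (FT a)) = - FT (\<lambda>x. of_real (\<omega> x) * (of_real (\<omega> x) * a x))"
    and pos: "\<And>a. L12 a \<Longrightarrow>
      \<i> * cinner (FT (\<lambda>x. of_real (sgn x) * (of_real (\<omega> x) * (of_real (\<omega> x) * a x)))) (M (FT a)) \<in> \<real>\<^sub>\<ge>\<^sub>0"
    and a: "L12 a"
  shows "M (FT a) = FT (\<lambda>x. \<i> * of_real (sgn x * \<omega> x) * a x)"
proof -
  note comm = commuting_real[OF M ti]
  have \<omega>B': "cmod (of_real (\<omega> x)) \<le> B" for x using \<omega>B by simp
  have one: "M (FT a) = FT (\<lambda>x. \<i> * of_real (sgn x * \<omega> x) * a x)"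
    if s: "s = 1 \<or> s = -1" and \<delta>: "\<delta> > 0" and a: "L12 a" and az: "\<And>x. x \<notin> {x. s * x > 0 \<and> \<omega> x \<ge> \<delta>} \<Longrightarrow> a x = 0"
    for s \<delta> :: real and a
  proof -
    let ?S = "{x. s * x > 0 \<and> \<omega> x \<ge> \<delta>}"
    let ?N = "\<lambda>w. scaleC (- \<i> * of_real s) (M w)"
    have ss: "s * s = 1" using s by auto
    have ss': "complex_of_real s * of_real s = 1" using ss by (simp flip: of_real_mult)
    have Sg: "sgn x = s" if "x \<in> ?S" for x using that s by auto
    have [measurable]: "?S \<in> sets borel" by measurable
    have N: "bounded_operator ?N"
      using M unfolding bounded_operator_def
      by (auto intro: bounded_linear_compose[OF bounded_linear_scaleC] simp: scaleC_scaleC mult_ac)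
    have Nc: "commuting ?N (\<lambda>x. of_real (f x))" if "f \<in> borel_measurable borel" "\<And>x. \<bar>f x\<bar> \<le> B" for f :: "real \<Rightarrow> real" and B
      using comm[OF that] by (simp add: commuting_def cinner_scaleC_left)
    have Npos: "0 \<le> Re (cinner (?N (FT b)) (FT b))" if b: "L12 b" and bz: "\<And>x. x \<notin> ?S \<Longrightarrow> b x = 0" for b
    proof -
      \<comment> \<open>The reciprocal of \<omega>, cut off to \<open>S\<close>. Testing
        \<open>pos\<close> at \<open>f b\<close> removes one factor \<omega>; moving
        \<open>f\<close> across \<open>M\<close> to the second argument removes the other and leaves
        the quadratic form of \<open>M\<close> at \<open>FT b\<close>.\<close>
      define f where "f x = (if x \<in> ?S then 1 / \<omega> x else 0)" for x
      have [measurable]: "f \<in> borel_measurable borel" unfolding f_def by measurable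
      have fB: "\<bar>f x\<bar> \<le> 1 / \<delta>" for x
        using \<delta> by (auto simp: f_def intro!: divide_left_mono)
      have cf: "commuting M (\<lambda>x. of_real (f x))" by (rule comm[OF _ fB]) measurable
      let ?fb = "\<lambda>x. of_real (f x) * b x"
      let ?w = "\<lambda>x. of_real (sgn x) * (of_real (\<omega> x) * (of_real (\<omega> x) * ?fb x))"
      have Lfb: "L12 ?fb" by (rule commuting_L12(1)[OF cf b])
      have w: "?w = (\<lambda>x. of_real s * (of_real (\<omega> x) * b x))"
      proof
        fix x show "?w x = of_real s * (of_real (\<omega> x) * b x)"
          using bz[of x] Sg[of x] \<delta> by (cases "x \<in> ?S") (auto simp: f_def)
      qed
      have Lw: "L12 (\<lambda>x. of_real s * (of_real (\<omega> x) * b x))"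
        by (intro L12_cmult L12_mult_bounded[OF b _ \<omega>B']) measurable
      have "cinner (M (FT ?fb)) (FT (\<lambda>x. of_real s * (of_real (\<omega> x) * b x))) =
         cinner (M (FT b)) (FT (\<lambda>x. cnj (of_real (f x)) * (of_real s * (of_real (\<omega> x) * b x))))"
        by (rule commutingD[OF cf b Lw])
      also have "(\<lambda>x. cnj (of_real (f x)) * (of_real s * (of_real (\<omega> x) * b x))) = (\<lambda>x. of_real s * b x)"
      proof
        fix x show "cnj (of_real (f x)) * (of_real s * (of_real (\<omega> x) * b x)) = of_real s * b x"
          using bz[of x] \<delta> by (cases "x \<in> ?S") (auto simp: f_def)
      qed
      also have "cinner (M (FT b)) (FT (\<lambda>x. of_real s * b x)) = of_real s * cinner (M (FT b)) (FT b)"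
        using b by (simp add: FT_cmult cinner_scaleC_right)
      finally have e: "cinner (M (FT ?fb)) (FT ?w) = of_real s * cinner (M (FT b)) (FT b)" unfolding w .
      have "0 \<le> Re (\<i> * cinner (FT ?w) (M (FT ?fb)))"
        using pos[OF Lfb] by (simp add: complex_nonneg_Reals_iff)
      also have "\<i> * cinner (FT ?w) (M (FT ?fb)) = cnj (- \<i> * cinner (M (FT ?fb)) (FT ?w))"
        using cinner_commute[of "FT ?w" "M (FT ?fb)"] by simp
      also have "- \<i> * cinner (M (FT ?fb)) (FT ?w) = cinner (?N (FT b)) (FT b)"
        unfolding e cinner_scaleC_left by simp
      finally show ?thesis by simp
    qed
    have Nsq: "?N (?N (FT a)) = FT (\<lambda>x. of_real (\<omega> x) * (of_real (\<omega> x) * a x))" if "L12 a" for a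
    proof -
      have "?N (?N (FT a)) = scaleC (- \<i> * of_real s * (- \<i> * of_real s)) (M (M (FT a)))"
        by (simp add: bounded_operatorD[OF M] scaleC_scaleC)
      \<comment> \<open>The factor \<open>- \<i>\<close> turns the square root of
        \<open>- \<omega>^2\<close> into one of \<open>\<omega>^2\<close>; the sign \<open>s\<close>
        disappears on squaring.\<close>
      also have "- \<i> * of_real s * (- \<i> * of_real s) = - (complex_of_real s * of_real s)" by (simp add: complex_eq_iff)
      also have "\<dots> = of_real (- 1)" by (simp add: ss')
      finally show ?thesis unfolding scaleC_of_real sq[OF that] by simp
    qed
    have "?N (FT a) = FT (\<lambda>x. of_real (\<omega> x) * a x)"
    proof (rule positive_square_root_unique[where N = ?N and S = ?S and \<delta> = \<delta> and B = B])
      show "bounded_operator ?N" by (fact N)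
      show "commuting ?N (\<lambda>x. of_real (f x))" if "f \<in> borel_measurable borel" "\<And>x. \<bar>f x\<bar> \<le> B"
        for f :: "real \<Rightarrow> real" and B using that by (rule Nc)
      show "0 \<le> Re (cinner (?N (FT b)) (FT b))" if "L12 b" "\<And>x. x \<notin> ?S \<Longrightarrow> b x = 0" for b
        using that by (rule Npos)
      show "?N (?N (FT a)) = FT (\<lambda>x. of_real (\<omega> x) * (of_real (\<omega> x) * a x))" if "L12 a" for a
        using that by (rule Nsq)
      show "a x = 0" if "x \<notin> ?S" for x using that by (rule az)
    qed (use \<omega> \<omega>B \<delta> a in auto)
    then have "scaleC (\<i> * of_real s) (?N (FT a)) = scaleC (\<i> * of_real s) (FT (\<lambda>x. of_real (\<omega> x) * a x))" by simp
    also have "\<dots> = FT (\<lambda>x. (\<i> * of_real s) * (of_real (\<omega> x) * a x))"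
      by (rule FT_cmult[symmetric], rule L12_mult_bounded[OF a _ \<omega>B']) measurable
    also have "scaleC (\<i> * of_real s) (?N (FT a)) = scaleC (complex_of_real s * of_real s) (M (FT a))"
      unfolding scaleC_scaleC by (rule arg_cong[where f = "\<lambda>z. scaleC z _"]) (simp add: complex_eq_iff)
    also have "\<dots> = M (FT a)" by (simp only: ss' scaleC_one)
    also have "(\<lambda>x. (\<i> * of_real s) * (of_real (\<omega> x) * a x)) = (\<lambda>x. \<i> * of_real (sgn x * \<omega> x) * a x)"
    proof
      fix x show "(\<i> * of_real s) * (of_real (\<omega> x) * a x) = \<i> * of_real (sgn x * \<omega> x) * a x"
        using az[of x] Sg[of x] by (cases "x \<in> ?S") auto
    qed
    finally show ?thesis .
  qed
  define d where "d n = inverse (real (Suc n))" for n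
  have d: "d n > 0" for n by (simp add: d_def)
  \<comment> \<open>The part of \<open>a\<close> on the half-line of sign \<open>s\<close> where
    \<omega> is at least \<open>d n\<close>. The two halves together exhaust \<open>a\<close>
    outside the point 0, because \<omega> is positive there.\<close>
  define ap where "ap s n x = (if s * x > 0 \<and> \<omega> x \<ge> d n then a x else 0)" for s n x
  have [measurable]: "a \<in> borel_measurable borel" using a by (rule L12_measurable)
  have Lap: "L12 (ap s n)" for s n
  proof -
    have "L12 (\<lambda>x. of_real (indicator {x. s * x > 0 \<and> \<omega> x \<ge> d n} x) * a x)"
      by (rule L12_mult_bounded[OF a, where B = 1]) (auto simp: indicator_def)
    also have "(\<lambda>x. of_real (indicator {x. s * x > 0 \<and> \<omega> x \<ge> d n} x) * a x) = ap s n"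
      by (auto simp: ap_def fun_eq_iff)
    finally show ?thesis .
  qed
  have \<theta>m: "(\<lambda>x. \<i> * of_real (sgn x * \<omega> x)) \<in> borel_measurable borel" by measurable
  have \<theta>B: "cmod (\<i> * of_real (sgn x * \<omega> x)) \<le> B" for x
    using \<omega>B[of x] order_trans[OF abs_ge_zero \<omega>B] by (auto simp: norm_mult sgn_if)
  let ?\<theta> = "\<lambda>a x. \<i> * of_real (sgn x * \<omega> x) * a x"
  have L\<theta>: "L12 (?\<theta> b)" if "L12 b" for b
    by (rule L12_mult_bounded[OF that \<theta>m \<theta>B])
  define an where "an n x = ap 1 n x + ap (-1) n x" for n x
  have Lan: "L12 (an n)" for n unfolding an_def by (intro L12_add Lap)
  have Man: "M (FT (an n)) = FT (?\<theta> (an n))" for n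
  proof -
    have "M (FT (an n)) = M (FT (ap 1 n)) + M (FT (ap (-1) n))"
      unfolding an_def using Lap by (simp add: FT_add bounded_operatorD[OF M])
    also have "\<dots> = FT (?\<theta> (ap 1 n)) + FT (?\<theta> (ap (-1) n))"
    proof -
      have "M (FT (ap s n)) = FT (?\<theta> (ap s n))" if "s = 1 \<or> s = -1" for s
        by (rule one[OF that d Lap]) (auto simp: ap_def)
      then show ?thesis by simp
    qed
    also have "\<dots> = FT (?\<theta> (an n))"
      unfolding an_def distrib_left by (rule FT_add[symmetric]) (rule L\<theta>[OF Lap])+
    finally show ?thesis .
  qed
  have an_eq: "an n x = (if x \<noteq> 0 \<and> \<omega> x \<ge> d n then a x else 0)" for n x
    by (auto simp: an_def ap_def)
  have lim: "(\<lambda>n. an n x) \<longlonglongrightarrow> a x" if "x \<noteq> 0" for x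
  proof -
    have "d \<longlonglongrightarrow> 0" unfolding d_def by (rule LIMSEQ_inverse_real_of_nat)
    then have "\<forall>\<^sub>F n in sequentially. d n < \<omega> x" using \<omega>pos[OF that] by (rule order_tendstoD(2))
    then have "\<forall>\<^sub>F n in sequentially. an n x = a x"
      by eventually_elim (use that in \<open>auto simp: an_eq\<close>)
    then show ?thesis by (rule tendsto_eventually)
  qed
  have AE0: "AE x in lborel. x \<noteq> (0::real)" by (rule AE_lborel_singleton)
  have l1: "(\<lambda>n. FT (an n)) \<longlonglongrightarrow> FT a"
    by (rule FT_tendsto[OF Lan a _ L12_square_integrable[OF a]])
       (use AE0 in eventually_elim, rule lim, assumption, simp add: an_eq)
  have l2: "(\<lambda>n. FT (?\<theta> (an n))) \<longlonglongrightarrow> FT (?\<theta> a)"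
  proof (rule FT_tendsto[OF L\<theta>[OF Lan] L\<theta>[OF a] _ L12_square_integrable[OF L\<theta>[OF a]]])
    show "AE x in lborel. (\<lambda>n. ?\<theta> (an n) x) \<longlonglongrightarrow> ?\<theta> a x"
      using AE0 by eventually_elim (intro tendsto_mult_left lim)
    show "cmod (?\<theta> (an n) x) \<le> cmod (?\<theta> a x)" for n x by (simp add: an_eq)
  qed
  have "(\<lambda>n. M (FT (an n))) \<longlonglongrightarrow> M (FT a)" by (intro bounded_operator_tendsto[OF M] l1)
  then show ?thesis using l2 unfolding Man by (rule LIMSEQ_unique)
qed

section \<open>Differentiable functions with growth conditions\<close>

definition polyb :: "(real \<Rightarrow> 'a::real_normed_vector) \<Rightarrow> bool" where
  "polyb f \<longleftrightarrow> (\<exists>C N. \<forall>x. norm (f x) \<le> C * (1 + \<bar>x\<bar>) ^ N)"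

definition rapid :: "(real \<Rightarrow> 'a::real_normed_vector) \<Rightarrow> bool" where
  "rapid f \<longleftrightarrow> (\<forall>N. \<exists>C. \<forall>x. (1 + \<bar>x\<bar>) ^ N * norm (f x) \<le> C)"

text \<open>Differentiability of order \<open>n\<close> with the growth condition \<open>P\<close>
  on the function and on each derivative up to order \<open>n\<close>, the last of them continuous.
  It is used with \<open>P = polyb\<close> for symbols and \<open>P = rapid\<close> for transforms
  of Schwartz data.\<close>

primrec Creg :: "((real \<Rightarrow> 'a::real_normed_vector) \<Rightarrow> bool) \<Rightarrow> nat \<Rightarrow> (real \<Rightarrow> 'a) \<Rightarrow> bool" where
  "Creg P 0 f = (continuous_on UNIV f \<and> P f)"
| "Creg P (Suc n) f = (P f \<and> (\<exists>f'. (\<forall>x. (f has_vector_derivative f' x) (at x)) \<and> Creg P n f'))"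

lemma polyb_bounded: "(\<And>x. norm (f x) \<le> C) \<Longrightarrow> polyb f"
  unfolding polyb_def by (rule exI[of _ C], rule exI[of _ 0]) simp

lemma polybE:
  assumes "polyb f"
  obtains C N where "C \<ge> 0" "\<And>x. norm (f x) \<le> C * (1 + \<bar>x\<bar>) ^ N"
proof -
  obtain C N where CN: "\<And>x. norm (f x) \<le> C * (1 + \<bar>x\<bar>) ^ N" using assms unfolding polyb_def by blast
  have "C \<ge> 0" using order_trans[OF norm_ge_zero CN[of 0]] by simp
  then show thesis using that CN by blast
qed

lemma polyb_add:
  assumes "polyb f" "polyb g" shows "polyb (\<lambda>x. f x + g x)"
proof -
  obtain C N where C: "C \<ge> 0" "\<And>x. norm (f x) \<le> C * (1 + \<bar>x\<bar>) ^ N" using assms(1) by (rule polybE) blast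
  obtain D M where D: "D \<ge> 0" "\<And>x. norm (g x) \<le> D * (1 + \<bar>x\<bar>) ^ M" using assms(2) by (rule polybE) blast
  have "norm (f x + g x) \<le> (C + D) * (1 + \<bar>x\<bar>) ^ (N + M)" for x
  proof -
    have "(1 + \<bar>x\<bar>) ^ N \<le> (1 + \<bar>x\<bar>) ^ (N + M)" "(1 + \<bar>x\<bar>) ^ M \<le> (1 + \<bar>x\<bar>) ^ (N + M)"
      by (intro power_increasing; simp)+
    then have "C * (1 + \<bar>x\<bar>) ^ N \<le> C * (1 + \<bar>x\<bar>) ^ (N + M)" "D * (1 + \<bar>x\<bar>) ^ M \<le> D * (1 + \<bar>x\<bar>) ^ (N + M)"
      using C D by (auto intro: mult_left_mono)
    then show ?thesis using C(2)[of x] D(2)[of x] norm_triangle_ineq[of "f x" "g x"]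
      unfolding distrib_right by linarith
  qed
  then show ?thesis unfolding polyb_def by blast
qed

lemma polyb_mult:
  fixes f g :: "real \<Rightarrow> 'a::real_normed_algebra"
  assumes "polyb f" "polyb g" shows "polyb (\<lambda>x. f x * g x)"
proof -
  obtain C N where C: "C \<ge> 0" "\<And>x. norm (f x) \<le> C * (1 + \<bar>x\<bar>) ^ N" using assms(1) by (rule polybE) blast
  obtain D M where D: "D \<ge> 0" "\<And>x. norm (g x) \<le> D * (1 + \<bar>x\<bar>) ^ M" using assms(2) by (rule polybE) blast
  have "norm (f x * g x) \<le> (C * D) * (1 + \<bar>x\<bar>) ^ (N + M)" for x
  proof -
    have "norm (f x * g x) \<le> norm (f x) * norm (g x)" by (rule norm_mult_ineq)
    also have "\<dots> \<le> (C * (1 + \<bar>x\<bar>) ^ N) * (D * (1 + \<bar>x\<bar>) ^ M)" using C D by (intro mult_mono) auto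
    finally show ?thesis by (simp add: power_add mult_ac)
  qed
  then show ?thesis unfolding polyb_def by blast
qed

lemma polyb_power: "polyb f \<Longrightarrow> polyb (\<lambda>x. f x ^ n)" for f :: "real \<Rightarrow> 'a::real_normed_algebra_1"
  by (induction n) (auto intro: polyb_bounded[of _ 1] polyb_mult)

lemma polyb_linear:
  assumes "polyb f" "bounded_linear L" shows "polyb (\<lambda>x. L (f x))"
proof -
  obtain C N where C: "C \<ge> 0" "\<And>x. norm (f x) \<le> C * (1 + \<bar>x\<bar>) ^ N" using assms(1) by (rule polybE) blast
  obtain K where K: "K \<ge> 0" "\<And>x. norm (L x) \<le> norm x * K" using bounded_linear.nonneg_bounded[OF assms(2)] by blast
  have "norm (L (f x)) \<le> (C * K) * (1 + \<bar>x\<bar>) ^ N" for x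
    using order_trans[OF K(2) mult_right_mono[OF C(2) K(1)], of x] by (simp add: mult_ac)
  then show ?thesis unfolding polyb_def by blast
qed

lemma polyb_le: "polyb g \<Longrightarrow> (\<And>x. norm (f x) \<le> norm (g x)) \<Longrightarrow> polyb f"
  unfolding polyb_def by (meson order_trans)

lemma polyb_ident: "polyb (\<lambda>x::real. x)"
  unfolding polyb_def by (rule exI[of _ 1], rule exI[of _ 1]) simp

lemma rapid_add:
  assumes "rapid f" "rapid g" shows "rapid (\<lambda>x. f x + g x)"
  unfolding rapid_def
proof
  fix N
  obtain C D where C: "\<And>x. (1 + \<bar>x\<bar>) ^ N * norm (f x) \<le> C" and D: "\<And>x. (1 + \<bar>x\<bar>) ^ N * norm (g x) \<le> D"
    using assms unfolding rapid_def by metis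
  have "(1 + \<bar>x\<bar>) ^ N * norm (f x + g x) \<le> C + D" for x
    using mult_left_mono[OF norm_triangle_ineq[of "f x" "g x"], of "(1 + \<bar>x\<bar>) ^ N"] C[of x] D[of x]
    by (simp add: distrib_left)
  then show "\<exists>C. \<forall>x. (1 + \<bar>x\<bar>) ^ N * norm (f x + g x) \<le> C" by blast
qed

lemma polyb_mult_rapid:
  fixes f g :: "real \<Rightarrow> 'a::real_normed_algebra"
  assumes "polyb f" "rapid g" shows "rapid (\<lambda>x. f x * g x)"
  unfolding rapid_def
proof
  fix M
  obtain C N where C: "C \<ge> 0" "\<And>x. norm (f x) \<le> C * (1 + \<bar>x\<bar>) ^ N" using assms(1) by (rule polybE) blast
  obtain D where D: "\<And>x. (1 + \<bar>x\<bar>) ^ (M + N) * norm (g x) \<le> D" using assms(2) unfolding rapid_def by metis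
  have "(1 + \<bar>x\<bar>) ^ M * norm (f x * g x) \<le> C * D" for x
  proof -
    have "(1 + \<bar>x\<bar>) ^ M * norm (f x * g x) \<le> (1 + \<bar>x\<bar>) ^ M * (norm (f x) * norm (g x))"
      by (intro mult_left_mono norm_mult_ineq) auto
    also have "\<dots> \<le> (1 + \<bar>x\<bar>) ^ M * ((C * (1 + \<bar>x\<bar>) ^ N) * norm (g x))"
      using C by (intro mult_left_mono mult_right_mono) auto
    also have "\<dots> = C * ((1 + \<bar>x\<bar>) ^ (M + N) * norm (g x))" by (simp add: power_add mult_ac)
    also have "\<dots> \<le> C * D" using C D by (intro mult_left_mono) auto
    finally show ?thesis .
  qed
  then show "\<exists>C. \<forall>x. (1 + \<bar>x\<bar>) ^ M * norm (f x * g x) \<le> C" by blast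
qed

lemma rapid_linear:
  assumes "rapid f" "bounded_linear L" shows "rapid (\<lambda>x. L (f x))"
  unfolding rapid_def
proof
  fix N
  obtain C where C: "\<And>x. (1 + \<bar>x\<bar>) ^ N * norm (f x) \<le> C" using assms(1) unfolding rapid_def by metis
  obtain K where K: "K \<ge> 0" "\<And>x. norm (L x) \<le> norm x * K" using bounded_linear.nonneg_bounded[OF assms(2)] by blast
  have "(1 + \<bar>x\<bar>) ^ N * norm (L (f x)) \<le> C * K" for x
  proof -
    have "(1 + \<bar>x\<bar>) ^ N * norm (L (f x)) \<le> (1 + \<bar>x\<bar>) ^ N * (norm (f x) * K)"
      by (intro mult_left_mono K) auto
    also have "\<dots> = ((1 + \<bar>x\<bar>) ^ N * norm (f x)) * K" by (simp only: mult.assoc)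
    also have "\<dots> \<le> C * K" by (rule mult_right_mono[OF C K(1)])
    finally show ?thesis .
  qed
  then show "\<exists>C. \<forall>x. (1 + \<bar>x\<bar>) ^ N * norm (L (f x)) \<le> C" by blast
qed

lemma rapid_reflect: "rapid f \<Longrightarrow> rapid (\<lambda>x. f (- x))"
  unfolding rapid_def by (metis abs_minus_cancel)

lemma rapid_bound_square:
  assumes "rapid f" obtains C where "\<And>x. norm (f x) \<le> C * inverse (1 + x\<^sup>2)"
proof -
  obtain C where C: "\<And>x. (1 + \<bar>x\<bar>) ^ 2 * norm (f x) \<le> C" using assms unfolding rapid_def by metis
  have "norm (f x) \<le> C * inverse (1 + x\<^sup>2)" for x
  proof -
    have p: "1 + x\<^sup>2 > 0" by (simp add: add_pos_nonneg)
    have "1 + x\<^sup>2 \<le> (1 + \<bar>x\<bar>)\<^sup>2" by (simp add: power2_sum)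
    then have "(1 + x\<^sup>2) * norm (f x) \<le> C" using C[of x] mult_right_mono[OF _ norm_ge_zero] order_trans by blast
    then show ?thesis using p by (simp add: field_simps)
  qed
  then show thesis using that by blast
qed

lemma integrable_inverse_square: "integrable lborel (\<lambda>x::real. inverse (1 + x\<^sup>2))"
  using integrable_inverse_1_plus_square by (simp add: set_integrable_def)

lemma rapid_integrable:
  fixes f :: "real \<Rightarrow> 'a::{second_countable_topology, banach}"
  assumes f: "rapid f" and m: "f \<in> borel_measurable borel"
  shows "integrable lborel f"
proof -
  obtain C where C: "\<And>x. norm (f x) \<le> C * inverse (1 + x\<^sup>2)" using rapid_bound_square[OF f] by blast
  show ?thesis
    by (rule Bochner_Integration.integrable_bound[of _ "\<lambda>x. C * inverse (1 + x\<^sup>2)"])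
       (use m order_trans[OF C abs_ge_self] in \<open>auto intro: integrable_inverse_square\<close>)
qed

lemma rapid_L12:
  assumes f: "rapid f" and m: "f \<in> borel_measurable borel"
  shows "L12 f"
proof -
  have i: "integrable lborel f" by (rule rapid_integrable[OF f m])
  obtain B where B: "\<And>x. cmod (f x) \<le> B" using f unfolding rapid_def by (metis mult_1 power_0)
  have "integrable lborel (\<lambda>x. (cmod (f x))\<^sup>2)"
  proof (rule Bochner_Integration.integrable_bound[of _ "\<lambda>x. B * cmod (f x)"])
    show "AE x in lborel. norm ((cmod (f x))\<^sup>2) \<le> norm (B * cmod (f x))"
    proof (rule AE_I2)
      fix x
      have "B \<ge> 0" using order_trans[OF norm_ge_zero B] .
      then show "norm ((cmod (f x))\<^sup>2) \<le> norm (B * cmod (f x))"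
        using mult_right_mono[OF B norm_ge_zero, of x "f x"] by (simp add: power2_eq_square abs_mult)
    qed
  qed (use i m in auto)
  then show ?thesis using i m by (simp add: L12_def square_integrable_def)
qed

section \<open>Calculus of functions with controlled derivatives\<close>

lemma Creg_P: "Creg P n f \<Longrightarrow> P f"
  by (cases n) auto

lemma Creg_continuous: "Creg P n f \<Longrightarrow> continuous_on UNIV f"
  by (cases n) (auto intro!: continuous_at_imp_continuous_on dest!: spec intro: has_vector_derivative_continuous)

lemma Creg_measurable: "Creg P n f \<Longrightarrow> f \<in> borel_measurable borel"
  by (rule borel_measurable_continuous_onI[OF Creg_continuous])

lemma Creg_Suc: "Creg P (Suc n) f \<Longrightarrow> Creg P n f"
proof (induction n arbitrary: f)
  case 0
  then show ?case using Creg_continuous[OF 0] Creg_P[OF 0] by simp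
next
  case (Suc n)
  then show ?case by (metis Creg.simps(2))
qed

lemma Creg_SucI:
  "P f \<Longrightarrow> (\<And>x. (f has_vector_derivative f' x) (at x)) \<Longrightarrow> Creg P n f' \<Longrightarrow> Creg P (Suc n) f"
  by auto

lemma Creg_linear:
  assumes "bounded_linear L" "\<And>f. P f \<Longrightarrow> Q (\<lambda>x. L (f x))" "Creg P n f"
  shows "Creg Q n (\<lambda>x. L (f x))"
  using assms(3)
proof (induction n arbitrary: f)
  case 0
  then show ?case using assms(2) bounded_linear.continuous_on[OF assms(1), of UNIV f] by simp
next
  case (Suc n)
  then obtain f' where f': "\<And>x. (f has_vector_derivative f' x) (at x)" "Creg P n f'" by auto
  then have "\<forall>x. ((\<lambda>x. L (f x)) has_vector_derivative L (f' x)) (at x)"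
    using bounded_linear.has_vector_derivative[OF assms(1)] by blast
  then show ?case using Suc.IH[OF f'(2)] Creg_P[OF Suc.prems] assms(2) by auto
qed

lemma Creg_add:
  assumes P: "\<And>f g. P f \<Longrightarrow> P g \<Longrightarrow> P (\<lambda>x. f x + g x)"
  shows "Creg P n f \<Longrightarrow> Creg P n g \<Longrightarrow> Creg P n (\<lambda>x. f x + g x)"
proof (induction n arbitrary: f g)
  case 0
  then show ?case using P by (auto intro: continuous_on_add)
next
  case (Suc n)
  obtain f' g' where f': "\<And>x. (f has_vector_derivative f' x) (at x)" "Creg P n f'"
    and g': "\<And>x. (g has_vector_derivative g' x) (at x)" "Creg P n g'" using Suc.prems by auto
  have "\<forall>x. ((\<lambda>x. f x + g x) has_vector_derivative f' x + g' x) (at x)"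
    using f' g' by (auto intro: has_vector_derivative_add)
  then show ?case using Suc.IH[OF f'(2) g'(2)] P Creg_P[OF Suc.prems(1)] Creg_P[OF Suc.prems(2)] by auto
qed

text \<open>Three growth conditions, so that the Leibniz rule is proved once for products of two
  polynomially bounded factors and for a polynomially bounded times a rapidly decreasing
  one.\<close>

lemma Creg_mult:
  fixes f g :: "real \<Rightarrow> 'a::real_normed_algebra"
  assumes R: "\<And>f g. P f \<Longrightarrow> Q g \<Longrightarrow> R (\<lambda>x. f x * g x)" and Ra: "\<And>f g. R f \<Longrightarrow> R g \<Longrightarrow> R (\<lambda>x. f x + g x)"
  shows "Creg P n f \<Longrightarrow> Creg Q n g \<Longrightarrow> Creg R n (\<lambda>x. f x * g x)"
proof (induction n arbitrary: f g)
  case 0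
  then show ?case using R by (auto intro: continuous_on_mult)
next
  case (Suc n)
  obtain f' g' where f': "\<And>x. (f has_vector_derivative f' x) (at x)" "Creg P n f'"
    and g': "\<And>x. (g has_vector_derivative g' x) (at x)" "Creg Q n g'" using Suc.prems by auto
  have "((\<lambda>x. f x * g x) has_vector_derivative f x * g' x + f' x * g x) (at x)" for x
    by (rule has_vector_derivative_mult[OF f'(1) g'(1)])
  moreover have "Creg R n (\<lambda>x. f x * g' x + f' x * g x)"
    by (intro Creg_add Ra Suc.IH Creg_Suc[OF Suc.prems(1)] Creg_Suc[OF Suc.prems(2)] f' g')
  ultimately show ?case
    by (rule Creg_SucI[where P = R and f = "\<lambda>x. f x * g x" and f' = "\<lambda>x. f x * g' x + f' x * g x",
          OF R[OF Creg_P[OF Suc.prems(1)] Creg_P[OF Suc.prems(2)]]])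
qed

lemma Creg_polyb_add: "Creg polyb n f \<Longrightarrow> Creg polyb n g \<Longrightarrow> Creg polyb n (\<lambda>x. f x + g x)"
  by (rule Creg_add) (rule polyb_add)

lemma Creg_rapid_add: "Creg rapid n f \<Longrightarrow> Creg rapid n g \<Longrightarrow> Creg rapid n (\<lambda>x. f x + g x)"
  by (rule Creg_add) (rule rapid_add)

lemma Creg_polyb_mult:
  fixes f g :: "real \<Rightarrow> 'a::real_normed_algebra"
  shows "Creg polyb n f \<Longrightarrow> Creg polyb n g \<Longrightarrow> Creg polyb n (\<lambda>x. f x * g x)"
  by (rule Creg_mult[where P = polyb and Q = polyb]) (auto intro: polyb_mult polyb_add)

lemma Creg_rapid_mult:
  fixes f g :: "real \<Rightarrow> 'a::real_normed_algebra"
  shows "Creg polyb n f \<Longrightarrow> Creg rapid n g \<Longrightarrow> Creg rapid n (\<lambda>x. f x * g x)"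
  by (rule Creg_mult[where P = polyb and Q = rapid]) (auto intro: polyb_mult_rapid rapid_add)

lemma Creg_polyb_linear: "bounded_linear L \<Longrightarrow> Creg polyb n f \<Longrightarrow> Creg polyb n (\<lambda>x. L (f x))"
  by (rule Creg_linear) (auto intro: polyb_linear)

lemma Creg_rapid_linear: "bounded_linear L \<Longrightarrow> Creg rapid n f \<Longrightarrow> Creg rapid n (\<lambda>x. L (f x))"
  by (rule Creg_linear) (auto intro: rapid_linear)

lemma Creg_rapid_reflect: "Creg rapid n f \<Longrightarrow> Creg rapid n (\<lambda>x. f (- x))"
proof (induction n arbitrary: f)
  case 0
  then show ?case by (auto intro!: rapid_reflect continuous_on_compose2[of UNIV f _ uminus] continuous_intros)
next
  case (Suc n)
  obtain f' where f': "\<And>x. (f has_vector_derivative f' x) (at x)" "Creg rapid n f'" using Suc.prems by auto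
  have "((\<lambda>x. f (- x)) has_vector_derivative - f' (- x)) (at x)" for x
    using vector_diff_chain_at[OF has_vector_derivative_minus[OF has_vector_derivative_id] f'(1)[of "- x"]]
    by (simp add: o_def)
  moreover have "Creg rapid n (\<lambda>x. - f' (- x))"
    by (rule Creg_rapid_linear[OF bounded_linear_minus[OF bounded_linear_ident] Suc.IH[OF f'(2)]])
  ultimately show ?case 
    by (rule Creg_SucI[where P = rapid and f' = "\<lambda>x. - f' (- x)", OF rapid_reflect[OF Creg_P[OF Suc.prems]]])
qed

lemma Creg_polyb_const: "Creg polyb n (\<lambda>x. c)"
proof (induction n arbitrary: c)
  case (Suc n)
  then show ?case using polyb_bounded[of "\<lambda>x. c" "norm c"]
    by (auto intro!: exI[of _ "\<lambda>x. 0"])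
qed (auto intro: polyb_bounded[of _ "norm c" for c])

lemma Creg_polyb_cis: "Creg polyb n (\<lambda>x. cis (s * x))"
proof (induction n)
  case (Suc n)
  have "((\<lambda>x. cis (s * x)) has_vector_derivative (of_real s * \<i>) * cis (s * x)) (at x)" for x
    unfolding has_vector_derivative_def
    by (rule has_derivative_eq_rhs[OF has_derivative_cis[of "\<lambda>x. s * x" "\<lambda>h. s * h"]])
       (auto intro!: derivative_eq_intros simp: fun_eq_iff scaleR_conv_of_real)
  moreover have "Creg polyb n (\<lambda>x. (of_real s * \<i>) * cis (s * x))"
    by (rule Creg_polyb_mult[OF Creg_polyb_const Suc])
  ultimately show ?case
    by (rule Creg_SucI[where P = polyb and f' = "\<lambda>x. (of_real s * \<i>) * cis (s * x)", rotated])
       (rule polyb_bounded[of _ 1], simp)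
qed (auto intro!: polyb_bounded[of _ 1] continuous_intros)

text \<open>Used for the inverse square root of \<open>hq\<close> and for the reciprocal of a phase
  derivative. Each differentiation lowers the exponent by 1, so the induction keeps \<open>s\<close>
  arbitrary and needs control of \<open>h\<close> from below as well as from above.\<close>

lemma Creg_powr:
  fixes h :: "real \<Rightarrow> real" and s :: real
  assumes pos: "\<And>x. h x > 0" and inv: "polyb (\<lambda>x. 1 / h x)" and h: "Creg polyb n h"
  shows "Creg polyb n (\<lambda>x. h x powr s)"
proof -
  have pb: "polyb (\<lambda>x. h x powr s)" if ph: "polyb h" for s :: real
  proof -
    define k where "k = nat \<lceil>\<bar>s\<bar>\<rceil>"
    have ks: "\<bar>s\<bar> \<le> real k" unfolding k_def by linarith
    \<comment> \<open>The sum \<open>h + 1 / h\<close> dominates both \<open>h\<close> and its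
      reciprocal and is at least 1, so any real power of \<open>h\<close> lies below its power with
      an integer exponent \<open>k \<ge> \<bar>s\<bar>\<close>.\<close>
    have "polyb (\<lambda>x. (h x + 1 / h x) ^ k)" by (intro polyb_power polyb_add ph inv)
    then show ?thesis
    proof (rule polyb_le)
      fix x
      have y: "h x + 1 / h x \<ge> 1" "h x \<le> h x + 1 / h x" "1 / h x \<le> h x + 1 / h x"
      proof -
        show "h x + 1 / h x \<ge> 1"
          using pos[of x] by (cases "h x \<ge> 1") (auto intro: add_increasing2 add_increasing)
      qed (use pos[of x] in auto)
      have "h x powr s \<le> (h x + 1 / h x) powr \<bar>s\<bar>"
      proof (cases "s \<ge> 0")
        case True then show ?thesis using pos[of x] y by (auto intro!: powr_mono2)
      next
        case False
        have "h x powr s = (1 / h x) powr (- s)" using pos[of x] by (simp add: powr_minus powr_divide)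
        then show ?thesis using False pos[of x] y by (auto intro!: powr_mono2)
      qed
      also have "\<dots> \<le> (h x + 1 / h x) powr real k" using y ks by (intro powr_mono) auto
      also have "\<dots> = (h x + 1 / h x) ^ k" using y by (intro powr_realpow) auto
      finally show "norm (h x powr s) \<le> norm ((h x + 1 / h x) ^ k)"
        using order_trans[OF _ abs_ge_self] by simp
    qed
  qed
  show ?thesis using h
  proof (induction n arbitrary: s)
    case 0
    have "continuous_on UNIV (\<lambda>x. h x powr s)"
      using 0 pos by (intro continuous_on_powr continuous_on_const) (auto simp: less_imp_neq[symmetric] dest: less_imp_neq)
    then show ?case using pb[OF Creg_P[OF 0]] by simp
  next
    case (Suc n)
    obtain h' where h': "\<And>x. (h has_vector_derivative h' x) (at x)" "Creg polyb n h'" using Suc.prems by auto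
    have "((\<lambda>x. h x powr s) has_vector_derivative (s * h x powr (s - 1)) * h' x) (at x)" for x
      using DERIV_fun_powr[of h "h' x" x s] h'(1)[of x] pos[of x]
      by (simp add: has_real_derivative_iff_has_vector_derivative)
    moreover have "Creg polyb n (\<lambda>x. (s * h x powr (s - 1)) * h' x)"
      by (intro Creg_polyb_mult[OF Creg_polyb_mult[OF Creg_polyb_const Suc.IH] h'(2)] Creg_Suc[OF Suc.prems])
    ultimately show ?case 
      by (rule Creg_SucI[where P = polyb and f = "\<lambda>x. h x powr s", OF pb[OF Creg_P[OF Suc.prems], of s]])
  qed
qed

text \<open>Such averages are remainders in Taylor's formula. Differentiating under the integral
  multiplies the weight \<open>p\<close> by \<open>r\<close>, which is why the induction runs over
  arbitrary continuous weights; the growth bound survives because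
  \<open>\<bar>r * x\<bar> \<le> \<bar>x\<bar>\<close>.\<close>

lemma Creg_average:
  fixes g :: "real \<Rightarrow> real"
  assumes "Creg polyb n g" "continuous_on UNIV p"
  shows "Creg polyb n (\<lambda>x. integral {0..1} (\<lambda>r. p r * g (r * x)))"
  using assms
proof (induction n arbitrary: g p)
  case 0
  have g: "continuous_on UNIV g" "polyb g" using 0 by auto
  obtain C N where C: "C \<ge> 0" "\<And>x. norm (g x) \<le> C * (1 + \<bar>x\<bar>) ^ N" using g(2) by (rule polybE) blast
  have "bounded (p ` {0..1})" by (intro compact_imp_bounded compact_continuous_image continuous_on_subset[OF 0(2)]) auto
  then obtain B where B: "\<And>r. r \<in> {0..1} \<Longrightarrow> \<bar>p r\<bar> \<le> B" unfolding bounded_iff by (metis imageI real_norm_def)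
  have B0: "B \<ge> 0" using B[of 0] by auto
  have c: "continuous_on S (\<lambda>z. p (snd z) * g (snd z * fst z))" for S
    by (intro continuous_intros continuous_on_compose2[OF 0(2)] continuous_on_compose2[OF g(1)]) auto
  have "continuous_on UNIV (\<lambda>x. integral (cbox 0 1) (\<lambda>r. p r * g (r * x)))"
    by (rule integral_continuous_on_param) (use c in \<open>simp add: case_prod_beta\<close>)
  moreover have "norm (integral {0..1} (\<lambda>r. p r * g (r * x))) \<le> (B * C) * (1 + \<bar>x\<bar>) ^ N" for x
  proof -
    have "norm (integral {0..1} (\<lambda>r. p r * g (r * x))) \<le> integral {0..1::real} (\<lambda>r. (B * C) * (1 + \<bar>x\<bar>) ^ N)"
    proof (rule Henstock_Kurzweil_Integration.integral_norm_bound_integral)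
      show "(\<lambda>r. p r * g (r * x)) integrable_on {0..1}"
        by (intro integrable_continuous_interval continuous_intros continuous_on_compose2[OF 0(2)] continuous_on_compose2[OF g(1)]) auto
      fix r :: real assume r: "r \<in> {0..1}"
      have "\<bar>r * x\<bar> \<le> \<bar>x\<bar>" using r by (auto simp: abs_mult intro!: mult_left_le_one_le)
      then have "(1 + \<bar>r * x\<bar>) ^ N \<le> (1 + \<bar>x\<bar>) ^ N" by (intro power_mono) auto
      then have "norm (g (r * x)) \<le> C * (1 + \<bar>x\<bar>) ^ N"
        by (rule order_trans[OF C(2)[of "r * x"] mult_left_mono[OF _ C(1)]])
      then have "\<bar>p r\<bar> * norm (g (r * x)) \<le> B * (C * (1 + \<bar>x\<bar>) ^ N)"
        using B[OF r] B0 by (intro mult_mono) auto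
      then show "norm (p r * g (r * x)) \<le> (B * C) * (1 + \<bar>x\<bar>) ^ N" by (simp add: abs_mult mult_ac)
    qed auto
    then show ?thesis by simp
  qed
  ultimately show ?case by (auto simp: polyb_def)
next
  case (Suc n)
  obtain g' where g': "\<And>x. (g has_vector_derivative g' x) (at x)" "Creg polyb n g'" using Suc.prems by auto
  have 0: "Creg polyb 0 (\<lambda>x. integral {0..1} (\<lambda>r. p r * g (r * x)))"
  proof -
    have "Creg polyb n (\<lambda>x. integral {0..1} (\<lambda>r. p r * g (r * x)))" by (rule Suc.IH[OF Creg_Suc[OF Suc.prems(1)] Suc.prems(2)])
    from Creg_continuous[OF this] Creg_P[OF this] show ?thesis by simp
  qed
  have p: "continuous_on S p" for S by (rule continuous_on_subset[OF Suc.prems(2)]) auto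
  have gc: "continuous_on UNIV g" "continuous_on UNIV g'" by (rule Creg_continuous[OF Suc.prems(1)], rule Creg_continuous[OF g'(2)])
  have "((\<lambda>x. integral (cbox 0 1) (\<lambda>r. p r * g (r * x))) has_vector_derivative integral (cbox 0 1) (\<lambda>r. (p r * r) * g' (r * x))) (at x within UNIV)" for x
  proof (rule leibniz_rule_vector_derivative)
    fix x r :: real
    have "((\<lambda>x. r * x) has_vector_derivative r) (at x)"
      unfolding has_real_derivative_iff_has_vector_derivative[symmetric]
      by (auto intro!: derivative_eq_intros)
    from vector_diff_chain_at[OF this g'(1)[of "r * x"]]
    have "((\<lambda>x. g (r * x)) has_vector_derivative r * g' (r * x)) (at x)"
      by (simp add: o_def)
    then show "((\<lambda>x. p r * g (r * x)) has_vector_derivative (p r * r) * g' (r * x)) (at x within UNIV)"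
      using has_vector_derivative_mult_right[of "\<lambda>x. g (r * x)" "r * g' (r * x)" "at x" "p r"] by (simp add: mult.assoc)
  next
    show "(\<lambda>r. p r * g (r * x)) integrable_on cbox 0 1" for x
      by (intro integrable_continuous continuous_intros p continuous_on_compose2[OF gc(1)]) auto
    have "continuous_on S (\<lambda>z. (p (snd z) * snd z) * g' (snd z * fst z))" for S
      by (intro continuous_intros continuous_on_compose2[OF Suc.prems(2)] continuous_on_compose2[OF gc(2)]) auto
    then show "continuous_on (UNIV \<times> cbox 0 1) (\<lambda>(x, r). (p r * r) * g' (r * x))" by (simp add: case_prod_beta)
  qed auto
  moreover have "Creg polyb n (\<lambda>x. integral {0..1} (\<lambda>r. (p r * r) * g' (r * x)))"
    by (rule Suc.IH[OF g'(2)]) (intro continuous_intros p)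
  ultimately show ?case 
    unfolding cbox_interval
    by (rule Creg_SucI[where P = polyb and f = "\<lambda>x. integral {0..1} (\<lambda>r. p r * g (r * x))", OF Creg_P[OF 0]])
qed

text \<open>The fundamental theorem of calculus on \<open>[-n, n]\<close>, with boundary terms that
  tend to 0 because \<open>G\<close> decays; this is the form in which integration by parts is used
  below.\<close>

lemma integral_derivative_zero:
  fixes G :: "real \<Rightarrow> complex"
  assumes d: "\<And>x. (G has_vector_derivative G' x) (at x)" and c: "continuous_on UNIV G'"
    and i: "integrable lborel G'" and r: "rapid G"
  shows "(LINT x|lborel. G' x) = 0"
proof -
  have [measurable]: "G' \<in> borel_measurable borel" using i by auto
  have "(\<lambda>n. LINT x|lborel. indicator {- real n..real n} x *\<^sub>R G' x) \<longlonglongrightarrow> (LINT x|lborel. G' x)"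
  proof (rule integral_dominated_convergence[where w = "\<lambda>x. norm (G' x)"])
    show "AE x in lborel. (\<lambda>n. indicator {- real n..real n} x *\<^sub>R G' x) \<longlonglongrightarrow> G' x"
    proof (rule AE_I2, rule tendsto_eventually)
      fix x :: real
      obtain n0 where n0: "real n0 \<ge> \<bar>x\<bar>" using real_arch_simple by blast
      have "- real n \<le> x \<and> x \<le> real n" if "n \<ge> n0" for n using n0 that by linarith
      then show "\<forall>\<^sub>F n in sequentially. indicator {- real n..real n} x *\<^sub>R G' x = G' x"
        by (intro eventually_mono[OF eventually_ge_at_top[of n0]]) (auto simp: abs_le_iff indicator_def)
    qed
  qed (use i in \<open>auto simp: indicator_def\<close>)
  moreover have "(LINT x|lborel. indicator {- real n..real n} x *\<^sub>R G' x) = G (real n) - G (- real n)" for n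
    by (rule integral_FTC_Icc) (auto intro: has_vector_derivative_at_within d continuous_on_subset[OF c])
  ultimately have l: "(\<lambda>n. G (real n) - G (- real n)) \<longlonglongrightarrow> (LINT x|lborel. G' x)" by simp
  obtain C where C: "\<And>x. norm (G x) \<le> C * inverse (1 + x\<^sup>2)" using rapid_bound_square[OF r] by blast
  have C0: "C \<ge> 0" using order_trans[OF norm_ge_zero C[of 0]] by simp
  have "norm (G (real n) - G (- real n)) \<le> 2 * C * inverse (real n)" if "n > 0" for n
  proof -
    have "real n \<le> 1 + (real n)\<^sup>2" using that by (simp add: power2_eq_square) (metis le_add2 le_square of_nat_mono of_nat_mult add_increasing zero_le_one)
    then have "C * inverse (1 + (real n)\<^sup>2) \<le> C * inverse (real n)"
      using that C0 by (intro mult_left_mono le_imp_inverse_le) auto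
    then show ?thesis using norm_triangle_ineq4[of "G (real n)" "G (- real n)"] C[of "real n"] C[of "- real n"] by simp
  qed
  then have "\<forall>\<^sub>F n in sequentially. norm (G (real n) - G (- real n)) \<le> 2 * C * inverse (real n)"
    by (intro eventually_mono[OF eventually_gt_at_top[of 0]])
  moreover have "(\<lambda>n. 2 * C * inverse (real n)) \<longlonglongrightarrow> 2 * C * 0"
    by (intro tendsto_intros lim_inverse_n)
  ultimately have "(\<lambda>n. G (real n) - G (- real n)) \<longlonglongrightarrow> 0"
    using Lim_null_comparison by fastforce
  then show ?thesis using l LIMSEQ_unique by blast
qed

text \<open>Non-stationary phase: each integration by parts gains a factor \<open>1 / t\<close>.\<close>

lemma nonstationary_phase:
  fixes \<Theta> \<Theta>' :: "real \<Rightarrow> real"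
  assumes d: "\<And>x. (\<Theta> has_real_derivative \<Theta>' x) (at x)" and c: "continuous_on UNIV \<Theta>'"
    and nz: "\<And>x. \<Theta>' x \<noteq> 0" and inv: "Creg polyb l (\<lambda>x. 1 / \<Theta>' x)" and b: "Creg rapid l b"
  shows "\<exists>C. \<forall>t>0. cmod (LINT x|lborel. cis (t * \<Theta> x) * b x) \<le> C / t ^ l"
  using b inv
proof (induction l arbitrary: b)
  case 0
  have bi: "integrable lborel b" using rapid_integrable Creg_P[OF 0(1)] Creg_measurable[OF 0(1)] by blast
  have "cmod (LINT x|lborel. cis (t * \<Theta> x) * b x) \<le> (LINT x|lborel. cmod (b x))" for t
    using integral_norm_bound[of lborel "\<lambda>x. cis (t * \<Theta> x) * b x"] by (simp add: norm_mult)
  then show ?case by auto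
next
  case (Suc l)
  \<comment> \<open>Differentiating \<open>cis (t * \<Theta> x) * q x\<close> reproduces the
    integrand with a factor \<open>\<i> * t\<close>, plus an oscillatory integral with amplitude
    \<open>q'\<close>, which has one derivative less. Dividing by \<open>t\<close> is the
    gain.\<close>
  define q where "q x = complex_of_real (1 / \<Theta>' x) * b x" for x
  have "Creg polyb (Suc l) (\<lambda>x. complex_of_real (1 / \<Theta>' x))"
    by (rule Creg_polyb_linear[OF bounded_linear_of_real Suc.prems(2)])
  then have q: "Creg rapid (Suc l) q"
    unfolding q_def by (rule Creg_rapid_mult[OF _ Suc.prems(1)])
  then obtain q' where q': "\<And>x. (q has_vector_derivative q' x) (at x)" "Creg rapid l q'" by auto
  obtain C where C: "\<And>t. t > 0 \<Longrightarrow> cmod (LINT x|lborel. cis (t * \<Theta> x) * q' x) \<le> C / t ^ l"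
    using Suc.IH[OF q'(2) Creg_Suc[OF Suc.prems(2)]] by blast
  have bi: "integrable lborel b" using rapid_integrable Creg_P[OF Suc.prems(1)] Creg_measurable[OF Suc.prems(1)] by blast
  have qi: "integrable lborel q'" using rapid_integrable Creg_P[OF q'(2)] Creg_measurable[OF q'(2)] by blast
  have \<Theta>c: "continuous_on UNIV \<Theta>" using d DERIV_isCont by (intro continuous_at_imp_continuous_on) blast
  have \<Theta>m: "\<Theta> \<in> borel_measurable borel" by (rule borel_measurable_continuous_onI[OF \<Theta>c])
  have "cmod (LINT x|lborel. cis (t * \<Theta> x) * b x) \<le> C / t ^ Suc l" if t: "t > 0" for t
  proof -
    have e: "(\<lambda>x. cis (t * \<Theta> x)) \<in> borel_measurable borel" using \<Theta>m by measurable
    have i1: "integrable lborel (\<lambda>x. cis (t * \<Theta> x) * b x)" by (rule integrable_mult_bounded[OF bi e, of 1]) simp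
    have i2: "integrable lborel (\<lambda>x. cis (t * \<Theta> x) * q' x)" by (rule integrable_mult_bounded[OF qi e, of 1]) simp
    let ?G' = "\<lambda>x. (\<i> * of_real t) * (cis (t * \<Theta> x) * b x) + cis (t * \<Theta> x) * q' x"
    have "(LINT x|lborel. ?G' x) = 0"
    proof (rule integral_derivative_zero[where G = "\<lambda>x. cis (t * \<Theta> x) * q x"])
      fix x
      have "((\<lambda>x. t * \<Theta> x) has_derivative (\<lambda>h. t * \<Theta>' x * h)) (at x)"
        using DERIV_cmult[OF d[of x], of t] by (simp add: has_field_derivative_def)
      from has_derivative_cis[OF this]
      have "((\<lambda>x. cis (t * \<Theta> x)) has_vector_derivative (t * \<Theta>' x) *\<^sub>R (\<i> * cis (t * \<Theta> x))) (at x)"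
        unfolding has_vector_derivative_def
        by (rule has_derivative_eq_rhs) (auto simp: scaleR_conv_of_real fun_eq_iff mult_ac)
      from has_vector_derivative_mult[OF this q'(1)[of x]]
      have "((\<lambda>x. cis (t * \<Theta> x) * q x) has_vector_derivative
         cis (t * \<Theta> x) * q' x + (t * \<Theta>' x) *\<^sub>R (\<i> * cis (t * \<Theta> x)) * q x) (at x)" .
      moreover have "cis (t * \<Theta> x) * q' x + (t * \<Theta>' x) *\<^sub>R (\<i> * cis (t * \<Theta> x)) * q x = ?G' x"
        using nz[of x] by (simp add: q_def scaleR_conv_of_real)
      ultimately show "((\<lambda>x. cis (t * \<Theta> x) * q x) has_vector_derivative ?G' x) (at x)" by (simp only:)
    next
      show "continuous_on UNIV ?G'"
        by (intro continuous_intros \<Theta>c Creg_continuous[OF Suc.prems(1)] Creg_continuous[OF q'(2)])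
      show "integrable lborel ?G'" using i1 i2 by simp
      show "rapid (\<lambda>x. cis (t * \<Theta> x) * q x)"
        by (rule polyb_mult_rapid[OF polyb_bounded[of _ 1] Creg_P[OF q]]) simp
    qed
    then have "(\<i> * of_real t) * (LINT x|lborel. cis (t * \<Theta> x) * b x) = - (LINT x|lborel. cis (t * \<Theta> x) * q' x)"
      using i1 i2 by (simp add: add_eq_0_iff2)
    then have "t * cmod (LINT x|lborel. cis (t * \<Theta> x) * b x) = cmod (LINT x|lborel. cis (t * \<Theta> x) * q' x)"
      using t by (metis norm_minus_cancel norm_mult norm_ii norm_of_real mult_1 abs_of_pos)
    then have "t * cmod (LINT x|lborel. cis (t * \<Theta> x) * b x) \<le> C / t ^ l" using C[OF t] by simp
    then show ?thesis using t by (simp add: field_simps)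
  qed
  then show ?case by blast
qed

section \<open>Schwartz functions\<close>

lemma norm_cis_minus_one_le: "cmod (cis y - 1) \<le> \<bar>y\<bar>"
proof -
  have "cmod (cis y - 1) = 2 * \<bar>sin (y / 2)\<bar>"
    using dist_exp_i_1[of y] by (simp add: cis_conv_exp)
  also have "\<dots> \<le> \<bar>y\<bar>" using abs_sin_x_le_abs_x[of "y / 2"] by simp
  finally show ?thesis .
qed

lemma ft_has_vector_derivative:
  assumes a: "integrable lborel a" and b: "integrable lborel (\<lambda>y. of_real y * a y)"
  shows "(ft a has_vector_derivative ft (\<lambda>y. 2 * pi * \<i> * (of_real y * a y)) x) (at x)"
proof -
  have [measurable]: "a \<in> borel_measurable borel" using a by auto
  let ?b = "\<lambda>y. 2 * pi * \<i> * (of_real y * a y)"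
  have bi: "integrable lborel ?b" using b by (intro integrable_mult_right)
  \<comment> \<open>The error in the difference quotient of the character. A second-order estimate
    makes it tend to 0 for each \<open>y\<close>, while a bound linear in |y| and uniform in
    \<open>h\<close> makes it dominated by the first moment of \<open>a\<close>.\<close>
  define D where "D h y = (cis (2 * pi * h * y) - 1) / of_real h - 2 * pi * \<i> * of_real y" for h y
  have D_lim: "(\<lambda>i. D (X i) y) \<longlonglongrightarrow> 0" if X: "\<And>i. X i \<noteq> 0" "X \<longlonglongrightarrow> 0" for X :: "nat \<Rightarrow> real" and y
  proof -
    have le: "cmod (D h y) \<le> 2 * pi\<^sup>2 * y\<^sup>2 * \<bar>h\<bar>" if "h \<noteq> 0" for h
    proof -
      have D: "D h y = (cis (2 * pi * h * y) - (1 + \<i> * of_real (2 * pi * h * y))) / of_real h"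
        using that by (simp add: D_def diff_divide_distrib add_divide_distrib right_diff_distrib)
      have "cmod (cis (2 * pi * h * y) - (1 + \<i> * of_real (2 * pi * h * y))) \<le> \<bar>2 * pi * h * y\<bar>\<^sup>2 / 2"
        using iexp_approx1[of "2 * pi * h * y" 1] by (simp add: cis_conv_exp power2_eq_square)
      then have "cmod (D h y) \<le> (\<bar>2 * pi * h * y\<bar>\<^sup>2 / 2) / \<bar>h\<bar>"
        unfolding D norm_divide norm_of_real by (rule divide_right_mono) simp
      also have "\<dots> = 2 * pi\<^sup>2 * y\<^sup>2 * \<bar>h\<bar>"
        using that by (simp add: power2_eq_square abs_mult)
      finally show ?thesis .
    qed
    have "(\<lambda>i. 2 * pi\<^sup>2 * y\<^sup>2 * \<bar>X i\<bar>) \<longlonglongrightarrow> 2 * pi\<^sup>2 * y\<^sup>2 * \<bar>0\<bar>"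
      by (intro tendsto_intros X)
    then have z: "(\<lambda>i. 2 * pi\<^sup>2 * y\<^sup>2 * \<bar>X i\<bar>) \<longlonglongrightarrow> 0" by simp
    show ?thesis
      by (rule Lim_null_comparison[OF always_eventually z]) (use le X in auto)
  qed
  have D_le: "cmod (D h y) \<le> 4 * pi * \<bar>y\<bar>" if "h \<noteq> 0" for h y
  proof -
    have "cmod ((cis (2 * pi * h * y) - 1) / of_real h) \<le> \<bar>2 * pi * h * y\<bar> / \<bar>h\<bar>"
      unfolding norm_divide norm_of_real by (intro divide_right_mono norm_cis_minus_one_le) simp
    also have "\<dots> = 2 * pi * \<bar>y\<bar>" using that by (simp add: abs_mult)
    finally have "cmod ((cis (2 * pi * h * y) - 1) / of_real h) \<le> 2 * pi * \<bar>y\<bar>" .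
    moreover have "cmod (2 * pi * \<i> * of_real y) = 2 * pi * \<bar>y\<bar>" by (simp add: norm_mult)
    ultimately show ?thesis
      unfolding D_def using norm_triangle_ineq4[of "(cis (2 * pi * h * y) - 1) / of_real h" "2 * pi * \<i> * of_real y"]
      by linarith
  qed
  have eq: "(ft a (x + h) - ft a x - h *\<^sub>R ft ?b x) /\<^sub>R h = (LINT y|lborel. a y * cis (2 * pi * x * y) * D h y)"
    if h: "h \<noteq> 0" for h
  proof -
    have pt: "a y * cis (2 * pi * (x + h) * y) - a y * cis (2 * pi * x * y) - h *\<^sub>R (?b y * cis (2 * pi * x * y)) =
        h *\<^sub>R (a y * cis (2 * pi * x * y) * D h y)" for y
    proof -
      have c: "cis (2 * pi * (x + h) * y) = cis (2 * pi * x * y) * cis (2 * pi * h * y)"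
        by (simp add: cis_mult distrib_left distrib_right)
      have D: "of_real h * D h y = cis (2 * pi * h * y) - 1 - of_real h * (2 * pi * \<i> * of_real y)"
        using h by (simp add: D_def right_diff_distrib diff_divide_distrib)
      have "h *\<^sub>R (a y * cis (2 * pi * x * y) * D h y) = a y * cis (2 * pi * x * y) * (of_real h * D h y)"
        by (simp add: scaleR_conv_of_real)
      then show ?thesis unfolding D c by (simp add: scaleR_conv_of_real right_diff_distrib mult_ac)
    qed
    have i: "integrable lborel (\<lambda>y. a y * cis (2 * pi * (x + h) * y))" "integrable lborel (\<lambda>y. a y * cis (2 * pi * x * y))"
      "integrable lborel (\<lambda>y. h *\<^sub>R (?b y * cis (2 * pi * x * y)))"
      by (intro integrable_ft a, intro integrable_ft a, intro integrable_scaleR_right integrable_ft bi)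
    have "(ft a (x + h) - ft a x - h *\<^sub>R ft ?b x) =
      (LINT y|lborel. a y * cis (2 * pi * (x + h) * y) - a y * cis (2 * pi * x * y) - h *\<^sub>R (?b y * cis (2 * pi * x * y)))"
      unfolding ft_def integral_scaleR_right[symmetric] using i by simp
    also have "\<dots> = (LINT y|lborel. h *\<^sub>R (a y * cis (2 * pi * x * y) * D h y))"
      unfolding pt ..
    finally show ?thesis using h by simp
  qed
  have "(\<lambda>h. norm (ft a (x + h) - ft a x - h *\<^sub>R ft ?b x) / norm h) \<midarrow>0\<rightarrow> 0"
    unfolding tendsto_at_iff_sequentially o_def
  proof (intro allI impI)
    fix X :: "nat \<Rightarrow> real" assume X: "\<forall>i. X i \<in> UNIV - {0}" "X \<longlonglongrightarrow> 0"
    then have X0: "X i \<noteq> 0" for i by auto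
    have "(\<lambda>i. LINT y|lborel. a y * cis (2 * pi * x * y) * D (X i) y) \<longlonglongrightarrow> (LINT y::real|lborel. (0::complex))"
    proof (rule integral_dominated_convergence[where w = "\<lambda>y. 4 * pi * cmod (of_real y * a y)"])
      show "AE y in lborel. (\<lambda>i. a y * cis (2 * pi * x * y) * D (X i) y) \<longlonglongrightarrow> 0"
        using D_lim[OF X0 X(2)] by (intro AE_I2 tendsto_mult_right_zero)
      show "AE y in lborel. norm (a y * cis (2 * pi * x * y) * D (X i) y) \<le> 4 * pi * cmod (of_real y * a y)" for i
        using mult_left_mono[OF D_le[OF X0] norm_ge_zero] by (intro AE_I2) (simp add: norm_mult mult_ac)
    qed (use b in \<open>auto simp: D_def\<close>)
    then have "(\<lambda>i. norm (LINT y|lborel. a y * cis (2 * pi * x * y) * D (X i) y)) \<longlonglongrightarrow> 0"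
      by (simp add: tendsto_norm_zero)
    moreover have "norm (LINT y|lborel. a y * cis (2 * pi * x * y) * D (X i) y) =
        norm (ft a (x + X i) - ft a x - X i *\<^sub>R ft ?b x) / norm (X i)" for i
      unfolding eq[OF X0, symmetric] by (simp add: divide_inverse mult.commute)
    ultimately show "(\<lambda>i. norm (ft a (x + X i) - ft a x - X i *\<^sub>R ft ?b x) / norm (X i)) \<longlonglongrightarrow> 0" by simp
  qed
  then show ?thesis
    unfolding has_vector_derivative_def has_derivative_at by (auto intro: bounded_linear_scaleR_left)
qed

text \<open>Each moment of \<open>a\<close> buys one derivative of its transform, and each such
  derivative is bounded as the transform of an integrable function.\<close>

lemma Creg_ft:
  assumes "\<And>k. k \<le> n \<Longrightarrow> integrable lborel (\<lambda>y. of_real y ^ k * a y)"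
  shows "Creg polyb n (ft a)"
  using assms
proof (induction n arbitrary: a)
  case 0
  then have "integrable lborel a" by simp
  then show ?case using continuous_ft norm_ft_le by (auto intro: polyb_bounded)
next
  case (Suc n)
  have a: "integrable lborel a" "integrable lborel (\<lambda>y. of_real y * a y)"
    using Suc.prems[of 0] Suc.prems[of 1] by auto
  have "Creg polyb n (ft (\<lambda>y. 2 * pi * \<i> * (of_real y * a y)))"
  proof (rule Suc.IH)
    fix k assume "k \<le> n"
    then have "integrable lborel (\<lambda>y. 2 * pi * \<i> * (of_real y ^ Suc k * a y))"
      by (intro integrable_mult_right Suc.prems) auto
    then show "integrable lborel (\<lambda>y. of_real y ^ k * (2 * pi * \<i> * (of_real y * a y)))" by (simp add: mult_ac)
  qed
  then show ?case
    by (rule Creg_SucI[where P = polyb and f = "ft a", rotated 2])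
       (rule polyb_bounded[OF norm_ft_le[OF a(1)]], rule ft_has_vector_derivative[OF a])
qed

lemma schwartzE:
  assumes "schwartz f"
  obtains f' where "\<And>x. (f has_vector_derivative f' x) (at x)" "schwartz f'" "rapid f"
    "\<And>m. rapid (\<lambda>x. of_real x ^ m * f x)"
proof -
  obtain d where d0: "d 0 = f" and d: "\<And>n x. (d n has_vector_derivative d (Suc n) x) (at x)"
    and b: "\<And>m n. bounded (range (\<lambda>x. x ^ m *\<^sub>R d n x))"
    using assms unfolding schwartz_def derivs_of_def by blast
  have r: "rapid f"
    unfolding rapid_def
  proof
    fix N
    obtain B where B: "\<And>x. norm (x ^ 0 *\<^sub>R f x) \<le> B" using b[of 0 0] d0 unfolding bounded_iff by auto
    obtain C where C: "\<And>x. norm (x ^ N *\<^sub>R f x) \<le> C" using b[of N 0] d0 unfolding bounded_iff by auto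
    have "(1 + \<bar>x\<bar>) ^ N * norm (f x) \<le> 2 ^ N * (B + C)" for x
    proof -
      have "(1 + \<bar>x\<bar>) ^ N * norm (f x) \<le> 2 ^ N * (1 ^ N + \<bar>x\<bar> ^ N) * norm (f x)"
        by (intro mult_right_mono power_add_le) auto
      also have "\<dots> = 2 ^ N * (norm (x ^ 0 *\<^sub>R f x) + norm (x ^ N *\<^sub>R f x))"
        by (simp add: distrib_right power_abs mult.assoc)
      also have "\<dots> \<le> 2 ^ N * (B + C)" by (intro mult_left_mono add_mono B C) auto
      finally show ?thesis .
    qed
    then show "\<exists>C. \<forall>x. (1 + \<bar>x\<bar>) ^ N * norm (f x) \<le> C" by blast
  qed
  have "schwartz (d 1)"
    unfolding schwartz_def derivs_of_def by (rule exI[of _ "\<lambda>n. d (Suc n)"]) (auto simp: d b)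
  moreover have "rapid (\<lambda>x. of_real x ^ m * f x)" for m
  proof -
    have "polyb (\<lambda>x::real. complex_of_real x)" by (rule polyb_le[OF polyb_ident]) simp
    then show ?thesis by (intro polyb_mult_rapid[OF polyb_power r])
  qed
  ultimately show thesis using that[of "d 1"] d[of 0] d0 r by simp
qed

lemma schwartz_mult_ident:
  assumes "schwartz f" shows "schwartz (\<lambda>x. of_real x * f x)"
proof -
  obtain d where d0: "d 0 = f" and d: "\<And>n x. (d n has_vector_derivative d (Suc n) x) (at x)"
    and b: "\<And>m n. bounded (range (\<lambda>x. x ^ m *\<^sub>R d n x))"
    using assms unfolding schwartz_def derivs_of_def by blast
  \<comment> \<open>Leibniz' rule for the product with \<open>x\<close>. For \<open>n = 0\<close>
    the truncated index \<open>n - 1\<close> is harmless, since its coefficient vanishes.\<close>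
  define e where "e n x = of_real x * d n x + of_nat n * d (n - 1) x" for n x
  have "(e n has_vector_derivative e (Suc n) x) (at x)" for n x
  proof -
    have x: "(complex_of_real has_vector_derivative 1) (at x)"
      using has_vector_derivative_of_real[OF DERIV_ident] by simp
    have "((\<lambda>x. of_real x * d n x) has_vector_derivative of_real x * d (Suc n) x + 1 * d n x) (at x)"
      by (rule has_vector_derivative_mult[OF x d])
    moreover have "((\<lambda>x. of_nat n * d (n - 1) x) has_vector_derivative of_nat n * d n x) (at x)"
      using has_vector_derivative_mult_right[OF d[of "n - 1" x], of "of_nat n"] by (cases n) auto
    ultimately have "((\<lambda>x. of_real x * d n x + of_nat n * d (n - 1) x) has_vector_derivative
       (of_real x * d (Suc n) x + 1 * d n x) + of_nat n * d n x) (at x)"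
      by (rule has_vector_derivative_add)
    then show ?thesis by (simp add: e_def[abs_def] algebra_simps)
  qed
  moreover have "bounded (range (\<lambda>x. x ^ m *\<^sub>R e n x))" for m n
  proof -
    obtain B where B: "\<And>x. norm (x ^ Suc m *\<^sub>R d n x) \<le> B" using b[of "Suc m" n] unfolding bounded_iff by auto
    obtain C where C: "\<And>x. norm (x ^ m *\<^sub>R d (n - 1) x) \<le> C" using b[of m "n - 1"] unfolding bounded_iff by auto
    have "norm (x ^ m *\<^sub>R e n x) \<le> B + real n * C" for x
    proof -
      have "x ^ m *\<^sub>R e n x = x ^ Suc m *\<^sub>R d n x + of_nat n * (x ^ m *\<^sub>R d (n - 1) x)"
        by (simp add: e_def scaleR_conv_of_real algebra_simps)
      also have "norm \<dots> \<le> norm (x ^ Suc m *\<^sub>R d n x) + norm (of_nat n * (x ^ m *\<^sub>R d (n - 1) x))"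
        by (rule norm_triangle_ineq)
      also have "\<dots> \<le> B + real n * C"
        unfolding norm_mult norm_of_nat by (intro add_mono mult_left_mono B C) auto
      finally show ?thesis .
    qed
    then show ?thesis unfolding bounded_iff by blast
  qed
  moreover have "e 0 = (\<lambda>x. of_real x * f x)" by (simp add: e_def[abs_def] d0)
  ultimately show ?thesis unfolding schwartz_def derivs_of_def by blast
qed

lemma schwartz_cmult:
  assumes "schwartz f" shows "schwartz (\<lambda>x. c * f x)"
proof -
  obtain d where d0: "d 0 = f" and d: "\<And>n x. (d n has_vector_derivative d (Suc n) x) (at x)"
    and b: "\<And>m n. bounded (range (\<lambda>x. x ^ m *\<^sub>R d n x))"
    using assms unfolding schwartz_def derivs_of_def by blast
  have "bounded (range (\<lambda>x. x ^ m *\<^sub>R (c * d n x)))" for m n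
    using bounded_linear_image[OF b bounded_linear_mult_right[of c], of m n] by (simp add: image_image)
  moreover have "((\<lambda>x. c * d n x) has_vector_derivative c * d (Suc n) x) (at x)" for n x
    by (rule has_vector_derivative_mult_right[OF d])
  ultimately show ?thesis unfolding schwartz_def derivs_of_def using d0
    by (intro exI[of _ "\<lambda>n x. c * d n x"]) auto
qed

lemma schwartz_continuous: "schwartz f \<Longrightarrow> continuous_on UNIV f"
  by (erule schwartzE) (intro continuous_at_imp_continuous_on ballI has_vector_derivative_continuous)

lemma schwartz_rapid: "schwartz f \<Longrightarrow> rapid f"
  by (erule schwartzE)

lemma schwartz_L12: "schwartz f \<Longrightarrow> L12 f"
  by (intro rapid_L12 schwartz_rapid borel_measurable_continuous_onI schwartz_continuous)

lemma ft_schwartz_deriv: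
  assumes f: "schwartz f" and d: "\<And>x. (f has_vector_derivative f' x) (at x)" and f': "schwartz f'"
  shows "ft f' x = - (2 * pi * \<i> * of_real x) * ft f x"
proof -
  have i: "integrable lborel f" "integrable lborel f'" using f f' schwartz_L12 by (auto simp: L12_def)
  let ?G' = "\<lambda>y. f y * (of_real (2 * pi * x) * \<i> * cis (2 * pi * x * y)) + f' y * cis (2 * pi * x * y)"
  have i1: "integrable lborel (\<lambda>y. f y * (of_real (2 * pi * x) * \<i> * cis (2 * pi * x * y)))"
    using integrable_mult_right[OF integrable_ft[OF i(1), of x], of "of_real (2 * pi * x) * \<i>"] by (simp add: mult_ac)
  have fr: "rapid f" by (rule schwartz_rapid[OF f])
  have "(LINT y|lborel. ?G' y) = 0"
  proof (rule integral_derivative_zero)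
    show "((\<lambda>y. f y * cis (2 * pi * x * y)) has_vector_derivative ?G' y) (at y)" for y
    proof (rule has_vector_derivative_mult[OF d])
      show "((\<lambda>y. cis (2 * pi * x * y)) has_vector_derivative (of_real (2 * pi * x) * \<i> * cis (2 * pi * x * y))) (at y)"
        unfolding has_vector_derivative_def
        by (rule has_derivative_eq_rhs[OF has_derivative_cis[of "\<lambda>y. 2 * pi * x * y" "\<lambda>h. 2 * pi * x * h"]])
           (auto intro!: derivative_eq_intros simp: fun_eq_iff scaleR_conv_of_real)
    qed
    have "continuous_on UNIV f'" "continuous_on UNIV f"
      by (rule schwartz_continuous[OF f'], rule schwartz_continuous[OF f])
    then show "continuous_on UNIV ?G'" by (intro continuous_intros)
    show "integrable lborel ?G'" by (intro Bochner_Integration.integrable_add i1 integrable_ft i)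
    show "rapid (\<lambda>y. f y * cis (2 * pi * x * y))"
      using polyb_mult_rapid[OF polyb_bounded[of "\<lambda>y. cis (2 * pi * x * y)" 1] fr] by (simp add: mult.commute)
  qed
  then have "(LINT y|lborel. f y * (of_real (2 * pi * x) * \<i> * cis (2 * pi * x * y))) + ft f' x = 0"
    using i1 integrable_ft[OF i(2), of x] by (simp add: ft_def)
  also have "(LINT y|lborel. f y * (of_real (2 * pi * x) * \<i> * cis (2 * pi * x * y))) =
     (LINT y|lborel. (of_real (2 * pi * x) * \<i>) * (f y * cis (2 * pi * x * y)))"
    by (simp add: mult_ac)
  also have "\<dots> = (of_real (2 * pi * x) * \<i>) * ft f x" unfolding ft_def by (rule integral_mult_right_zero)
  finally show ?thesis by (simp add: add_eq_0_iff2 mult_ac)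
qed

lemma rapid_ft_schwartz:
  assumes "schwartz f" shows "rapid (ft f)"
proof -
  have pw: "\<exists>C. \<forall>x. \<bar>x\<bar> ^ N * cmod (ft f x) \<le> C" if "schwartz f" for N f
    using that
  proof (induction N arbitrary: f)
    case 0
    then show ?case using norm_ft_le[of f] schwartz_L12[OF 0] by (auto simp: L12_def)
  next
    case (Suc N)
    obtain f' where f': "\<And>x. (f has_vector_derivative f' x) (at x)" "schwartz f'"
      using Suc.prems by (rule schwartzE) blast
    obtain C where C: "\<And>x. \<bar>x\<bar> ^ N * cmod (ft f' x) \<le> C" using Suc.IH[OF f'(2)] by blast
    have "\<bar>x\<bar> ^ Suc N * cmod (ft f x) \<le> C / (2 * pi)" for x
    proof -
      have "cmod (ft f' x) = 2 * pi * \<bar>x\<bar> * cmod (ft f x)"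
        unfolding ft_schwartz_deriv[OF Suc.prems f'] by (simp add: norm_mult)
      then have "2 * pi * (\<bar>x\<bar> ^ Suc N * cmod (ft f x)) \<le> C" using C[of x] by (simp add: mult_ac)
      then show ?thesis by (simp add: field_simps)
    qed
    then show ?case by blast
  qed
  show ?thesis
    unfolding rapid_def
  proof
    fix N
    obtain B C where B: "\<And>x. \<bar>x\<bar> ^ 0 * cmod (ft f x) \<le> B" and C: "\<And>x. \<bar>x\<bar> ^ N * cmod (ft f x) \<le> C"
      using pw[OF assms] by metis
    have "(1 + \<bar>x\<bar>) ^ N * norm (ft f x) \<le> 2 ^ N * (B + C)" for x
    proof -
      have "(1 + \<bar>x\<bar>) ^ N * norm (ft f x) \<le> 2 ^ N * (1 ^ N + \<bar>x\<bar> ^ N) * norm (ft f x)"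
        by (intro mult_right_mono power_add_le) auto
      also have "\<dots> = 2 ^ N * (\<bar>x\<bar> ^ 0 * norm (ft f x) + \<bar>x\<bar> ^ N * norm (ft f x))"
        by (simp add: distrib_right mult.assoc)
      also have "\<dots> \<le> 2 ^ N * (B + C)" by (intro mult_left_mono add_mono B C) auto
      finally show ?thesis .
    qed
    then show "\<exists>C. \<forall>x. (1 + \<bar>x\<bar>) ^ N * norm (ft f x) \<le> C" by blast
  qed
qed

lemma Creg_rapid_ft_schwartz: "schwartz f \<Longrightarrow> Creg rapid n (ft f)"
proof (induction n arbitrary: f)
  case 0
  then show ?case using rapid_ft_schwartz continuous_ft schwartz_L12 by (auto simp: L12_def)
next
  case (Suc n)
  have i: "integrable lborel f" "integrable lborel (\<lambda>y. of_real y * f y)"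
    using schwartz_L12[OF Suc.prems] schwartz_L12[OF schwartz_mult_ident[OF Suc.prems]] by (auto simp: L12_def)
  show ?case
    by (rule Creg_SucI[where P = rapid and f = "ft f", OF rapid_ft_schwartz[OF Suc.prems] ft_has_vector_derivative[OF i]])
       (intro Suc.IH schwartz_cmult schwartz_mult_ident Suc.prems)
qed

lemma Creg_rapid_ift_schwartz: "schwartz f \<Longrightarrow> Creg rapid n (ift f)"
  unfolding ift_def[abs_def] by (rule Creg_rapid_reflect[OF Creg_rapid_ft_schwartz])

text \<open>The amplitude is the inverse transform of the Schwartz representative, so it decays
  rapidly together with all its derivatives, as repeated integration by parts requires.\<close>

lemma in_schwartz_FT:
  assumes "in_schwartz w"
  obtains a where "\<And>n. Creg rapid n a" "L12 a" "w = FT a"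
proof -
  obtain f where f: "schwartz f" "AE x in lborel. rep_l2 w x = f x" using assms unfolding in_schwartz_def by blast
  have c: "Creg rapid n (ift f)" for n by (rule Creg_rapid_ift_schwartz[OF f(1)])
  have L: "L12 (ift f)" by (rule rapid_L12[OF Creg_P[OF c] Creg_measurable[OF c]])
  have "w = abs_l2 f" by (rule eq_abs_l2I[OF L12_square_integrable[OF schwartz_L12[OF f(1)]] f(2)])
  then show thesis using that[OF c L] FT_ift[OF schwartz_L12[OF f(1)] L] by simp
qed

section \<open>The symbol of the kernel\<close>

text \<open>Shifting by half a period \<open>1 / (2 * X n)\<close> reverses the sign of the
  character. Twice the transform is then the integral of \<open>h y - h (y - s n)\<close> against
  the character, which tends to 0 because \<open>h\<close> is continuous with bounded
  support.\<close>

lemma riemann_lebesgue_continuous_support: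
  assumes h: "continuous_on UNIV h" "\<And>x. \<bar>x\<bar> > R \<Longrightarrow> h x = 0" and X: "\<And>n. \<bar>X n\<bar> > real n"
  shows "(\<lambda>n. ft h (X n)) \<longlonglongrightarrow> 0"
proof -
  have hi: "integrable lborel h" using L12_continuous_support[OF h] by (simp add: L12_def)
  have [measurable]: "h \<in> borel_measurable borel" using hi by auto
  define s where "s n = 1 / (2 * X n)" for n
  have X0: "X n \<noteq> 0" for n using X[of n] by auto
  have sn: "\<bar>s n\<bar> \<le> inverse (real n)" if "n > 0" for n
  proof -
    have "\<bar>s n\<bar> = inverse (2 * \<bar>X n\<bar>)" by (simp add: s_def abs_mult inverse_eq_divide)
    also have "\<dots> \<le> inverse (real n)" using X[of n] that by (intro le_imp_inverse_le) auto
    finally show ?thesis .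
  qed
  have s0: "s \<longlonglongrightarrow> 0"
    by (rule Lim_null_comparison[OF _ lim_inverse_n])
       (use sn in \<open>auto intro!: eventually_mono[OF eventually_gt_at_top[of 0]]\<close>)
  have s1: "\<bar>s n\<bar> \<le> 1" if "n > 0" for n
  proof -
    have "inverse (real n) \<le> 1" using that by (simp add: field_simps)
    then show ?thesis using sn[OF that] by linarith
  qed
  have "bounded (h ` {-R..R})"
    by (intro compact_imp_bounded compact_continuous_image continuous_on_subset[OF h(1)]) auto
  then obtain B0 where B0: "\<And>x. x \<in> {-R..R} \<Longrightarrow> cmod (h x) \<le> B0" unfolding bounded_iff by blast
  define B where "B = max B0 0"
  have hB: "cmod (h x) \<le> B" for x
  proof (cases "\<bar>x\<bar> > R")
    case False
    then have "x \<in> {-R..R}" by auto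
    from B0[OF this] show ?thesis by (simp add: B_def)
  qed (use h(2)[of x] in \<open>simp add: B_def\<close>)
  \<comment> \<open>The index is shifted to \<open>Suc n\<close> because the bound
    \<open>\<bar>s n\<bar> \<le> 1\<close>, which gives the integrands a common support, is proved
    for positive indices.\<close>
  have "(\<lambda>n. LINT y|lborel. cmod (h y - h (y - s (Suc n)))) \<longlonglongrightarrow> (LINT y::real|lborel. (0::real))"
  proof (rule integral_dominated_convergence[where w = "\<lambda>y. indicator {-(R + 1)..R + 1} y * (2 * B)"])
    show "AE y in lborel. (\<lambda>n. cmod (h y - h (y - s (Suc n)))) \<longlonglongrightarrow> 0"
    proof (rule AE_I2)
      fix y
      have "isCont h (y - 0)" using h(1) by (simp add: continuous_on_eq_continuous_at)
      then have "(\<lambda>n. h (y - s (Suc n))) \<longlonglongrightarrow> h (y - 0)"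
        by (rule isCont_tendsto_compose) (intro tendsto_intros LIMSEQ_Suc[OF s0])
      then have "(\<lambda>n. cmod (h y - h (y - s (Suc n)))) \<longlonglongrightarrow> cmod (h y - h (y - 0))" by (intro tendsto_intros)
      then show "(\<lambda>n. cmod (h y - h (y - s (Suc n)))) \<longlonglongrightarrow> 0" by simp
    qed
    show "AE y in lborel. norm (cmod (h y - h (y - s (Suc n)))) \<le> indicator {-(R + 1)..R + 1} y * (2 * B)" for n
    proof (rule AE_I2)
      fix y
      show "norm (cmod (h y - h (y - s (Suc n)))) \<le> indicator {-(R + 1)..R + 1} y * (2 * B)"
      proof (cases "\<bar>y\<bar> > R + 1")
        case True
        then have "\<bar>y\<bar> > R" "\<bar>y - s (Suc n)\<bar> > R" using s1[of "Suc n"] by linarith+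
        then have "h y = 0" "h (y - s (Suc n)) = 0" by (auto intro: h(2))
        then show ?thesis by (simp add: B_def)
      next
        case False
        have "cmod (h y - h (y - s (Suc n))) \<le> 2 * B"
          using norm_triangle_ineq4[of "h y" "h (y - s (Suc n))"] hB[of y] hB[of "y - s (Suc n)"] by linarith
        then show ?thesis using False by (auto simp: abs_le_iff indicator_def)
      qed
    qed
    show "integrable lborel (\<lambda>y. indicator {-(R + 1)..R + 1} y * (2 * B))"
      by (rule integrable_indicator_interval)
  qed auto
  then have l: "(\<lambda>n. LINT y|lborel. cmod (h y - h (y - s (Suc n)))) \<longlonglongrightarrow> 0" by simp
  have le: "cmod (ft h (X n)) \<le> (LINT y|lborel. cmod (h y - h (y - s n)))" for n
  proof -
    have c: "cis (2 * pi * X n * (y - s n)) = - cis (2 * pi * X n * y)" for y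
    proof -
      have "2 * pi * X n * (y - s n) = 2 * pi * X n * y + - pi" using X0[of n] by (simp add: s_def right_diff_distrib)
      then have "cis (2 * pi * X n * (y - s n)) = cis (2 * pi * X n * y) * cis (- pi)" by (simp only: cis_mult)
      also have "cis (- pi) = - 1" by (simp add: complex_eq_iff)
      finally show ?thesis by simp
    qed
    have i: "integrable lborel (\<lambda>y. h y * cis (2 * pi * X n * y))" by (rule integrable_ft[OF hi])
    have i2: "integrable lborel (\<lambda>y. h (y - s n) * cis (2 * pi * X n * (y - s n)))" by (rule integrable_shift[OF i])
    have "ft h (X n) = (LINT y|lborel. h (y - s n) * cis (2 * pi * X n * (y - s n)))"
      unfolding ft_def by (rule LINT_shift[symmetric])
    also have "\<dots> = - (LINT y|lborel. h (y - s n) * cis (2 * pi * X n * y))"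
      unfolding c by simp
    finally have e: "ft h (X n) = - (LINT y|lborel. h (y - s n) * cis (2 * pi * X n * y))" .
    have i3: "integrable lborel (\<lambda>y. h (y - s n) * cis (2 * pi * X n * y))" using i2 unfolding c by simp
    have "2 * ft h (X n) = (LINT y|lborel. h y * cis (2 * pi * X n * y)) - (LINT y|lborel. h (y - s n) * cis (2 * pi * X n * y))"
      using e by (simp add: ft_def)
    also have "\<dots> = (LINT y|lborel. (h y - h (y - s n)) * cis (2 * pi * X n * y))"
      unfolding left_diff_distrib using i i3 by simp
    finally have "2 * cmod (ft h (X n)) = cmod (LINT y|lborel. (h y - h (y - s n)) * cis (2 * pi * X n * y))"
      by (metis norm_mult norm_numeral)
    also have "\<dots> \<le> (LINT y|lborel. cmod (h y - h (y - s n)))"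
      using integral_norm_bound[of lborel "\<lambda>y. (h y - h (y - s n)) * cis (2 * pi * X n * y)"] by (simp add: norm_mult)
    finally show ?thesis using norm_ge_zero[of "ft h (X n)"] by linarith
  qed
  have "(\<lambda>n. ft h (X (Suc n))) \<longlonglongrightarrow> 0"
    by (rule Lim_null_comparison[OF always_eventually l]) (use le in auto)
  then show ?thesis by (rule LIMSEQ_imp_Suc)
qed

text \<open>Approximation in L^1 is uniform on the transform side. A failure of the claim would give
  frequencies escaping to infinity along which the transform of the approximant stays at least
  \<open>e / 2\<close>.\<close>

lemma riemann_lebesgue:
  assumes f: "integrable lborel f" and e: "e > 0"
  obtains R where "\<And>x. \<bar>x\<bar> > R \<Longrightarrow> cmod (ft f x) < e"
proof -
  have "\<exists>R. \<forall>x. \<bar>x\<bar> > R \<longrightarrow> cmod (ft f x) < e"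
  proof (rule ccontr)
    assume "\<not> ?thesis"
    then have "\<forall>n. \<exists>x. \<bar>x\<bar> > real n \<and> cmod (ft f x) \<ge> e" by (metis not_less)
    then obtain X where X: "\<And>n. \<bar>X n\<bar> > real n" "\<And>n. cmod (ft f (X n)) \<ge> e" by metis
    have fm: "f \<in> borel_measurable borel" using f by auto
    have fi: "integrable lborel (\<lambda>x. cmod (f x) ^ 1)" using f by simp
    have e2: "e / 2 > 0" using e by simp
    obtain h R where h: "continuous_on UNIV h" "\<And>x. \<bar>x\<bar> > R \<Longrightarrow> h x = 0"
      "(LINT x|lborel. cmod (f x - h x) ^ 1) < e / 2"
      by (rule continuous_support_approx[OF fm fi zero_less_one e2]) blast
    have hi: "integrable lborel h" using L12_continuous_support[OF h(1,2)] by (simp add: L12_def)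
    have "cmod (ft f (X n)) \<le> e / 2 + cmod (ft h (X n)) " for n
    proof -
      have "cmod (ft f (X n) - ft h (X n)) \<le> e / 2"
        using norm_ft_le[OF Bochner_Integration.integrable_diff[OF f hi], of "X n"] h(3) by (simp add: ft_diff f hi)
      then show ?thesis using norm_triangle_sub[of "ft f (X n)" "ft h (X n)"] by linarith
    qed
    then have "e / 2 \<le> cmod (ft h (X n))" for n using X(2)[of n] by (smt (verit) field_sum_of_halves)
    moreover have "(\<lambda>n. cmod (ft h (X n))) \<longlonglongrightarrow> 0"
      by (rule tendsto_norm_zero[OF riemann_lebesgue_continuous_support[OF h(1,2) X(1)]])
    ultimately have "e / 2 \<le> 0" by (intro LIMSEQ_le_const[of _ 0]) auto
    then show False using e by simp
  qed
  then show thesis using that by blast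
qed

section \<open>The symbol \<open>\<omega>^2\<close> and its odd square root\<close>

locale wave_kernel =
  fixes J :: "real \<Rightarrow> real" and l :: nat
  assumes J_L1: "integrable lborel J"
    and J_nonneg: "AE x in lborel. J x \<ge> 0"
    and J_even: "AE x in lborel. J (- x) = J x"
    and J_nonzero: "\<not> (AE x in lborel. J x = 0)"
    and moments: "\<And>k. k \<le> l + 2 \<Longrightarrow> integrable lborel (\<lambda>x. \<bar>x\<bar> ^ k * J x)"
begin

definition "Jc x = complex_of_real (J x)"
text \<open>The transforms of \<open>Jc1\<close> and \<open>Jc2\<close> are the first and second
  derivatives of \<open>ft Jc\<close>.\<close>

definition "Jc1 x = 2 * pi * \<i> * (of_real x * Jc x)"
definition "Jc2 x = 2 * pi * \<i> * (of_real x * Jc1 x)"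

text \<open>This is \<open>\<omega>^2\<close>, that is, \<mu>_0 minus the transform of
  \<open>J\<close>. The real part is taken here so that the analysis of \<open>symb\<close> stays
  within real functions; evenness of \<open>J\<close> shows later that the transform is
  real.\<close>

definition "symb x = (LINT y|lborel. J y) - Re (ft Jc x)"
definition "symb1 x = - Re (ft Jc1 x)"
definition "symb2 x = - Re (ft Jc2 x)"
definition "mu2 = (LINT y|lborel. y\<^sup>2 * J y)"

lemma J_measurable [measurable]: "J \<in> borel_measurable borel"
  using J_L1 by auto

lemma integrable_Jc_power: "k \<le> l + 2 \<Longrightarrow> integrable lborel (\<lambda>y. of_real y ^ k * Jc y)"
proof (rule Bochner_Integration.integrable_bound[OF moments])
  show "AE x in lborel. norm (of_real x ^ k * Jc x) \<le> norm (\<bar>x\<bar> ^ k * J x)"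
    by (auto simp: Jc_def norm_mult norm_power abs_mult)
qed (auto simp: Jc_def)

lemma integrable_moment2: "integrable lborel (\<lambda>y. y\<^sup>2 * J y)"
  using moments[of 2] by simp

lemma integrable_Jc: "integrable lborel Jc" "integrable lborel (\<lambda>y. of_real y * Jc y)"
    "integrable lborel Jc1" "integrable lborel (\<lambda>y. of_real y * Jc1 y)" "integrable lborel Jc2"
proof -
  show 1: "integrable lborel Jc" "integrable lborel (\<lambda>y. of_real y * Jc y)"
    using integrable_Jc_power[of 0] integrable_Jc_power[of 1] by auto
  then show "integrable lborel Jc1" unfolding Jc1_def[abs_def] by (intro integrable_mult_right)
  have "integrable lborel (\<lambda>y. 2 * pi * \<i> * (of_real y ^ 2 * Jc y))"
    by (intro integrable_mult_right integrable_Jc_power) simp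
  then show 2: "integrable lborel (\<lambda>y. of_real y * Jc1 y)"
    by (simp add: Jc1_def power2_eq_square mult_ac)
  then show "integrable lborel Jc2" unfolding Jc2_def[abs_def] by (intro integrable_mult_right)
qed

lemma symb_deriv: "(symb has_real_derivative symb1 x) (at x)"
proof -
  have "(ft Jc has_vector_derivative ft Jc1 x) (at x)"
    using ft_has_vector_derivative[OF integrable_Jc(1,2)] by (simp add: Jc1_def[abs_def])
  from bounded_linear.has_vector_derivative[OF bounded_linear_Re this]
  have d: "((\<lambda>x. Re (ft Jc x)) has_real_derivative Re (ft Jc1 x)) (at x)"
    unfolding has_real_derivative_iff_has_vector_derivative .
  show ?thesis unfolding symb_def[abs_def] symb1_def using DERIV_diff[OF DERIV_const d] by simp
qed

lemma symb1_deriv: "(symb1 has_real_derivative symb2 x) (at x)"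
proof -
  have "(ft Jc1 has_vector_derivative ft Jc2 x) (at x)"
    using ft_has_vector_derivative[OF integrable_Jc(3,4)] by (simp add: Jc2_def[abs_def])
  from bounded_linear.has_vector_derivative[OF bounded_linear_Re this]
  have d: "((\<lambda>x. Re (ft Jc1 x)) has_real_derivative Re (ft Jc2 x)) (at x)"
    unfolding has_real_derivative_iff_has_vector_derivative .
  show ?thesis unfolding symb1_def[abs_def] symb2_def by (rule DERIV_minus[OF d])
qed

lemma Creg_sym2: "Creg polyb l symb2"
proof -
  have "Creg polyb l (ft Jc2)"
  proof (rule Creg_ft)
    fix k assume k: "k \<le> l"
    have "integrable lborel (\<lambda>y. (2 * pi * \<i>) * (2 * pi * \<i>) * (of_real y ^ (k + 2) * Jc y))"
      using k by (intro integrable_mult_right integrable_Jc_power) auto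
    then show "integrable lborel (\<lambda>y. of_real y ^ k * Jc2 y)"
      by (simp add: Jc2_def Jc1_def power_add power2_eq_square mult_ac)
  qed
  then have "Creg polyb l (\<lambda>x. - Re (ft Jc2 x))"
    by (intro Creg_polyb_linear[OF bounded_linear_minus[OF bounded_linear_Re]])
  then show ?thesis by (simp add: symb2_def[abs_def])
qed

lemma symb_integral:
  shows "integrable lborel (\<lambda>y. (1 - cos (2 * pi * x * y)) * J y)"
    and "symb x = (LINT y|lborel. (1 - cos (2 * pi * x * y)) * J y)"
proof -
  have e: "Re (Jc y * cis (2 * pi * x * y)) = cos (2 * pi * x * y) * J y" for y by (simp add: Jc_def)
  have i: "integrable lborel (\<lambda>y. cos (2 * pi * x * y) * J y)"
    using integrable_Re[OF integrable_ft[OF integrable_Jc(1), of x]] unfolding e .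
  then show "integrable lborel (\<lambda>y. (1 - cos (2 * pi * x * y)) * J y)"
    using J_L1 by (simp add: left_diff_distrib)
  have "Re (ft Jc x) = (LINT y|lborel. cos (2 * pi * x * y) * J y)"
    unfolding ft_def integral_Re[OF integrable_ft[OF integrable_Jc(1)], symmetric] e ..
  then show "symb x = (LINT y|lborel. (1 - cos (2 * pi * x * y)) * J y)"
    using i J_L1 by (simp add: symb_def left_diff_distrib)
qed

lemma symb1_integral:
  shows "integrable lborel (\<lambda>y. 2 * pi * y * sin (2 * pi * x * y) * J y)"
    and "symb1 x = (LINT y|lborel. 2 * pi * y * sin (2 * pi * x * y) * J y)"
proof -
  have e: "Re (Jc1 y * cis (2 * pi * x * y)) = - (2 * pi * y * sin (2 * pi * x * y) * J y)" for y
    by (simp add: Jc1_def Jc_def)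
  have i: "integrable lborel (\<lambda>y. - (2 * pi * y * sin (2 * pi * x * y) * J y))"
    using integrable_Re[OF integrable_ft[OF integrable_Jc(3), of x]] unfolding e .
  then show "integrable lborel (\<lambda>y. 2 * pi * y * sin (2 * pi * x * y) * J y)" by simp
  have "Re (ft Jc1 x) = (LINT y|lborel. - (2 * pi * y * sin (2 * pi * x * y) * J y))"
    unfolding ft_def integral_Re[OF integrable_ft[OF integrable_Jc(3)], symmetric] e ..
  then show "symb1 x = (LINT y|lborel. 2 * pi * y * sin (2 * pi * x * y) * J y)"
    by (simp add: symb1_def)
qed

lemma symb_0: "symb 0 = 0" and symb1_0: "symb1 0 = 0" and symb2_0: "symb2 0 = 4 * pi\<^sup>2 * mu2"
proof -
  show "symb 0 = 0" "symb1 0 = 0" by (simp_all add: symb_integral(2) symb1_integral(2))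
  have "ft Jc2 0 = (LINT y|lborel. complex_of_real ((- 4 * pi\<^sup>2) * (y\<^sup>2 * J y)))"
    unfolding ft_def by (intro Bochner_Integration.integral_cong)
      (auto simp: Jc2_def Jc1_def Jc_def complex_eq_iff power2_eq_square)
  also have "\<dots> = of_real (- 4 * pi\<^sup>2 * mu2)"
    unfolding integral_complex_of_real mu2_def by (subst integral_mult_right_zero) simp
  finally have "Re (ft Jc2 0) = - 4 * pi\<^sup>2 * mu2" by (simp only: Re_complex_of_real)
  then show "symb2 0 = 4 * pi\<^sup>2 * mu2" by (simp add: symb2_def)
qed

text \<open>A zero integral would force \<open>f y * J y = 0\<close> almost everywhere, hence
  \<open>J = 0\<close> outside a countable set. With the weights \<open>1\<close>,
  \<open>y^2\<close> and \<open>1 - cos\<close> it yields positivity of \<mu>_0, of \<mu>_2, and of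
  the symbol away from 0.\<close>

lemma weighted_J_pos:
  assumes i: "integrable lborel (\<lambda>y. f y * J y)" and f: "\<And>y. f y \<ge> 0" and z: "countable {y. f y = 0}"
  shows "(LINT y|lborel. f y * J y) > 0"
proof -
  have nn: "AE y in lborel. f y * J y \<ge> 0" using J_nonneg by eventually_elim (use f in auto)
  have "(LINT y|lborel. f y * J y) \<noteq> 0"
  proof
    assume "(LINT y|lborel. f y * J y) = 0"
    then have "AE y in lborel. f y * J y = 0" using integral_nonneg_eq_0_iff_AE[OF i nn] by simp
    moreover have "AE y in lborel. y \<notin> {y. f y = 0}"
      by (rule AE_not_in[OF countable_imp_null_set_lborel[OF z]])
    ultimately have "AE y in lborel. J y = 0" by eventually_elim auto
    then show False using J_nonzero by simp
  qed
  moreover have "(LINT y|lborel. f y * J y) \<ge> 0" by (rule integral_nonneg_AE[OF nn])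
  ultimately show ?thesis by linarith
qed

lemma mu0_pos: "(LINT y|lborel. J y) > 0"
  using weighted_J_pos[of "\<lambda>_. 1"] J_L1 by simp

lemma mu2_pos: "mu2 > 0"
  unfolding mu2_def by (rule weighted_J_pos[OF integrable_moment2]) auto

lemma symb_pos: "x \<noteq> 0 \<Longrightarrow> symb x > 0"
  unfolding symb_integral(2)
proof (rule weighted_J_pos[OF symb_integral(1)])
  assume x: "x \<noteq> 0"
  have "{y. 1 - cos (2 * pi * x * y) = 0} \<subseteq> range (\<lambda>n::int. of_int n / x)"
  proof
    fix y assume "y \<in> {y. 1 - cos (2 * pi * x * y) = 0}"
    then have "cos (2 * pi * x * y) = 1" by simp
    then obtain n :: int where "2 * pi * x * y = of_int n * 2 * pi" using cos_one_2pi_int by blast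
    then have "x * y = of_int n" by simp
    then show "y \<in> range (\<lambda>n::int. of_int n / x)" using x by (intro range_eqI[of _ _ n]) (simp add: field_simps)
  qed
  then show "countable {y. 1 - cos (2 * pi * x * y) = 0}" by (rule countable_subset) simp
qed simp

lemma symb_nonneg: "symb x \<ge> 0"
  using symb_pos[of x] symb_0 by (cases "x = 0") auto

lemma symb_le: "symb x \<le> 2 * (LINT y|lborel. cmod (Jc y))"
proof -
  have "(LINT y|lborel. J y) \<le> (LINT y|lborel. cmod (Jc y))"
    using J_L1 by (intro integral_mono) (auto simp: Jc_def)
  moreover have "- Re (ft Jc x) \<le> (LINT y|lborel. cmod (Jc y))"
    using norm_ft_le[OF integrable_Jc(1), of x] abs_Re_le_cmod[of "ft Jc x"] by linarith
  ultimately show ?thesis by (simp add: symb_def)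
qed

text \<open>This is the bound \<open>2 * pi * c\<close> on the derivative of \<theta>, since that
  derivative is \<open>symb1 / (2 * \<theta>)\<close>. It is Cauchy-Schwarz with weight
  \<open>J\<close>: after the double angle formula, with the cosine bounded by 1, the factors are
  \<open>y\<close> and \<open>sin (pi * x * y)\<close>, whose squares integrate to
  \<open>mu2\<close> and \<open>symb x / 2\<close>.\<close>

lemma symb1_sq_le: "(symb1 x)\<^sup>2 \<le> 8 * pi\<^sup>2 * mu2 * symb x"
proof (cases "x = 0")
  case False
  then have sp: "symb x > 0" by (rule symb_pos)
  \<comment> \<open>The parameter in 2|y||sin z| \<le> k y^2 + (sin z)^2 / k for which the two terms
    have equal integrals against \<open>J\<close>.\<close>
  define k where "k = sqrt (symb x / (2 * mu2))"
  have k: "k > 0" using sp mu2_pos by (simp add: k_def)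
  have k2: "k\<^sup>2 = symb x / (2 * mu2)" using sp mu2_pos by (simp add: k_def)
  have pt: "\<bar>2 * pi * y * sin (2 * pi * x * y)\<bar> \<le> 2 * pi * k * y\<^sup>2 + pi / k * (1 - cos (2 * pi * x * y))" for y
  proof -
    define z where "z = pi * x * y"
    have zz: "2 * pi * x * y = 2 * z" by (simp add: z_def)
    have "\<bar>2 * pi * y * sin (2 * z)\<bar> = 2 * pi * (2 * \<bar>y\<bar> * (\<bar>sin z\<bar> * \<bar>cos z\<bar>))"
      by (simp add: sin_double abs_mult)
    also have "\<dots> \<le> 2 * pi * (2 * \<bar>y\<bar> * \<bar>sin z\<bar>)"
      by (intro mult_left_mono) (auto intro: mult_right_le_one_le abs_cos_le_one)
    also have "2 * \<bar>y\<bar> * \<bar>sin z\<bar> \<le> k * y\<^sup>2 + (sin z)\<^sup>2 / k"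
    proof -
      have "0 \<le> (k * \<bar>y\<bar> - \<bar>sin z\<bar>)\<^sup>2 / k" using k by simp
      also have "\<dots> = k * y\<^sup>2 + (sin z)\<^sup>2 / k - 2 * \<bar>y\<bar> * \<bar>sin z\<bar>"
        using k by (simp add: power2_diff power_mult_distrib field_simps power2_eq_square)
      finally show ?thesis by simp
    qed
    also have "2 * pi * (k * y\<^sup>2 + (sin z)\<^sup>2 / k) = 2 * pi * k * y\<^sup>2 + pi / k * (1 - cos (2 * z))"
    proof -
      have "pi / k * (1 - cos (2 * z)) = 2 * pi * ((sin z)\<^sup>2 / k)" unfolding cos_double_sin by simp
      then show ?thesis by (simp only: distrib_left mult.assoc)
    qed
    finally show ?thesis unfolding zz by simp
  qed
  have i2: "integrable lborel (\<lambda>y. (2 * pi * k * y\<^sup>2 + pi / k * (1 - cos (2 * pi * x * y))) * J y)"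
  proof -
    have "integrable lborel (\<lambda>y. (2 * pi * k) * (y\<^sup>2 * J y) + pi / k * ((1 - cos (2 * pi * x * y)) * J y))"
      by (intro Bochner_Integration.integrable_add integrable_mult_right integrable_moment2 symb_integral(1))
    then show ?thesis by (simp add: distrib_right mult.assoc)
  qed
  have "\<bar>symb1 x\<bar> \<le> (LINT y|lborel. \<bar>2 * pi * y * sin (2 * pi * x * y) * J y\<bar>)"
    unfolding symb1_integral(2) by (rule integral_abs_bound)
  also have "\<dots> \<le> (LINT y|lborel. (2 * pi * k * y\<^sup>2 + pi / k * (1 - cos (2 * pi * x * y))) * J y)"
  proof (rule integral_mono_AE)
    show "integrable lborel (\<lambda>y. \<bar>2 * pi * y * sin (2 * pi * x * y) * J y\<bar>)"
      by (rule integrable_abs[OF symb1_integral(1)])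
    show "AE y in lborel. \<bar>2 * pi * y * sin (2 * pi * x * y) * J y\<bar> \<le> (2 * pi * k * y\<^sup>2 + pi / k * (1 - cos (2 * pi * x * y))) * J y"
      using J_nonneg
    proof eventually_elim
      fix y assume "0 \<le> J y"
      then show "\<bar>2 * pi * y * sin (2 * pi * x * y) * J y\<bar> \<le> (2 * pi * k * y\<^sup>2 + pi / k * (1 - cos (2 * pi * x * y))) * J y"
        using mult_right_mono[OF pt[of y]] by (simp add: abs_mult)
    qed
  qed (rule i2)
  also have "\<dots> = (LINT y|lborel. (2 * pi * k) * (y\<^sup>2 * J y) + pi / k * ((1 - cos (2 * pi * x * y)) * J y))"
    by (simp add: distrib_right mult.assoc)
  also have "\<dots> = 2 * pi * k * mu2 + pi / k * symb x"
    using integrable_moment2 symb_integral(1)[of x]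
    by (subst Bochner_Integration.integral_add) (auto simp: mu2_def symb_integral(2))
  also have "\<dots> = 4 * pi * k * mu2"
  proof -
    have "symb x = 2 * mu2 * k\<^sup>2" using k2 mu2_pos by simp
    then show ?thesis using k by (simp add: power2_eq_square)
  qed
  finally have "(symb1 x)\<^sup>2 \<le> (4 * pi * k * mu2)\<^sup>2"
    using power_mono[of "\<bar>symb1 x\<bar>" "4 * pi * k * mu2" 2] by simp
  also have "\<dots> = 8 * pi\<^sup>2 * mu2 * symb x"
  proof -
    have "(4 * pi * k * mu2)\<^sup>2 = 16 * pi\<^sup>2 * k\<^sup>2 * mu2\<^sup>2" by (simp add: power_mult_distrib)
    also have "\<dots> = 8 * pi\<^sup>2 * mu2 * symb x"
      unfolding k2 using mu2_pos by (simp add: power2_eq_square[of mu2])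
    finally show ?thesis .
  qed
  finally show ?thesis .
qed (simp add: symb_0 symb1_0)

text \<open>
  By Taylor's formula, \<open>hq\<close> and \<open>Aq\<close> are the quotients of \<open>symb\<close> by \<open>x\<^sup>2\<close> and of its derivative
  \<open>symb1\<close> by \<open>x\<close>; in this form they visibly have \<open>l\<close> derivatives at \<open>0\<close> as well.
\<close>

definition "hq x = integral {0..1} (\<lambda>r. (1 - r) * symb2 (r * x))"
definition "Aq x = integral {0..1} (\<lambda>r. 1 * symb2 (r * x))"

lemma symb_eq_hq: "symb x = x\<^sup>2 * hq x" and symb1_eq_Aq: "symb1 x = x * Aq x"
proof -
  have c: "((\<lambda>r. r * x) has_real_derivative x) (at r)" for r by (auto intro!: derivative_eq_intros)
  have d1: "((\<lambda>r. symb1 (r * x)) has_real_derivative symb2 (r * x) * x) (at r)" for r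
    by (rule DERIV_chain2[OF symb1_deriv c])
  have d0: "((\<lambda>r. symb (r * x)) has_real_derivative symb1 (r * x) * x) (at r)" for r
    by (rule DERIV_chain2[OF symb_deriv c])
  have "((\<lambda>r. symb2 (r * x) * x) has_integral symb1 (1 * x) - symb1 (0 * x)) {0..1}"
    by (rule fundamental_theorem_of_calculus)
       (auto intro: has_vector_derivative_at_within d1[unfolded has_real_derivative_iff_has_vector_derivative])
  then have "integral {0..1} (\<lambda>r. symb2 (r * x) * x) = symb1 x" by (intro integral_unique) (simp add: symb1_0)
  then show "symb1 x = x * Aq x" by (simp add: Aq_def mult.commute)
  \<comment> \<open>An antiderivative for Taylor's remainder: its value at \<open>r = 1\<close> is
    \<open>symb x\<close>, and at \<open>r = 0\<close> it vanishes together with \<open>symb\<close>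
    and \<open>symb1\<close>.\<close>
  have "((\<lambda>r. (1 - r) * (x * symb1 (r * x)) + symb (r * x)) has_real_derivative (1 - r) * (x\<^sup>2 * symb2 (r * x))) (at r)" for r
    by (auto intro!: derivative_eq_intros d1 d0 simp: power2_eq_square algebra_simps)
  then have "((\<lambda>r. (1 - r) * (x\<^sup>2 * symb2 (r * x))) has_integral
      ((1 - 1) * (x * symb1 (1 * x)) + symb (1 * x)) - ((1 - 0) * (x * symb1 (0 * x)) + symb (0 * x))) {0..1}"
    by (intro fundamental_theorem_of_calculus) (auto intro: has_vector_derivative_at_within simp: has_real_derivative_iff_has_vector_derivative)
  then have "integral {0..1} (\<lambda>r. (1 - r) * (x\<^sup>2 * symb2 (r * x))) = symb x" by (simp add: integral_unique symb1_0 symb_0)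
  moreover have "integral {0..1} (\<lambda>r. (1 - r) * (x\<^sup>2 * symb2 (r * x))) = integral {0..1} (\<lambda>r. x\<^sup>2 * ((1 - r) * symb2 (r * x)))"
    by (intro arg_cong[where f = "integral {0..1}"]) (auto simp: fun_eq_iff)
  ultimately show "symb x = x\<^sup>2 * hq x" by (simp add: hq_def)
qed

lemma Creg_hq: "Creg polyb l hq" and Creg_Aq: "Creg polyb l Aq"
  unfolding hq_def[abs_def] Aq_def[abs_def]
  by (intro Creg_average Creg_sym2 continuous_intros)+

lemma hq_0: "hq 0 = 2 * pi\<^sup>2 * mu2" and Aq_0: "Aq 0 = 4 * pi\<^sup>2 * mu2"
proof -
  have "((\<lambda>r::real. 1 - r) has_integral (1 - 1\<^sup>2 / 2) - (0 - 0\<^sup>2 / 2)) {0..1}"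
    by (rule fundamental_theorem_of_calculus)
       (auto intro!: derivative_eq_intros simp: has_real_derivative_iff_has_vector_derivative[symmetric])
  then have "integral {0..1} (\<lambda>r::real. 1 - r) = 1 / 2" by (simp add: integral_unique)
  then show "hq 0 = 2 * pi\<^sup>2 * mu2" by (simp add: hq_def symb2_0)
  show "Aq 0 = 4 * pi\<^sup>2 * mu2" by (simp add: Aq_def symb2_0)
qed

lemma hq_pos: "hq x > 0"
proof (cases "x = 0")
  case False
  then have "x\<^sup>2 * hq x > 0" using symb_pos symb_eq_hq by simp
  then show ?thesis using False by (simp add: zero_less_mult_iff)
qed (simp add: hq_0 mu2_pos)

text \<open>On a compact interval continuity and positivity suffice. Far out, the Riemann-Lebesgue
  lemma keeps \<open>symb\<close> above half of \<mu>_0, so the reciprocal of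
  \<open>hq x = symb x / x^2\<close> grows at most quadratically.\<close>

lemma polyb_inverse_hq: "polyb (\<lambda>x. 1 / hq x)"
proof -
  let ?m = "LINT y|lborel. J y"
  obtain R0 where R0: "\<And>x. \<bar>x\<bar> > R0 \<Longrightarrow> cmod (ft Jc x) < ?m / 2"
    using riemann_lebesgue[OF integrable_Jc(1), of "?m / 2"] mu0_pos by auto
  define R where "R = max R0 0"
  have "continuous_on {-R..R} (\<lambda>x. 1 / hq x)"
    by (intro continuous_intros continuous_on_subset[OF Creg_continuous[OF Creg_hq]]) (auto simp: hq_pos less_imp_neq[OF hq_pos, symmetric])
  then have "bounded ((\<lambda>x. 1 / hq x) ` {-R..R})"
    by (intro compact_imp_bounded compact_continuous_image) auto
  then obtain B where B: "\<And>x. x \<in> {-R..R} \<Longrightarrow> \<bar>1 / hq x\<bar> \<le> B" unfolding bounded_iff by (metis imageI real_norm_def)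
  have z: "0 \<in> {-R..R}" by (simp add: R_def)
  have B0: "B \<ge> 0" by (rule order_trans[OF abs_ge_zero B[OF z]])
  have "norm (1 / hq x) \<le> norm (B + 2 / ?m * x\<^sup>2)" for x
  proof (cases "\<bar>x\<bar> \<le> R")
    case True
    then have "\<bar>1 / hq x\<bar> \<le> B" by (intro B) auto
    moreover have "2 / ?m * x\<^sup>2 \<ge> 0" using mu0_pos by simp
    ultimately show ?thesis using B0 by simp
  next
    case False
    then have x: "\<bar>x\<bar> > R0" "x \<noteq> 0" by (auto simp: R_def)
    have "Re (ft Jc x) \<le> ?m / 2" using R0[OF x(1)] complex_Re_le_cmod[of "ft Jc x"] by linarith
    then have "x\<^sup>2 * hq x \<ge> ?m / 2" unfolding symb_eq_hq[symmetric] symb_def by (simp add: field_simps)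
    then have "1 / hq x \<le> 2 / ?m * x\<^sup>2" using hq_pos[of x] mu0_pos by (simp add: field_simps)
    then show ?thesis using B0 hq_pos[of x] mu0_pos by simp
  qed
  moreover have "polyb (\<lambda>x. B + 2 / ?m * x\<^sup>2)"
    by (intro polyb_add polyb_mult polyb_power polyb_ident) (auto intro: polyb_bounded[OF order_refl])
  ultimately show ?thesis by (rule polyb_le[rotated])
qed

text \<open>
  \<open>\<theta>\<close> is \<open>2 \<pi> c \<psi>\<close> in the notation of the paper.  Its derivative is written without the
  derivative of \<open>hq\<close>, so that \<open>\<theta>\<close> has one derivative more than \<open>hq\<close>.
\<close>

definition "\<omega> x = sqrt (symb x)"
definition "\<theta> x = x * sqrt (hq x)"
definition "\<theta>' x = Aq x * (1 / 2) * hq x powr (- 1 / 2)"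

lemma theta_eq: "\<theta> x = sgn x * \<omega> x"
proof -
  have "\<omega> x = \<bar>x\<bar> * sqrt (hq x)" by (simp add: \<omega>_def symb_eq_hq real_sqrt_mult)
  then show ?thesis by (simp add: \<theta>_def sgn_if)
qed

lemma omega_sq: "\<omega> x * \<omega> x = symb x"
  using symb_nonneg by (simp add: \<omega>_def)

lemma omega_pos: "x \<noteq> 0 \<Longrightarrow> \<omega> x > 0"
  using symb_pos by (simp add: \<omega>_def)

lemma omega_measurable [measurable]: "\<omega> \<in> borel_measurable borel"
proof -
  have "continuous_on UNIV symb"
    using symb_deriv DERIV_isCont by (intro continuous_at_imp_continuous_on) blast
  then show ?thesis
    unfolding \<omega>_def[abs_def] by (intro borel_measurable_continuous_onI continuous_intros)
qed

lemma omega_bounded: "\<bar>\<omega> x\<bar> \<le> sqrt (2 * (LINT y|lborel. cmod (Jc y)))"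
  using symb_le[of x] symb_nonneg[of x] by (simp add: \<omega>_def)

lemma theta'_eq: "\<theta>' x = Aq x / (2 * sqrt (hq x))"
  using hq_pos[of x] by (simp add: \<theta>'_def powr_minus_divide powr_half_sqrt)

lemma Creg_theta': "Creg polyb l \<theta>'"
  unfolding \<theta>'_def[abs_def]
  by (intro Creg_polyb_mult Creg_Aq Creg_polyb_const Creg_powr hq_pos polyb_inverse_hq Creg_hq)

lemma theta'_0_eq: "\<theta>' 0 = sqrt (hq 0)"
proof -
  define q where "q = sqrt (hq 0)"
  have q: "q > 0" using hq_pos[of 0] by (simp add: q_def)
  have "q * q = hq 0" using hq_pos[of 0] by (simp add: q_def)
  then have "Aq 0 = 2 * (q * q)" by (simp add: hq_0 Aq_0)
  then have "\<theta>' 0 = 2 * (q * q) / (2 * q)" by (simp only: theta'_eq q_def)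
  also have "\<dots> = q" using q by simp
  finally show ?thesis by (simp only: q_def)
qed

lemma theta'_0: "\<theta>' 0 = 2 * pi * sqrt (mu2 / 2)"
proof -
  have "sqrt (2 * pi\<^sup>2 * mu2) = 2 * pi * sqrt (mu2 / 2)"
    by (rule real_sqrt_unique) (use mu2_pos in \<open>auto simp: power_mult_distrib\<close>)
  then show ?thesis by (simp only: theta'_0_eq hq_0)
qed

text \<open>At 0 the difference quotient is \<open>sqrt (hq h)\<close> itself, so continuity of
  \<open>hq\<close> is enough. Elsewhere \<theta> is locally a constant sign times
  \<open>sqrt (symb x)\<close>, and the derivative of \<open>symb\<close> is used.\<close>

lemma theta_deriv: "(\<theta> has_real_derivative \<theta>' x) (at x)"
proof (cases "x = 0")
  case True
  have "isCont hq 0" using Creg_continuous[OF Creg_hq] by (simp add: continuous_on_eq_continuous_at)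
  then have "isCont (\<lambda>x. sqrt (hq x)) 0" by (intro continuous_intros)
  then have "(\<lambda>h. sqrt (hq h)) \<midarrow>0\<rightarrow> sqrt (hq 0)" by (simp add: isCont_def)
  then have "(\<lambda>h. (\<theta> (0 + h) - \<theta> 0) / h) \<midarrow>0\<rightarrow> sqrt (hq 0)"
    by (rule Lim_transform_eventually) (auto simp: \<theta>_def eventually_at_filter)
  then show ?thesis unfolding True DERIV_def by (simp only: theta'_0_eq)
next
  case False
  have s: "symb x > 0" by (rule symb_pos[OF False])
  have d: "((\<lambda>x. sgn y * sqrt (symb x)) has_real_derivative sgn y * (symb1 x * (inverse (sqrt (symb x)) / 2))) (at x)" for y
    using s by (auto intro!: derivative_eq_intros symb_deriv)
  have "(\<theta> has_real_derivative sgn x * (symb1 x * (inverse (sqrt (symb x)) / 2))) (at x)"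
  proof (rule has_field_derivative_transform_within_open[OF d[of x], of "if x > 0 then {0<..} else {..<0}"])
    show "sgn x * sqrt (symb y) = \<theta> y" if "y \<in> (if x > 0 then {0<..} else {..<0})" for y
      using that False unfolding theta_eq \<omega>_def by (auto split: if_splits)
  qed (use False in auto)
  moreover have "sgn x * (symb1 x * (inverse (sqrt (symb x)) / 2)) = \<theta>' x"
  proof -
    have "sqrt (symb x) = \<bar>x\<bar> * sqrt (hq x)" by (simp add: symb_eq_hq real_sqrt_mult)
    then show ?thesis
      using False hq_pos[of x] by (simp add: theta'_eq symb1_eq_Aq sgn_if abs_if field_simps)
  qed
  ultimately show ?thesis by simp
qed

text \<open>\<open>symb1_sq_le\<close> divided by \<open>x^2\<close>. The bound is attained at 0, so
  low frequencies travel at the limiting speed.\<close>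

lemma theta'_le: "\<bar>\<theta>' x\<bar> \<le> 2 * pi * sqrt (mu2 / 2)"
proof (cases "x = 0")
  case False
  have "(x * Aq x)\<^sup>2 \<le> 8 * pi\<^sup>2 * mu2 * (x\<^sup>2 * hq x)"
    using symb1_sq_le[of x] by (simp add: symb1_eq_Aq symb_eq_hq)
  then have "x\<^sup>2 * (Aq x)\<^sup>2 \<le> x\<^sup>2 * (8 * pi\<^sup>2 * mu2 * hq x)" by (simp add: power_mult_distrib mult_ac)
  then have A: "(Aq x)\<^sup>2 \<le> 8 * pi\<^sup>2 * mu2 * hq x" using False by simp
  have "(\<theta>' x)\<^sup>2 = (Aq x)\<^sup>2 / (4 * hq x)"
    using hq_pos[of x] by (simp add: theta'_eq power_divide power_mult_distrib)
  also have "\<dots> \<le> 2 * pi\<^sup>2 * mu2" using A hq_pos[of x] by (simp add: field_simps)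
  also have "\<dots> = (2 * pi * sqrt (mu2 / 2))\<^sup>2" using mu2_pos by (simp add: power_mult_distrib)
  finally have "\<bar>\<theta>' x\<bar>\<^sup>2 \<le> (2 * pi * sqrt (mu2 / 2))\<^sup>2" by simp
  then show ?thesis by (rule power2_le_imp_le) (use mu2_pos in auto)
qed (use mu2_pos in \<open>simp add: theta'_0\<close>)

lemma theta_bounded: "\<bar>\<theta> x\<bar> \<le> sqrt (2 * (LINT y|lborel. cmod (Jc y)))"
  using omega_bounded[of x] order_trans[OF abs_ge_zero omega_bounded[of x]]
  by (auto simp: theta_eq abs_mult sgn_if)

lemma Creg_theta: "Creg polyb l \<theta>"
proof -
  have "Creg polyb (Suc l) \<theta>"
    by (rule Creg_SucI[where P = polyb and f = \<theta>, OF polyb_bounded _ Creg_theta'])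
       (use theta_bounded theta_deriv in \<open>auto simp: has_real_derivative_iff_has_vector_derivative\<close>)
  then show ?thesis by (rule Creg_Suc)
qed

end

section \<open>Dilations and weak derivatives of transforms\<close>

lemma scale_ft:
  assumes r: "r > 0"
  shows "ft (\<lambda>y. of_real r * b (r * y)) x = ft b (inverse r * x)"
proof -
  have "ft b (inverse r * x) = r *\<^sub>R (LINT y|lborel. b (0 + r * y) * cis (2 * pi * (inverse r * x) * (0 + r * y)))"
    unfolding ft_def using lborel_integral_real_affine[of r "\<lambda>y. b y * cis (2 * pi * (inverse r * x) * y)" 0] r by simp
  also have "\<dots> = (LINT y|lborel. r *\<^sub>R (b (0 + r * y) * cis (2 * pi * (inverse r * x) * (0 + r * y))))"
    by (rule integral_scaleR_right[symmetric])
  also have "\<dots> = ft (\<lambda>y. of_real r * b (r * y)) x"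
  proof -
    have "2 * (pi * (inverse r * (x * (r * y)))) = 2 * (pi * (x * y))" for y using r by simp
    then show ?thesis unfolding ft_def by (simp only: scaleR_conv_of_real add_0_left mult.assoc)
  qed
  finally show ?thesis by simp
qed

lemma L12_scale:
  assumes "L12 b" "r \<noteq> 0"
  shows "L12 (\<lambda>y. of_real r * b (r * y))"
proof -
  have "L12 (\<lambda>y. b (0 + r * y))"
    using assms lborel_integrable_real_affine[of b r 0] square_integrable_affine[of b r 0] by (simp add: L12_def)
  then show ?thesis using L12_cmult[of "\<lambda>y. b (0 + r * y)" "of_real r"] by simp
qed

lemma dilate_FT:
  assumes b: "L12 b" and r: "r > 0"
  shows "dilate r (FT b) = FT (\<lambda>y. of_real r * b (r * y))"
  using r square_integrable_ft[OF b] by (simp add: FT_def abs_l2_dilate scale_ft[OF r, abs_def])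

lemma rapid_compact_support:
  assumes f: "continuous_on UNIV f" and K: "\<And>x::real. \<bar>x\<bar> > K \<Longrightarrow> f x = 0"
  shows "rapid f"
  unfolding rapid_def
proof
  fix N
  have "continuous_on {-K..K} (\<lambda>x. (1 + \<bar>x\<bar>) ^ N * norm (f x))"
    by (intro continuous_intros continuous_on_subset[OF f]) auto
  then have "bounded ((\<lambda>x. (1 + \<bar>x\<bar>) ^ N * norm (f x)) ` {-K..K})"
    by (intro compact_imp_bounded compact_continuous_image) auto
  then obtain B where B: "\<forall>y\<in>(\<lambda>x. (1 + \<bar>x\<bar>) ^ N * norm (f x)) ` {-K..K}. norm y \<le> B" unfolding bounded_iff by blast
  have "(1 + \<bar>x\<bar>) ^ N * norm (f x) \<le> max B 0" for x
  proof (cases "\<bar>x\<bar> > K")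
    case False
    then have "x \<in> {-K..K}" by auto
    then have "norm ((1 + \<bar>x\<bar>) ^ N * norm (f x)) \<le> B" using B by blast
    then show ?thesis by (simp add: abs_mult)
  qed (simp add: K)
  then show "\<exists>C. \<forall>x. (1 + \<bar>x\<bar>) ^ N * norm (f x) \<le> C" by blast
qed

text \<open>Supplies vectors to which the scaling axiom applies. The product of \<open>ft a\<close>
  with the test function is differentiated, and the integral of the result vanishes because the test
  function has bounded support.\<close>

lemma FT_weak_derivative:
  assumes a: "L12 a" and b: "L12 (\<lambda>y. of_real y * a y)"
  shows "has_weak_derivative (FT a) (FT (\<lambda>y. 2 * pi * \<i> * (of_real y * a y)))"
  unfolding has_weak_derivative_def
proof (intro allI impI)
  let ?b = "\<lambda>y. 2 * pi * \<i> * (of_real y * a y)"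
  fix f assume "test_function f"
  then obtain d K where d: "derivs_of f d" and K: "\<And>x. \<bar>x\<bar> > K \<Longrightarrow> f x = 0"
    unfolding test_function_def by blast
  have b': "L12 ?b" by (rule L12_cmult[OF b])
  have ai: "integrable lborel a" and bi: "integrable lborel ?b" using a b' by (auto simp: L12_def)
  have fd: "(f has_vector_derivative d 1 x) (at x)" and d1: "(d 1 has_vector_derivative d 2 x) (at x)" for x
    using d unfolding derivs_of_def by (auto simp: numeral_2_eq_2)
  have fc: "continuous_on UNIV f"
    by (rule continuous_at_imp_continuous_on) (intro ballI has_vector_derivative_continuous[OF fd])
  have dc: "continuous_on UNIV (d 1)"
    by (rule continuous_at_imp_continuous_on) (intro ballI has_vector_derivative_continuous[OF d1])
  \<comment> \<open>The set |y| > K is open, so the test function is locally constant there.\<close>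
  have dz: "d 1 x = 0" if "\<bar>x\<bar> > K" for x
  proof -
    have "\<forall>\<^sub>F y in nhds x. \<bar>y\<bar> > K"
    proof -
      have "open {y. \<bar>y\<bar> > K}" by (intro open_Collect_less continuous_intros)
      then show ?thesis using that by (auto simp: eventually_nhds)
    qed
    then have "\<forall>\<^sub>F y in at x. 0 = f y"
      unfolding eventually_at_filter by (rule eventually_mono) (auto simp: K)
    then have "(f has_vector_derivative 0) (at x)"
      unfolding has_vector_derivative_def
      by (intro has_derivative_transform_eventually[of "\<lambda>_. 0" "\<lambda>x. x *\<^sub>R 0" x UNIV f])
         (auto simp: K that)
    then show ?thesis using fd vector_derivative_unique_at by blast
  qed
  have vd: "vector_derivative f (at x) = d 1 x" for x by (rule vector_derivative_at[OF fd])
  have ra: "AE x in lborel. rep_l2 (FT a) x = ft a x" and rb: "AE x in lborel. rep_l2 (FT ?b) x = ft ?b x"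
    unfolding FT_def by (rule rep_abs_l2[OF square_integrable_ft], fact)+
  have m: "rep_l2 w \<in> borel_measurable borel" for w
    using square_integrable_rep[of w] by (simp add: square_integrable_def)
  have fm: "f \<in> borel_measurable borel" "d 1 \<in> borel_measurable borel"
    by (intro borel_measurable_continuous_onI fc dc)+
  have fr: "rapid f" "rapid (d 1)" using rapid_compact_support[OF fc K] rapid_compact_support[OF dc dz] by auto
  have pa: "polyb (ft a)" "polyb (ft ?b)" by (rule polyb_bounded[OF norm_ft_le], fact)+
  have cts: "continuous_on UNIV (ft a)" "continuous_on UNIV (ft ?b)" by (rule continuous_ft, fact)+
  have i: "integrable lborel (\<lambda>x. ft a x * d 1 x)" "integrable lborel (\<lambda>x. ft ?b x * f x)"
    by (intro rapid_integrable polyb_mult_rapid pa fr borel_measurable_continuous_onI continuous_intros cts fc dc)+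
  have "(LINT x|lborel. ft a x * d 1 x + ft ?b x * f x) = 0"
  proof (rule integral_derivative_zero)
    show "((\<lambda>x. ft a x * f x) has_vector_derivative ft a x * d 1 x + ft ?b x * f x) (at x)" for x
      using b by (intro has_vector_derivative_mult fd ft_has_vector_derivative ai) (simp add: L12_def)
  qed (intro continuous_intros cts fc dc Bochner_Integration.integrable_add i polyb_mult_rapid pa fr)+
  then have e: "(LINT x|lborel. ft a x * d 1 x) = - (LINT x|lborel. ft ?b x * f x)"
    using i by (simp add: add_eq_0_iff2)
  have "(LINT x|lborel. rep_l2 (FT a) x * vector_derivative f (at x)) = (LINT x|lborel. ft a x * d 1 x)"
    unfolding vd by (rule integral_cong_AE) (use ra m fm ai in \<open>auto elim!: eventually_mono\<close>)
  moreover have "(LINT x|lborel. rep_l2 (FT ?b) x * f x) = (LINT x|lborel. ft ?b x * f x)"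
    by (rule integral_cong_AE) (use rb m fm bi in \<open>auto elim!: eventually_mono\<close>)
  ultimately show "(LINT x|lborel. rep_l2 (FT a) x * vector_derivative f (at x)) = - (LINT x|lborel. rep_l2 (FT ?b) x * f x)"
    using e by simp
qed

section \<open>From the axioms for \<open>c\<close> and \<open>D\<close> to a multiplier and a
  speed\<close>

context wave_kernel
begin

text \<open>Reflection shows that \<open>ft Jc\<close> is even, by evenness of \<open>J\<close>, and
  conjugation that it is then real.\<close>

lemma ft_Jc: "ft Jc x = of_real ((LINT y|lborel. J y) - symb x)"
proof -
  have "ft Jc (- x) = (LINT y|lborel. Jc (0 - y) * cis (2 * pi * (- x) * (0 - y)))"
    unfolding ft_def by (rule LINT_reflect[symmetric])
  also have "\<dots> = (LINT y|lborel. Jc y * cis (2 * pi * x * y))"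
    by (rule integral_cong_AE) (use J_even in \<open>auto simp: Jc_def elim!: eventually_mono\<close>)
  finally have 1: "ft Jc (- x) = ft Jc x" by (simp add: ft_def)
  have "cnj (ft Jc x) = ft Jc (- x)"
    unfolding ft_def Bochner_Integration.integral_cnj[symmetric]
    by (intro Bochner_Integration.integral_cong) (auto simp: Jc_def cis_cnj)
  then have "Im (ft Jc x) = 0" unfolding 1 by (simp add: complex_eq_iff)
  then show ?thesis by (simp add: complex_eq_iff symb_def)
qed

text \<open>The convolution theorem, at every point \<open>x\<close>. Fubini applies with the
  integrable dominating factors \<open>Jc (x - y)\<close> and \<open>a \<xi>\<close>; the final
  reflection uses that \<open>ft Jc\<close> is even.\<close>

lemma conv_FT:
  assumes a: "L12 a"
  shows "conv J (FT a) x = ft (\<lambda>\<xi>. ft Jc \<xi> * a \<xi>) x"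
proof -
  have ai: "integrable lborel a" using a by (simp add: L12_def)
  have [measurable]: "a \<in> borel_measurable borel" "Jc \<in> borel_measurable borel" using ai integrable_Jc(1) by auto
  have ra: "AE y in lborel. rep_l2 (FT a) y = ft a y"
    unfolding FT_def by (rule rep_abs_l2[OF square_integrable_ft[OF a]])
  have [measurable]: "rep_l2 (FT a) \<in> borel_measurable borel" "ft a \<in> borel_measurable borel"
    using square_integrable_rep[of "FT a"] ai by (auto simp: square_integrable_def)
  have Ji: "integrable lborel (\<lambda>y. Jc (x - y))" by (rule integrable_reflect[OF integrable_Jc(1)])
  have "conv J (FT a) x = (LINT y|lborel. Jc (x - y) * ft a y)"
    unfolding conv_def by (rule integral_cong_AE) (use ra in \<open>auto simp: Jc_def scaleR_conv_of_real elim!: eventually_mono\<close>)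
  also have "\<dots> = (LINT y|lborel. LINT \<xi>|lborel. Jc (x - y) * (a \<xi> * cis (2 * pi * y * \<xi>)))"
    unfolding ft_def by (simp only: integral_mult_right_zero)
  also have "\<dots> = (LINT \<xi>|lborel. LINT y|lborel. Jc (x - y) * (a \<xi> * cis (2 * pi * y * \<xi>)))"
    by (rule Fubini_dominated[OF _ Ji ai]) (auto simp: norm_mult)
  also have "\<dots> = (LINT \<xi>|lborel. LINT s|lborel. Jc s * (a \<xi> * cis (2 * pi * (x - s) * \<xi>)))"
  proof (rule Bochner_Integration.integral_cong[OF refl])
    fix \<xi>
    show "(LINT y|lborel. Jc (x - y) * (a \<xi> * cis (2 * pi * y * \<xi>))) = (LINT s|lborel. Jc s * (a \<xi> * cis (2 * pi * (x - s) * \<xi>)))"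
      using LINT_reflect[of "\<lambda>s. Jc s * (a \<xi> * cis (2 * pi * (x - s) * \<xi>))" x] by simp
  qed
  also have "\<dots> = (LINT \<xi>|lborel. LINT s|lborel. (a \<xi> * cis (2 * pi * x * \<xi>)) * (Jc s * cis (2 * pi * (- \<xi>) * s)))"
    by (intro Bochner_Integration.integral_cong)
       (auto simp: cis_mult left_diff_distrib right_diff_distrib mult_ac)
  also have "\<dots> = (LINT \<xi>|lborel. (a \<xi> * cis (2 * pi * x * \<xi>)) * ft Jc (- \<xi>))"
    unfolding ft_def by (simp only: integral_mult_right_zero)
  also have "\<dots> = (LINT \<xi>|lborel. ft Jc \<xi> * a \<xi> * cis (2 * pi * x * \<xi>))"
  proof -
    have "ft Jc (- \<xi>) = ft Jc \<xi>" for \<xi>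
      using symb_integral(2)[of \<xi>] symb_integral(2)[of "- \<xi>"] by (simp add: ft_Jc)
    then show ?thesis by (simp add: mult_ac)
  qed
  finally show ?thesis by (simp add: ft_def)
qed

lemma L12_omega: "L12 a \<Longrightarrow> L12 (\<lambda>x. of_real (\<omega> x) * a x)"
  by (rule L12_mult_bounded[where B = "sqrt (2 * (LINT y|lborel. cmod (Jc y)))"]) (use omega_bounded in auto)

lemma theta_measurable [measurable]: "\<theta> \<in> borel_measurable borel"
  by (rule Creg_measurable[OF Creg_theta])

lemma L12_theta: "L12 a \<Longrightarrow> L12 (\<lambda>x. \<i> * of_real (\<theta> x) * a x)"
  by (rule L12_mult_bounded[where B = "sqrt (2 * (LINT y|lborel. cmod (Jc y)))"]) (use theta_bounded in \<open>auto simp: norm_mult\<close>)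

text \<open>Axiom (1) as an identity in L^2. The form with an arbitrary \<open>z\<close> serves both
  on transforms, where \<open>z\<close> is computed, and along a solution, where \<open>z\<close> is
  its second time derivative.\<close>

lemma associated_square:
  assumes D: "associated J c D"
  shows "c\<^sup>2 *\<^sub>R D (D w) = z \<longleftrightarrow> (AE x in lborel. rep_l2 z x + moment J 0 *\<^sub>R rep_l2 w x = conv J w x)"
proof -
  have 1: "AE x in lborel. conv J w x - moment J 0 *\<^sub>R rep_l2 w x = c\<^sup>2 *\<^sub>R rep_l2 (D (D w)) x"
    using D unfolding associated_def by blast
  have sc: "AE x in lborel. rep_l2 (c\<^sup>2 *\<^sub>R D (D w)) x = c\<^sup>2 *\<^sub>R rep_l2 (D (D w)) x"
  proof -
    have "c\<^sup>2 *\<^sub>R D (D w) = abs_l2 (\<lambda>x. complex_of_real (c\<^sup>2) * rep_l2 (D (D w)) x)"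
      using abs_l2_scaleR[OF square_integrable_rep, of "c\<^sup>2" "D (D w)"] by (simp add: abs_rep_l2)
    then show ?thesis
      using rep_abs_l2[OF square_integrable_cmult[OF square_integrable_rep], of "complex_of_real (c\<^sup>2)" "D (D w)"]
      by (simp add: scaleR_conv_of_real)
  qed
  have 2: "AE x in lborel. rep_l2 (c\<^sup>2 *\<^sub>R D (D w)) x + moment J 0 *\<^sub>R rep_l2 w x = conv J w x"
    using 1 sc by eventually_elim (simp add: algebra_simps)
  show ?thesis
  proof
    assume "AE x in lborel. rep_l2 z x + moment J 0 *\<^sub>R rep_l2 w x = conv J w x"
    with 2 have "AE x in lborel. rep_l2 (c\<^sup>2 *\<^sub>R D (D w)) x = rep_l2 z x"
      by eventually_elim (metis add_right_cancel)
    then show "c\<^sup>2 *\<^sub>R D (D w) = z" by (rule l2_eqI)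
  qed (use 2 in auto)
qed

lemma associated_square_FT:
  assumes D: "associated J c D" and a: "L12 a"
  shows "c\<^sup>2 *\<^sub>R D (D (FT a)) = - FT (\<lambda>x. of_real (\<omega> x) * (of_real (\<omega> x) * a x))"
  unfolding associated_square[OF D]
proof -
  let ?W = "\<lambda>x. of_real (\<omega> x) * (of_real (\<omega> x) * a x)"
  have W: "L12 ?W" by (intro L12_omega a)
  have mu: "moment J 0 = (LINT y|lborel. J y)" by (simp add: moment_def)
  have e: "(\<lambda>\<xi>. ft Jc \<xi> * a \<xi>) = (\<lambda>\<xi>. of_real (LINT y|lborel. J y) * a \<xi> - ?W \<xi>)"
    by (auto simp: fun_eq_iff ft_Jc left_diff_distrib mult.assoc[symmetric] simp flip: omega_sq)
  have "conv J (FT a) x = of_real (LINT y|lborel. J y) * ft a x - ft ?W x" for x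
    unfolding conv_FT[OF a] e
    using ft_diff[OF L12_integrable[OF L12_cmult[OF a]] L12_integrable[OF W], of "of_real (LINT y|lborel. J y)"]
    by (simp add: ft_cmult)
  moreover have "AE x in lborel. rep_l2 (FT a) x = ft a x"
    unfolding FT_def by (rule rep_abs_l2[OF square_integrable_ft[OF a]])
  moreover have "AE x in lborel. rep_l2 (- FT ?W) x = - ft ?W x"
  proof -
    have "square_integrable (\<lambda>x. - ft ?W x)"
      using square_integrable_cmult[OF square_integrable_ft[OF W], of "-1"] by simp
    then show ?thesis
      unfolding FT_def abs_l2_uminus[OF square_integrable_ft[OF W]] by (rule rep_abs_l2)
  qed
  ultimately show "AE x in lborel. rep_l2 (- FT ?W) x + moment J 0 *\<^sub>R rep_l2 (FT a) x = conv J (FT a) x"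
    by (auto simp: mu scaleR_conv_of_real elim!: eventually_elim2)
qed

text \<open>\<open>HD\<close> is evaluated at \<open>w = D (FT a)\<close>: then \<open>D w\<close>
  is explicit by axiom (1), so \<open>hilbert (D w)\<close> is explicit too, and only the second
  argument of the inner product still contains \<open>D\<close>. This is the positivity premise of
  \<open>symbol_identification\<close> for \<open>c D\<close>.\<close>

lemma associated_symbol:
  assumes D: "associated J c D" and a: "L12 a"
  shows "c *\<^sub>R D (FT a) = FT (\<lambda>x. \<i> * of_real (\<theta> x) * a x)"
proof -
  have c: "c > 0" and bD: "bounded_operator D" and ti: "translation_invariant D"
    and pos: "\<And>w. cinner (hilbert (D w)) w \<in> \<real>\<^sub>\<ge>\<^sub>0"
    using D unfolding associated_def positive_operator_def by auto
  let ?M = "\<lambda>w. c *\<^sub>R D w"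
  have bM: "bounded_operator ?M"
    unfolding bounded_operator_def
  proof
    show "bounded_linear ?M"
      using bD unfolding bounded_operator_def by (intro bounded_linear_compose[OF bounded_linear_scaleR_right]) simp
    show "\<forall>z w. ?M (scaleC z w) = scaleC z (?M w)"
      unfolding scaleC_of_real[symmetric] by (simp add: bounded_operatorD[OF bD] scaleC_scaleC mult.commute)
  qed
  have tr: "translate s (r *\<^sub>R w) = r *\<^sub>R translate s w" for s r w
  proof (rule l2_abs_cases[of w])
    fix f assume f: "square_integrable f" "w = abs_l2 f"
    have "square_integrable (\<lambda>x. f (x - s))" using square_integrable_affine[of f 1 "-s"] f by simp
    then show ?thesis using f by (simp add: abs_l2_translate abs_l2_scaleR square_integrable_cmult)
  qed
  have tM: "translation_invariant ?M" using ti by (simp add: translation_invariant_def tr)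
  have sq: "?M (?M (FT a)) = - FT (\<lambda>x. of_real (\<omega> x) * (of_real (\<omega> x) * a x))" if "L12 a" for a
    using associated_square_FT[OF D that] by (simp add: bounded_operatorD[OF bD] power2_eq_square)
  have p: "\<i> * cinner (FT (\<lambda>x. of_real (sgn x) * (of_real (\<omega> x) * (of_real (\<omega> x) * a x)))) (?M (FT a)) \<in> \<real>\<^sub>\<ge>\<^sub>0"
    if a: "L12 a" for a
  proof -
    let ?W = "\<lambda>x. of_real (\<omega> x) * (of_real (\<omega> x) * a x)"
    let ?k = "complex_of_real (- 1 / c\<^sup>2)"
    have W: "L12 ?W" by (intro L12_omega a)
    have "D (D (FT a)) = (1 / c\<^sup>2) *\<^sub>R (c\<^sup>2 *\<^sub>R D (D (FT a)))" using c by simp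
    also have "\<dots> = scaleC ?k (FT ?W)"
      unfolding associated_square_FT[OF D a] scaleC_of_real by simp
    also have "\<dots> = FT (\<lambda>x. ?k * ?W x)" by (rule FT_cmult[OF W, symmetric])
    finally have DD: "D (D (FT a)) = FT (\<lambda>x. ?k * ?W x)" .
    have "hilbert (D (D (FT a))) = scaleC (- pi * \<i>) (FT (\<lambda>x. of_real (sgn x) * (?k * ?W x)))"
      unfolding DD by (rule hilbert_FT[OF L12_cmult[OF W]])
    also have "(\<lambda>x. of_real (sgn x) * (?k * ?W x)) = (\<lambda>x. ?k * (of_real (sgn x) * ?W x))"
      by (simp only: mult.left_commute)
    also have "FT \<dots> = scaleC ?k (FT (\<lambda>x. of_real (sgn x) * ?W x))"
      by (rule FT_cmult[OF L12_sgn[OF W]])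
    finally have "cinner (hilbert (D (D (FT a)))) (D (FT a)) =
        (- pi * \<i>) * (?k * cinner (FT (\<lambda>x. of_real (sgn x) * ?W x)) (D (FT a)))"
      by (simp only: cinner_scaleC_left)
    then have h: "(- pi * \<i>) * (?k * cinner (FT (\<lambda>x. of_real (sgn x) * ?W x)) (D (FT a))) \<in> \<real>\<^sub>\<ge>\<^sub>0"
      using pos[of "D (FT a)"] by simp
    \<comment> \<open>A positive factor that cancels the \<pi> of the Hilbert transform and the
      \<open>1 / c^2\<close> of axiom (1), and leaves one \<open>c\<close> to turn \<open>D\<close>
      into \<open>c D\<close>.\<close>
    have "of_real (c ^ 3 / pi) * ((- pi * \<i>) * (?k * cinner (FT (\<lambda>x. of_real (sgn x) * ?W x)) (D (FT a)))) \<in> \<real>\<^sub>\<ge>\<^sub>0"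
      using c by (intro nonneg_Reals_mult_I h) (simp add: complex_nonneg_Reals_iff)
    also have "of_real (c ^ 3 / pi) * ((- pi * \<i>) * (?k * cinner (FT (\<lambda>x. of_real (sgn x) * ?W x)) (D (FT a)))) =
       \<i> * cinner (FT (\<lambda>x. of_real (sgn x) * ?W x)) (?M (FT a))"
      using c by (simp add: cinner_scaleR_right power3_eq_cube power2_eq_square)
    finally show ?thesis .
  qed
  show ?thesis
    using symbol_identification[OF bM tM omega_measurable omega_bounded omega_pos sq p a]
    by (simp add: theta_eq)
qed

lemma theta_0: "\<theta> 0 = 0" by (simp add: \<theta>_def)

lemma theta_le_linear: "\<bar>\<theta> x\<bar> \<le> 2 * pi * sqrt (mu2 / 2) * \<bar>x\<bar>"
proof -
  have "norm (\<theta> x - \<theta> 0) \<le> 2 * pi * sqrt (mu2 / 2) * norm (x - 0)"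
    by (rule field_differentiable_bound[of UNIV \<theta> \<theta>']) (use theta_deriv theta'_le in auto)
  then show ?thesis by (simp add: theta_0)
qed

text \<open>The scaling limit is tested on a single function whose transform is an indicator.\<close>

lemma associated_speed:
  assumes D: "associated J c D"
  shows "c = sqrt (mu2 / 2)"
proof -
  define k where "k = 2 * pi * sqrt (mu2 / 2)"
  have c: "c > 0" and bD: "bounded_operator D" using D unfolding associated_def by auto
  \<comment> \<open>The interval lies on one side of 0: the final pairing is a multiple of the
    integral of \<open>y\<close> over it and must not vanish.\<close>
  define a where "a x = complex_of_real (indicator {0..1} x)" for x :: real
  have aL: "L12 a"
    by (rule L12_bounded_support[of _ 1 1]) (auto simp: a_def[abs_def] indicator_def)
  have yL: "L12 (\<lambda>y. of_real y * a y)"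
    by (rule L12_bounded_support[of _ 1 1]) (auto simp: a_def[abs_def] indicator_def)
  let ?b = "\<lambda>y. 2 * pi * \<i> * (of_real y * a y)"
  have bL: "L12 ?b" by (rule L12_cmult[OF yL])
  \<comment> \<open>The amplitude of the rescaled operator applied to \<open>FT a\<close>;
    conjugation with dilations replaces \<theta> at \<open>y\<close> by \<theta> at
    \<open>h * y\<close>.\<close>
  define g where "g h y = \<i> * of_real (\<theta> (h * y) / (c * h)) * a y" for h y
  have gb: "cmod (g h y) \<le> k / c * cmod (of_real y * a y)" if "h > 0" for h y
  proof -
    have "\<bar>\<theta> (h * y)\<bar> / (c * h) \<le> (k * (h * \<bar>y\<bar>)) / (c * h)"
      using theta_le_linear[of "h * y"] that c unfolding k_def by (intro divide_right_mono) (auto simp: abs_mult)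
    also have "\<dots> = k / c * \<bar>y\<bar>" using that by simp
    finally have "\<bar>\<theta> (h * y)\<bar> / (c * h) \<le> k / c * \<bar>y\<bar>" .
    then have "\<bar>\<theta> (h * y)\<bar> / (c * h) * cmod (a y) \<le> k / c * \<bar>y\<bar> * cmod (a y)" by (rule mult_right_mono) simp
    moreover have "cmod (g h y) = \<bar>\<theta> (h * y)\<bar> / (c * h) * cmod (a y)"
      using that c by (simp add: g_def norm_mult norm_divide)
    ultimately show ?thesis by (simp add: norm_mult mult.assoc)
  qed
  have gm: "g h \<in> borel_measurable borel" for h
    using L12_measurable[OF aL] unfolding g_def[abs_def] by measurable
  have gL: "L12 (g h)" if h: "h > 0" for h
  proof -
    have "k \<ge> 0" using mu2_pos by (simp add: k_def)
    show ?thesis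
    proof (rule L12_bounded_support[OF gm, of 1 _ "k / c"])
      show "g h x = 0" if "\<bar>x\<bar> > 1" for x using that by (auto simp: g_def a_def indicator_def)
      show "cmod (g h x) \<le> k / c" if "\<bar>x\<bar> \<le> 1" for x
      proof -
        have "cmod (of_real x * a x) \<le> 1" using that by (auto simp: a_def indicator_def norm_mult)
        then have "k / c * cmod (of_real x * a x) \<le> k / c * 1" using \<open>k \<ge> 0\<close> c by (intro mult_left_mono) auto
        then show ?thesis using gb[OF h, of x] by linarith
      qed
    qed
  qed
  have Dh: "inverse h *\<^sub>R dilate h (D (dilate (inverse h) (FT a))) = FT (g h)" if h: "h > 0" for h
  proof -
    let ?a = "\<lambda>y. of_real (inverse h) * a (inverse h * y)"
    have aL': "L12 ?a" by (rule L12_scale[OF aL]) (use h in simp)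
    have 1: "dilate (inverse h) (FT a) = FT ?a" by (rule dilate_FT[OF aL]) (use h in simp)
    let ?t = "\<lambda>y. \<i> * of_real (\<theta> y) * ?a y"
    have tL: "L12 ?t" by (rule L12_theta[OF aL'])
    have "D (FT ?a) = scaleC (of_real (inverse c)) (FT ?t)"
      unfolding scaleC_of_real associated_symbol[OF D aL', symmetric] using c by simp
    also have "\<dots> = FT (\<lambda>y. of_real (inverse c) * ?t y)" by (rule FT_cmult[OF tL, symmetric])
    finally have 2: "D (FT ?a) = FT (\<lambda>y. of_real (inverse c) * ?t y)" .
    have L2: "L12 (\<lambda>y. of_real (inverse c) * ?t y)" by (rule L12_cmult[OF tL])
    have 3: "dilate h (FT (\<lambda>y. of_real (inverse c) * ?t y)) = FT (\<lambda>y. of_real h * (of_real (inverse c) * ?t (h * y)))"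
      by (rule dilate_FT[OF L2 h])
    have L3: "L12 (\<lambda>y. of_real h * (of_real (inverse c) * ?t (h * y)))"
      using L12_scale[OF L2, of h] h by simp
    have "inverse h *\<^sub>R dilate h (D (dilate (inverse h) (FT a))) = FT (\<lambda>y. of_real (inverse h) * (of_real h * (of_real (inverse c) * ?t (h * y))))"
      unfolding 1 2 3 FT_cmult[OF L3] scaleC_of_real ..
    also have "(\<lambda>y. of_real (inverse h) * (of_real h * (of_real (inverse c) * ?t (h * y)))) = g h"
    proof
      fix y
      have e: "inverse h * (h * y) = y" using h by simp
      show "of_real (inverse h) * (of_real h * (of_real (inverse c) * ?t (h * y))) = g h y"
        unfolding g_def e using h by (simp add: divide_inverse)
    qed
    finally show ?thesis .
  qed
  define s where "s n = inverse (real (Suc n))" for n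
  have s: "s n > 0" for n by (simp add: s_def)
  have s0: "s \<longlonglongrightarrow> 0" unfolding s_def by (rule LIMSEQ_inverse_real_of_nat)
  have "weakly_tendsto (\<lambda>h. inverse h *\<^sub>R dilate h (D (dilate (inverse h) (FT a)))) (FT ?b) (at_right 0)"
    using D FT_weak_derivative[OF aL yL] unfolding associated_def by blast
  then have "((\<lambda>h. cinner (inverse h *\<^sub>R dilate h (D (dilate (inverse h) (FT a)))) (FT a)) \<longlongrightarrow> cinner (FT ?b) (FT a)) (at_right 0)"
    unfolding weakly_tendsto_def by blast
  moreover have "filterlim s (at_right 0) sequentially"
    using s s0 by (auto simp: filterlim_at less_imp_neq[OF s, symmetric])
  ultimately have "(\<lambda>n. cinner (inverse (s n) *\<^sub>R dilate (s n) (D (dilate (inverse (s n)) (FT a)))) (FT a)) \<longlonglongrightarrow> cinner (FT ?b) (FT a)"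
    by (rule filterlim_compose)
  then have l1: "(\<lambda>n. cinner (FT (g (s n))) (FT a)) \<longlonglongrightarrow> cinner (FT ?b) (FT a)"
    by (simp only: Dh[OF s])
  \<comment> \<open>As \<theta> has slope \<open>k\<close> at 0, the rescaled symbols tend to
    \<open>\<i> * k * y / c\<close>, whereas the axiom demands \<open>2 * pi * \<i> * y\<close>.
    Pairing both limits with \<open>FT a\<close> forces \<open>k = 2 * pi * c\<close>.\<close>
  let ?g0 = "\<lambda>y. of_real (k / (2 * pi * c)) * ?b y"
  have "(\<lambda>n. FT (g (s n))) \<longlonglongrightarrow> FT ?g0"
  proof (rule FT_tendsto[OF gL[OF s] L12_cmult[OF bL]])
    show "square_integrable (\<lambda>y. of_real (k / c) * (of_real y * a y))"
      by (rule L12_square_integrable[OF L12_cmult[OF yL]])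
    have "k \<ge> 0" using mu2_pos by (simp add: k_def)
    then show "cmod (g (s n) y) \<le> cmod (of_real (k / c) * (of_real y * a y))" for n y
      using gb[OF s, of n y] c unfolding norm_mult[of "of_real (k / c)"] norm_of_real by simp
    show "AE y in lborel. (\<lambda>n. g (s n) y) \<longlonglongrightarrow> ?g0 y"
    proof (rule AE_I2)
      fix y
      have "((\<lambda>h. \<theta> (h * y)) has_real_derivative k * y) (at 0)"
      proof -
        have "((\<lambda>h. h * y) has_real_derivative y) (at 0)" by (auto intro!: derivative_eq_intros)
        from DERIV_chain2[OF theta_deriv this] show ?thesis by (simp add: theta'_0 k_def)
      qed
      then have "(\<lambda>h. \<theta> (h * y) / h) \<midarrow>0\<rightarrow> k * y" by (simp add: DERIV_def theta_0)
      then have "(\<lambda>n. \<theta> (s n * y) / s n) \<longlonglongrightarrow> k * y"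
        using s s0 unfolding tendsto_at_iff_sequentially by (auto simp: o_def less_imp_neq[OF s, symmetric])
      then have "(\<lambda>n. \<i> * of_real ((1 / c) * (\<theta> (s n * y) / s n)) * a y) \<longlonglongrightarrow> \<i> * of_real ((1 / c) * (k * y)) * a y"
        by (intro tendsto_intros)
      moreover have "\<i> * of_real ((1 / c) * (\<theta> (s n * y) / s n)) * a y = g (s n) y" for n by (simp add: g_def)
      moreover have "\<i> * of_real ((1 / c) * (k * y)) * a y = ?g0 y" by simp
      ultimately show "(\<lambda>n. g (s n) y) \<longlonglongrightarrow> ?g0 y" by (simp only:)
    qed
  qed
  then have l2: "(\<lambda>n. cinner (FT (g (s n))) (FT a)) \<longlonglongrightarrow> cinner (FT ?g0) (FT a)"
    by (intro tendsto_cinner tendsto_const)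
  have "cinner (FT ?b) (FT a) = cinner (FT ?g0) (FT a)" by (rule LIMSEQ_unique[OF l1 l2])
  then have eq: "cinner (FT ?b) (FT a) = of_real (k / (2 * pi * c)) * cinner (FT ?b) (FT a)"
    by (simp only: FT_cmult[OF bL] cinner_scaleC_left)
  have "cinner (FT ?b) (FT a) = (LINT y|lborel. (2 * pi * \<i>) * of_real (indicator {0..1} y *\<^sub>R y))"
    unfolding cinner_FT[OF bL aL]
    by (intro Bochner_Integration.integral_cong) (auto simp: a_def indicator_def)
  also have "\<dots> = (2 * pi * \<i>) * of_real (LINT y|lborel. indicator {0..1} y *\<^sub>R y)"
    by (simp only: integral_mult_right_zero integral_complex_of_real)
  also have "(LINT y|lborel. indicator {0..1} y *\<^sub>R y) = (1\<^sup>2 / 2 - 0\<^sup>2 / 2 :: real)"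
    by (rule integral_FTC_Icc) (auto intro!: derivative_eq_intros continuous_intros simp: has_real_derivative_iff_has_vector_derivative[symmetric])
  finally have "cinner (FT ?b) (FT a) \<noteq> 0" by simp
  then have "complex_of_real (k / (2 * pi * c)) = 1"
    using eq[symmetric] unfolding mult_cancel_right2 by blast
  then have "k / (2 * pi * c) = 1" by (simp only: of_real_eq_1_iff)
  then show ?thesis using c by (simp add: k_def)
qed

end

section \<open>The wave equation\<close>

text \<open>Conservation of energy: the derivative of the squared norm is twice the pairing of
  \<open>e\<close> with \<open>T e\<close>. The one-sided derivative at 0 suffices, since only times
  \<open>t \<ge> 0\<close> occur.\<close>

lemma skew_flow_unique:
  fixes e :: "real \<Rightarrow> 'a::real_inner"
  assumes d: "\<And>t. t \<ge> 0 \<Longrightarrow> (e has_vector_derivative T (e t)) (at t within {0..})"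
    and skew: "\<And>w. inner w (T w) = 0" and z: "e 0 = 0" and t: "t \<ge> 0"
  shows "e t = 0"
proof -
  have "\<exists>k. \<forall>t\<in>{0..}. inner (e t) (e t) = k"
  proof (rule has_derivative_zero_constant)
    fix t :: real assume t: "t \<in> {0..}"
    then have de: "(e has_derivative (\<lambda>h. h *\<^sub>R T (e t))) (at t within {0..})"
      using d[of t] by (simp add: has_vector_derivative_def)
    have "((\<lambda>t. inner (e t) (e t)) has_derivative (\<lambda>h. inner (e t) (h *\<^sub>R T (e t)) + inner (h *\<^sub>R T (e t)) (e t))) (at t within {0..})"
      by (rule has_derivative_inner[OF de de])
    then show "((\<lambda>t. inner (e t) (e t)) has_derivative (\<lambda>h. 0)) (at t within {0..})"
      using skew[of "e t"] by (simp add: inner_commute)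
  qed simp
  then have "inner (e t) (e t) = inner (e 0) (e 0)" using t by auto
  then show ?thesis by (simp add: z)
qed

context wave_kernel
begin

text \<open>Since \<theta> is bounded, the second-order error in expanding
  \<open>cis (h * \<theta> x)\<close> is at most a constant times \<open>h^2\<close>, uniformly in
  the frequency. The isometry makes this an estimate in the norm of L^2.\<close>

lemma flow_derivative:
  assumes a: "L12 a"
  shows "((\<lambda>t. FT (\<lambda>x. cis (t * \<theta> x) * a x)) has_vector_derivative
      FT (\<lambda>x. \<i> * of_real (\<theta> x) * (cis (t * \<theta> x) * a x))) (at t within S)"
proof -
  let ?G = "\<lambda>t. FT (\<lambda>x. cis (t * \<theta> x) * a x)"
  let ?V = "FT (\<lambda>x. \<i> * of_real (\<theta> x) * (cis (t * \<theta> x) * a x))"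
  define B where "B = sqrt (2 * (LINT y|lborel. cmod (Jc y)))"
  have B: "\<bar>\<theta> x\<bar> \<le> B" for x unfolding B_def by (rule theta_bounded)
  have aL: "L12 (\<lambda>x. cis (t * \<theta> x) * a x)" for t
    by (rule L12_mult_bounded[OF a, where B = 1]) auto
  define K where "K = norm (FT (\<lambda>x. of_real (B\<^sup>2 / 2) * a x))"
  have bL: "L12 (\<lambda>x. of_real (B\<^sup>2 / 2) * a x)" by (rule L12_cmult[OF a])
  have le: "norm (?G (t + h) - (?G t + h *\<^sub>R ?V)) \<le> h\<^sup>2 * K" for h
  proof -
    define p where "p x = cis ((t + h) * \<theta> x) * a x - (cis (t * \<theta> x) * a x + of_real h * (\<i> * of_real (\<theta> x) * (cis (t * \<theta> x) * a x)))" for x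
    have vL: "L12 (\<lambda>x. \<i> * of_real (\<theta> x) * (cis (t * \<theta> x) * a x))" by (rule L12_theta[OF aL])
    have pL: "L12 p" unfolding p_def by (intro L12_diff L12_add L12_cmult vL aL)
    have 1: "?G (t + h) - (?G t + h *\<^sub>R ?V) = FT p"
      unfolding p_def using aL vL
      by (simp add: FT_diff FT_add FT_cmult L12_add L12_cmult scaleC_of_real)
    have pt: "cmod (p x) \<le> cmod (of_real (h\<^sup>2) * (of_real (B\<^sup>2 / 2) * a x))" for x
    proof -
      have c: "cis ((t + h) * \<theta> x) = cis (t * \<theta> x) * cis (h * \<theta> x)" by (simp add: cis_mult distrib_right)
      have "p x = cis (t * \<theta> x) * a x * (cis (h * \<theta> x) - (1 + \<i> * of_real (h * \<theta> x)))"
        unfolding p_def c by (simp add: algebra_simps)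
      then have "cmod (p x) = cmod (a x) * cmod (cis (h * \<theta> x) - (1 + \<i> * of_real (h * \<theta> x)))"
        by (simp only: norm_mult norm_cis mult_1)
      also have "\<dots> \<le> cmod (a x) * (h\<^sup>2 * (B\<^sup>2 / 2))"
      proof (rule mult_left_mono[OF _ norm_ge_zero])
        have "cmod (cis (h * \<theta> x) - (1 + \<i> * of_real (h * \<theta> x))) \<le> \<bar>h * \<theta> x\<bar>\<^sup>2 / 2"
          using iexp_approx1[of "h * \<theta> x" 1] by (simp add: cis_conv_exp power2_eq_square)
        also have "\<bar>h * \<theta> x\<bar>\<^sup>2 / 2 \<le> h\<^sup>2 * (B\<^sup>2 / 2)"
          using power_mono[OF B[of x], of 2] by (simp add: power_mult_distrib mult_left_mono)
        finally show "cmod (cis (h * \<theta> x) - (1 + \<i> * of_real (h * \<theta> x))) \<le> h\<^sup>2 * (B\<^sup>2 / 2)" .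
      qed
      also have "\<dots> = cmod (of_real (h\<^sup>2) * (of_real (B\<^sup>2 / 2) * a x))"
        unfolding norm_mult norm_of_real by simp
      finally show ?thesis .
    qed
    have "(norm (FT p))\<^sup>2 \<le> (norm (FT (\<lambda>x. of_real (h\<^sup>2) * (of_real (B\<^sup>2 / 2) * a x))))\<^sup>2"
      unfolding norm_FT[OF pL] norm_FT[OF L12_cmult[OF bL]]
        norm_abs_l2[OF L12_square_integrable[OF pL]] norm_abs_l2[OF L12_square_integrable[OF L12_cmult[OF bL]]]
      by (rule integral_mono)
         (use pL L12_cmult[OF bL] pt in \<open>auto simp: L12_def square_integrable_def intro!: power_mono\<close>)
    then have "norm (FT p) \<le> norm (FT (\<lambda>x. of_real (h\<^sup>2) * (of_real (B\<^sup>2 / 2) * a x)))"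
      by (rule power2_le_imp_le) simp
    also have "\<dots> = h\<^sup>2 * K"
      unfolding FT_cmult[OF bL] norm_scaleC K_def norm_of_real by simp
    finally show ?thesis unfolding 1 .
  qed
  show ?thesis
    unfolding has_vector_derivative_def has_derivative_within
  proof
    show "bounded_linear (\<lambda>h. h *\<^sub>R ?V)" by (rule bounded_linear_scaleR_left)
    have "((\<lambda>y. \<bar>y - t\<bar> * K) \<longlongrightarrow> \<bar>t - t\<bar> * K) (at t within S)" by (intro tendsto_intros)
    then have z: "((\<lambda>y. \<bar>y - t\<bar> * K) \<longlongrightarrow> 0) (at t within S)" by simp
    show "((\<lambda>y. (1 / norm (y - t)) *\<^sub>R (?G y - (?G t + (y - t) *\<^sub>R ?V))) \<longlongrightarrow> 0) (at t within S)"
    proof (rule Lim_null_comparison[OF always_eventually z], rule allI)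
      fix y
      have "norm ((1 / norm (y - t)) *\<^sub>R (?G y - (?G t + (y - t) *\<^sub>R ?V))) =
          (1 / \<bar>y - t\<bar>) * norm (?G (t + (y - t)) - (?G t + (y - t) *\<^sub>R ?V))" by simp
      also have "\<dots> \<le> (1 / \<bar>y - t\<bar>) * ((y - t)\<^sup>2 * K)" by (intro mult_left_mono le) simp
      also have "\<dots> \<le> \<bar>y - t\<bar> * K"
      proof (cases "y = t")
        case False
        define z where "z = \<bar>y - t\<bar>"
        have "(y - t)\<^sup>2 = z * z" "z \<noteq> 0" using False by (simp_all add: z_def power2_eq_square)
        then have "(1 / z) * ((y - t)\<^sup>2 * K) = z * K" by (simp add: mult.assoc)
        then show ?thesis unfolding z_def by simp
      qed simp
      finally show "norm ((1 / norm (y - t)) *\<^sub>R (?G y - (?G t + (y - t) *\<^sub>R ?V))) \<le> \<bar>y - t\<bar> * K" .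
    qed
  qed
qed

text \<open>The symbol \<open>\<i> * \<theta>\<close> is purely imaginary, so the pairing vanishes
  on transforms; density and continuity of \<open>D\<close> extend this to all of L^2.\<close>

lemma associated_skew:
  assumes D: "associated J c D"
  shows "inner w (D w) = 0"
proof -
  have c: "c > 0" and bD: "bounded_operator D" using D unfolding associated_def by auto
  obtain b where b: "\<And>n. L12 (b n)" "(\<lambda>n. FT (b n)) \<longlonglongrightarrow> w" by (rule FT_dense_seq[of w]) blast
  have "inner (FT a) (c *\<^sub>R D (FT a)) = 0" if a: "L12 a" for a
  proof -
    have "cinner (FT a) (c *\<^sub>R D (FT a)) = (LINT x|lborel. (- \<i>) * of_real (\<theta> x * (cmod (a x))\<^sup>2))"
      unfolding associated_symbol[OF D a] cinner_FT[OF a L12_theta[OF a]]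
      by (intro Bochner_Integration.integral_cong) (auto simp: complex_norm_square mult_ac simp del: of_real_power)
    also have "\<dots> = (- \<i>) * of_real (LINT x|lborel. \<theta> x * (cmod (a x))\<^sup>2)"
      by (simp only: integral_mult_right_zero integral_complex_of_real)
    finally show ?thesis by (simp flip: Re_cinner)
  qed
  then have "inner (FT (b n)) (D (FT (b n))) = 0" for n using b(1) c by simp
  moreover have "(\<lambda>n. inner (FT (b n)) (D (FT (b n)))) \<longlonglongrightarrow> inner w (D w)"
    by (intro tendsto_inner bounded_operator_tendsto[OF bD] b)
  ultimately show ?thesis by (simp add: LIMSEQ_const_iff)
qed

text \<open>The explicit evolution solves the same linear first-order equation, and the difference
  starts at 0. Uniqueness is what makes the formula valid for an arbitrary L^2-valued
  solution.\<close>

lemma flow_representation: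
  assumes D: "associated J c D" and s: "s = 1 \<or> s = -1" and a: "L12 a"
    and f: "\<And>t. t \<ge> 0 \<Longrightarrow> (f has_vector_derivative s *\<^sub>R c *\<^sub>R D (f t)) (at t within {0..})"
    and f0: "f 0 = FT a" and t: "t \<ge> 0"
  shows "f t = FT (\<lambda>x. cis (t * (s * \<theta> x)) * a x)"
proof -
  have bD: "bounded_operator D" using D unfolding associated_def by auto
  let ?G = "\<lambda>t. FT (\<lambda>x. cis (t * (s * \<theta> x)) * a x)"
  have G: "(?G has_vector_derivative s *\<^sub>R c *\<^sub>R D (?G t)) (at t within {0..})" for t
  proof -
    have L: "L12 (\<lambda>x. cis (t * (s * \<theta> x)) * a x)" by (rule L12_mult_bounded[OF a, where B = 1]) auto
    have "((\<lambda>t. s * t) has_vector_derivative s) (at t within {0..})"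
      unfolding has_real_derivative_iff_has_vector_derivative[symmetric] by (auto intro!: derivative_eq_intros)
    from vector_diff_chain_within[OF this flow_derivative[OF a]]
    have "(?G has_vector_derivative s *\<^sub>R FT (\<lambda>x. \<i> * of_real (\<theta> x) * (cis (t * (s * \<theta> x)) * a x))) (at t within {0..})"
      by (simp add: o_def mult_ac)
    then show ?thesis unfolding associated_symbol[OF D L] .
  qed
  have "f t - ?G t = 0"
  proof (rule skew_flow_unique[where e = "\<lambda>t. f t - ?G t" and T = "\<lambda>w. s *\<^sub>R c *\<^sub>R D w", OF _ _ _ t])
    fix t :: real assume "t \<ge> 0"
    from has_vector_derivative_diff[OF f[OF this] G[of t]]
    show "((\<lambda>t. f t - ?G t) has_vector_derivative s *\<^sub>R c *\<^sub>R D (f t - ?G t)) (at t within {0..})"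
      by (simp add: bounded_operatorD[OF bD] scaleR_right_diff_distrib)
  qed (auto simp: associated_skew[OF D] f0)
  then show ?thesis by simp
qed

text \<open>Along \<open>x0 + v * t\<close> the phase is \<open>t\<close> times a fixed function
  \<Theta>, while \<open>x0\<close> only modulates the amplitude. Since |v| exceeds the maximal
  speed, the derivative of \<Theta> keeps the sign of \<open>v\<close> and stays at least
  \<open>k\<close> away from 0.\<close>

lemma decay_outside_cone:
  assumes s: "s = 1 \<or> s = -1" and v: "\<bar>v\<bar> > sqrt (mu2 / 2)" and a: "Creg rapid l a"
  shows "\<exists>C. \<forall>t>0. cmod (ft (\<lambda>x. cis (t * (s * \<theta> x)) * a x) (x0 + v * t)) \<le> C / t ^ l"
proof -
  define \<Theta> where "\<Theta> x = 2 * pi * v * x + s * \<theta> x" for x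
  define \<Theta>' where "\<Theta>' x = 2 * pi * v + s * \<theta>' x" for x
  define k where "k = 2 * pi * (\<bar>v\<bar> - sqrt (mu2 / 2))"
  have k: "k > 0" using v by (simp add: k_def)
  have sv: "sgn v * v = \<bar>v\<bar>" "sgn v * sgn v = 1" "\<bar>sgn v\<bar> = 1"
    using v mu2_pos by (auto simp: sgn_if abs_if split: if_splits)
  have low: "sgn v * \<Theta>' x \<ge> k" for x
  proof -
    have "\<bar>sgn v * (s * \<theta>' x)\<bar> \<le> 2 * pi * sqrt (mu2 / 2)"
      using theta'_le[of x] s sv(3) by (auto simp: abs_mult)
    then have "sgn v * (s * \<theta>' x) \<ge> - (2 * pi * sqrt (mu2 / 2))" by linarith
    moreover have "sgn v * \<Theta>' x = 2 * pi * (sgn v * v) + sgn v * (s * \<theta>' x)" by (simp add: \<Theta>'_def distrib_left)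
    ultimately show ?thesis unfolding sv(1) k_def by (simp add: right_diff_distrib)
  qed
  have pos: "sgn v * \<Theta>' x > 0" for x using low[of x] k by linarith
  have c': "Creg polyb l \<Theta>'"
    unfolding \<Theta>'_def[abs_def] by (intro Creg_polyb_add Creg_polyb_mult Creg_polyb_const Creg_theta')
  \<comment> \<open>The factor \<open>sgn v\<close> makes the base positive, as real powers require;
    it is undone in the reciprocal afterwards.\<close>
  have "Creg polyb l (\<lambda>x. (sgn v * \<Theta>' x) powr (- 1))"
  proof (rule Creg_powr[OF pos])
    have "norm (1 / (sgn v * \<Theta>' x)) \<le> 1 / k" for x
      using pos[of x] low[of x] k by (simp add: frac_le)
    then show "polyb (\<lambda>x. 1 / (sgn v * \<Theta>' x))" by (rule polyb_bounded)
    show "Creg polyb l (\<lambda>x. sgn v * \<Theta>' x)" by (intro Creg_polyb_mult Creg_polyb_const c')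
  qed
  then have "Creg polyb l (\<lambda>x. sgn v * (sgn v * \<Theta>' x) powr (- 1))"
    by (intro Creg_polyb_mult Creg_polyb_const)
  moreover have "sgn v * (sgn v * \<Theta>' x) powr (- 1) = 1 / \<Theta>' x" for x
  proof -
    have "sgn v * (sgn v * \<Theta>' x) powr (- 1) = sgn v / (sgn v * \<Theta>' x)"
      using pos[of x] by (simp add: powr_minus_divide)
    also have "\<dots> = 1 / \<Theta>' x" using sv(3) by (cases "sgn v = 0") auto
    finally show ?thesis .
  qed
  ultimately have inv: "Creg polyb l (\<lambda>x. 1 / \<Theta>' x)" by simp
  have d: "(\<Theta> has_real_derivative \<Theta>' x) (at x)" for x
    unfolding \<Theta>_def[abs_def] \<Theta>'_def by (auto intro!: derivative_eq_intros theta_deriv)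
  have nz: "\<Theta>' x \<noteq> 0" for x using pos[of x] by auto
  have b: "Creg rapid l (\<lambda>x. cis (2 * pi * x0 * x) * a x)"
    by (rule Creg_rapid_mult[OF Creg_polyb_cis a])
  obtain C where C: "\<And>t. t > 0 \<Longrightarrow> cmod (LINT x|lborel. cis (t * \<Theta> x) * (cis (2 * pi * x0 * x) * a x)) \<le> C / t ^ l"
    using nonstationary_phase[OF d Creg_continuous[OF c'] nz inv b] by blast
  have "ft (\<lambda>x. cis (t * (s * \<theta> x)) * a x) (x0 + v * t) = (LINT x|lborel. cis (t * \<Theta> x) * (cis (2 * pi * x0 * x) * a x))" for t
    unfolding ft_def
  proof (rule Bochner_Integration.integral_cong[OF refl])
    fix x
    have "cis (t * (s * \<theta> x)) * cis (2 * pi * (x0 + v * t) * x) = cis (t * \<Theta> x) * cis (2 * pi * x0 * x)"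
      unfolding cis_mult by (rule arg_cong[where f = cis]) (simp add: \<Theta>_def algebra_simps)
    then show "cis (t * (s * \<theta> x)) * a x * cis (2 * pi * (x0 + v * t) * x) = cis (t * \<Theta> x) * (cis (2 * pi * x0 * x) * a x)"
      by (metis mult.assoc mult.commute)
  qed
  then show ?thesis using C by auto
qed

end

theorem theorem2:
  fixes l :: nat and J :: "real \<Rightarrow> real" and c :: real and D :: "l2 \<Rightarrow> l2"
    and u u' u'' :: "real \<Rightarrow> l2"
  assumes J_L1: "integrable lborel J"
    and J_nonneg: "AE x in lborel. J x \<ge> 0"
    and J_even: "AE x in lborel. J (- x) = J x"
    and J_nonzero: "\<not> (AE x in lborel. J x = 0)"
    and moments: "\<And>k. k \<le> l + 2 \<Longrightarrow> integrable lborel (\<lambda>x. \<bar>x\<bar> ^ k * J x)"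
    and c_D: "associated J c D"
    and solution: "is_solution J u u' u''"
    and init: "in_schwartz (u 0)" "in_schwartz (u' 0)"
  shows "\<exists>ut Du :: real \<Rightarrow> real \<Rightarrow> complex.
    (\<forall>t\<ge>0. continuous_representative (u' t) (ut t) \<and>
            continuous_representative (D (u t)) (Du t)) \<and>
    (\<forall>v x0. \<bar>v\<bar> > c \<longrightarrow>
      (\<exists>C. \<forall>t>0. (cmod (ut t (x0 + v * t)))\<^sup>2 + c\<^sup>2 * (cmod (Du t (x0 + v * t)))\<^sup>2
                    \<le> C * t powi (- 2 * int l)))"
proof -
  interpret wave_kernel J l
    using J_L1 J_nonneg J_even J_nonzero moments by unfold_locales
  have c: "c > 0" and bD: "bounded_operator D" using c_D unfolding associated_def by auto
  have cs: "c = sqrt (mu2 / 2)" by (rule associated_speed[OF c_D])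
  have du: "(u has_vector_derivative u' t) (at t within {0..})"
    and du': "(u' has_vector_derivative u'' t) (at t within {0..})"
    and eq: "AE x in lborel. rep_l2 (u'' t) x + moment J 0 *\<^sub>R rep_l2 (u t) x = conv J (u t) x"
    if "t \<ge> 0" for t using solution that unfolding is_solution_def by auto
  have u'': "u'' t = c\<^sup>2 *\<^sub>R D (D (u t))" if "t \<ge> 0" for t
    using associated_square[OF c_D, of "u t" "u'' t"] eq[OF that] by simp
  obtain a0 where a0: "\<And>n. Creg rapid n a0" "L12 a0" "u 0 = FT a0"
    using init(1) by (rule in_schwartz_FT) blast
  obtain b0 where b0: "\<And>n. Creg rapid n b0" "L12 b0" "u' 0 = FT b0"
    using init(2) by (rule in_schwartz_FT) blast
  \<comment> \<open>The amplitude of \<open>u' + s c D u\<close> at time 0, with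
    \<open>s = 1\<close> and \<open>s = -1\<close> for the two directions of travel.\<close>
  define a where "a s x = b0 x + of_real s * (\<i> * of_real (\<theta> x) * a0 x)" for s x
  have aL: "L12 (a s)" for s
    unfolding a_def[abs_def] by (intro L12_add b0 L12_cmult L12_theta a0)
  have aC: "Creg rapid l (a s)" for s
    unfolding a_def[abs_def]
    by (intro Creg_rapid_add b0 Creg_rapid_mult Creg_polyb_mult Creg_polyb_const a0
        Creg_polyb_linear[OF bounded_linear_of_real] Creg_theta)
  define F where "F s t x = cis (t * (s * \<theta> x)) * a s x" for s t x
  have FL: "L12 (F s t)" for s t
    unfolding F_def[abs_def] by (rule L12_mult_bounded[OF aL, where B = 1]) auto
  have rep: "u' t + s *\<^sub>R c *\<^sub>R D (u t) = FT (F s t)" if t: "t \<ge> 0" and s: "s = 1 \<or> s = -1" for s t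
    unfolding F_def[abs_def]
  proof (rule flow_representation[where f = "\<lambda>t. u' t + s *\<^sub>R c *\<^sub>R D (u t)", OF c_D s aL _ _ t])
    have bl: "bounded_linear D" using bD by (simp add: bounded_operator_def)
    fix t :: real assume t: "t \<ge> 0"
    have "((\<lambda>t. s *\<^sub>R c *\<^sub>R D (u t)) has_vector_derivative s *\<^sub>R c *\<^sub>R D (u' t)) (at t within {0..})"
      by (rule bounded_linear.has_vector_derivative[OF bounded_linear_compose[OF bounded_linear_scaleR_right
            bounded_linear_compose[OF bounded_linear_scaleR_right bl]] du[OF t]])
    from has_vector_derivative_add[OF du'[OF t] this]
    have "((\<lambda>t. u' t + s *\<^sub>R c *\<^sub>R D (u t)) has_vector_derivative u'' t + s *\<^sub>R c *\<^sub>R D (u' t)) (at t within {0..})" .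
    \<comment> \<open>The second-order equation factors: \<open>u'' = c^2 D (D u)\<close> by axiom
      (1), and \<open>s^2 = 1\<close> lets \<open>s c D\<close> be taken out.\<close>
    moreover have "u'' t + s *\<^sub>R c *\<^sub>R D (u' t) = s *\<^sub>R c *\<^sub>R D (u' t + s *\<^sub>R c *\<^sub>R D (u t))"
      using s by (auto simp: u''[OF t] bounded_operatorD[OF bD] scaleR_add_right power2_eq_square)
    ultimately show "((\<lambda>t. u' t + s *\<^sub>R c *\<^sub>R D (u t)) has_vector_derivative
        s *\<^sub>R c *\<^sub>R D (u' t + s *\<^sub>R c *\<^sub>R D (u t))) (at t within {0..})" by simp
  next
    have "FT (a s) = FT b0 + scaleC (of_real s) (FT (\<lambda>x. \<i> * of_real (\<theta> x) * a0 x))"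
      unfolding a_def[abs_def] by (simp add: FT_add FT_cmult L12_cmult L12_theta a0 b0)
    then show "u' 0 + s *\<^sub>R c *\<^sub>R D (u 0) = FT (a s)"
      using associated_symbol[OF c_D a0(2)] by (simp add: a0 b0 scaleC_of_real)
  qed
  \<comment> \<open>Half the sum and half the difference of the two travelling parts recover the
    time derivative and \<open>c D u\<close>. Both are transforms of integrable amplitudes, hence
    continuous.\<close>
  define ut where "ut t x = (1 / 2) * (ft (F 1 t) x + ft (F (-1) t) x)" for t x
  define Du where "Du t x = of_real (1 / (2 * c)) * (ft (F 1 t) x - ft (F (-1) t) x)" for t x
  have crep: "continuous_representative (FT b) (ft b)" if "L12 b" for b
    unfolding continuous_representative_def FT_def
    using that by (auto intro: continuous_ft L12_integrable rep_abs_l2 square_integrable_ft)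
  have "continuous_representative (u' t) (ut t) \<and> continuous_representative (D (u t)) (Du t)" if t: "t \<ge> 0" for t
  proof
    have p: "u' t + c *\<^sub>R D (u t) = FT (F 1 t)" and q: "u' t - c *\<^sub>R D (u t) = FT (F (-1) t)"
      using rep[OF t, of 1] rep[OF t, of "-1"] by simp_all
    let ?f = "\<lambda>x. (1 / 2) * (F 1 t x + F (-1) t x)" and ?g = "\<lambda>x. of_real (1 / (2 * c)) * (F 1 t x - F (-1) t x)"
    have f: "L12 ?f" and g: "L12 ?g" by (intro L12_cmult L12_add L12_diff FL)+
    have "u' t = scaleC (of_real (1 / 2)) (FT (F 1 t) + FT (F (-1) t))"
      unfolding p[symmetric] q[symmetric] scaleC_of_real by (simp add: scaleR_2[symmetric])
    also have "\<dots> = FT ?f"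
      unfolding FT_cmult[OF L12_add[OF FL FL]] FT_add[OF FL FL] by simp
    finally have 1: "u' t = FT ?f" .
    have "D (u t) = scaleC (of_real (1 / (2 * c))) (FT (F 1 t) - FT (F (-1) t))"
      unfolding p[symmetric] q[symmetric] scaleC_of_real using c by (simp add: scaleR_2[symmetric])
    also have "\<dots> = FT ?g" unfolding FT_cmult[OF L12_diff[OF FL FL]] FT_diff[OF FL FL] ..
    finally have 2: "D (u t) = FT ?g" .
    have "ft ?f = ut t"
      unfolding ut_def[abs_def] ft_cmult ft_add[OF FL[THEN L12_integrable] FL[THEN L12_integrable]] ..
    then show "continuous_representative (u' t) (ut t)" using crep[OF f] 1 by simp
    have "ft ?g = Du t"
      unfolding Du_def[abs_def] ft_cmult ft_diff[OF FL[THEN L12_integrable] FL[THEN L12_integrable]] ..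
    then show "continuous_representative (D (u t)) (Du t)" using crep[OF g] 2 by simp
  qed
  moreover have "\<exists>C. \<forall>t>0. (cmod (ut t (x0 + v * t)))\<^sup>2 + c\<^sup>2 * (cmod (Du t (x0 + v * t)))\<^sup>2
                    \<le> C * t powi (- 2 * int l)" if v: "\<bar>v\<bar> > c" for v x0
  proof -
    obtain C1 where C1: "\<And>t. t > 0 \<Longrightarrow> cmod (ft (F 1 t) (x0 + v * t)) \<le> C1 / t ^ l"
      using decay_outside_cone[of 1 v "a 1" x0] v aC unfolding F_def[abs_def] cs by auto
    obtain C2 where C2: "\<And>t. t > 0 \<Longrightarrow> cmod (ft (F (-1) t) (x0 + v * t)) \<le> C2 / t ^ l"
      using decay_outside_cone[of "-1" v "a (-1)" x0] v aC unfolding F_def[abs_def] cs by auto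
    have "(cmod (ut t (x0 + v * t)))\<^sup>2 + c\<^sup>2 * (cmod (Du t (x0 + v * t)))\<^sup>2
        \<le> ((C1\<^sup>2 + C2\<^sup>2) / 2) * t powi (- 2 * int l)" if t: "t > 0" for t
    proof -
      define p q where "p = ft (F 1 t) (x0 + v * t)" and "q = ft (F (-1) t) (x0 + v * t)"
      \<comment> \<open>By the parallelogram law the energy density is the mean of the squared
        moduli of the two parts, which explains the constant and the doubled exponent.\<close>
      have par: "(cmod (p + q))\<^sup>2 + (cmod (p - q))\<^sup>2 = 2 * (cmod p)\<^sup>2 + 2 * (cmod q)\<^sup>2"
        unfolding cmod_power2 by (simp add: power2_eq_square algebra_simps)
      have "(cmod (ut t (x0 + v * t)))\<^sup>2 = (cmod (p + q))\<^sup>2 / 4"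
        by (simp add: ut_def p_def q_def norm_mult norm_divide power_divide)
      moreover have "c\<^sup>2 * (cmod (Du t (x0 + v * t)))\<^sup>2 = (cmod (p - q))\<^sup>2 / 4"
        using c by (simp add: Du_def p_def q_def norm_mult norm_divide power_divide power_mult_distrib)
      ultimately have "(cmod (ut t (x0 + v * t)))\<^sup>2 + c\<^sup>2 * (cmod (Du t (x0 + v * t)))\<^sup>2 = ((cmod p)\<^sup>2 + (cmod q)\<^sup>2) / 2"
        using par by simp
      also have "\<dots> \<le> ((C1 / t ^ l)\<^sup>2 + (C2 / t ^ l)\<^sup>2) / 2"
        using C1[OF t] C2[OF t] unfolding p_def q_def by (intro divide_right_mono add_mono power_mono) auto
      also have "\<dots> = ((C1\<^sup>2 + C2\<^sup>2) / 2) * (1 / t ^ (2 * l))"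
        by (simp add: power_divide power_mult[symmetric] mult.commute[of l] add_divide_distrib)
      also have "1 / t ^ (2 * l) = t powi (- 2 * int l)"
      proof -
        have "t powi (- 2 * int l) = t powi (- int (2 * l))" by simp
        also have "\<dots> = 1 / t ^ (2 * l)" unfolding power_int_minus power_int_of_nat by (simp add: divide_inverse)
        finally show ?thesis by simp
      qed
      finally show ?thesis .
    qed
    then show ?thesis by blast
  qed
  ultimately show ?thesis by blast
qed

end
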